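(* Let $\mathcal{G}$ be the hereditary class of finite simple graphs defined in the context. For every $G\in\mathcal{G}$, subadditivity holds for $G$; that is, if $V(G)=\{x_1,\ldots,x_n\}$, $\mathbb{K}$ is a field and $R=\mathbb{K}[x_1,\ldots,x_n]$, then $t_{a+b}(G)\le t_a(G)+t_b(G)$ for all $a,b\ge 0$ with $a+b\le\operatorname{pd}(R/I(G))$.
   Context: The edge ideal of a graph $G$ on $\{x_1,\ldots,x_n\}$ is $I(G)=(x_ix_j:\{x_i,x_j\}\in E(G))\subset R$, and $t_i(G)=\sup\{j:\beta_{i,j}^R(R/I(G))\neq 0\}$, with $\beta_{i,j}^R$ the graded Betti numbers over the standard graded ring $R$ and $\sup\emptyset=-\infty$. $N_G(v)$ is the set of neighbours of $v$ and $N_G[v]=N_G(v)\cup\{v\}$. For an edge $e$, $G\setminus e$ is the graph with vertex set $V(G)$ and edge set $E(G)\setminus\{e\}$. $C_n$ is the cycle on $n$ vertices. The class $\mathcal{G}$ (closed under taking induced subgraphs) is defined recursively on the number of edges: (0) graphs without edges belong to $\mathcal{G}$, and a disconnected graph belongs to $\mathcal{G}$ if and only if each of its connected components does; a connected graph $G$ with at least one edge belongs to $\mathcal{G}$ if and only if (1) $G=C_n$ for some $n\ge 3$, or (2) $G$ is not a cycle and there exists an edge $e=\{x,y\}\in E(G)$ such that $N_G(x)\subseteq N_G[y]$ and $G\setminus e\in\mathcal{G}$. *)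

theory Defs
  imports Complex_Main "HOL-Library.Poly_Mapping" "HOL-Library.Extended_Nat"
    "HOL-Library.Extended_Real"
begin

section \<open>Finite simple graphs\<close>

text \<open>A graph is given by its vertex set and its set of edges, the edges being two-element sets.\<close>

definition simple_graph :: "'v set \<Rightarrow> 'v set set \<Rightarrow> bool" where
  "simple_graph V E \<longleftrightarrow> finite V \<and> (\<forall>e\<in>E. e \<subseteq> V \<and> card e = 2)"

definition nbrs :: "'v set set \<Rightarrow> 'v \<Rightarrow> 'v set" where
  "nbrs E v = {w. {v, w} \<in> E}"

definition closed_nbrs :: "'v set set \<Rightarrow> 'v \<Rightarrow> 'v set" where
  "closed_nbrs E v = insert v (nbrs E v)"

definition induced_edges :: "'v set set \<Rightarrow> 'v set \<Rightarrow> 'v set set" where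
  "induced_edges E W = {e \<in> E. e \<subseteq> W}"

definition adj :: "'v set set \<Rightarrow> ('v \<times> 'v) set" where
  "adj E = {(u, v). {u, v} \<in> E}"

definition connected_graph :: "'v set \<Rightarrow> 'v set set \<Rightarrow> bool" where
  "connected_graph V E \<longleftrightarrow> V \<noteq> {} \<and> (\<forall>u\<in>V. \<forall>v\<in>V. (u, v) \<in> (adj E)\<^sup>*)"

definition components :: "'v set \<Rightarrow> 'v set set \<Rightarrow> 'v set set" where
  "components V E = (\<lambda>u. {v \<in> V. (u, v) \<in> (adj E)\<^sup>*}) ` V"

definition cycle_graph :: "'v set \<Rightarrow> 'v set set \<Rightarrow> bool" where
  "cycle_graph V E \<longleftrightarrow> (\<exists>(n::nat) f. n \<ge> 3 \<and> bij_betw f {..<n} V \<and>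
     E = {{f i, f ((i + 1) mod n)} | i. i < n})"

text \<open>The recursion of the definition is well-founded, so the inductive (least) predicate is the
  class itself; the "only if" directions are the lemmas below. That the class is closed under induced
  subgraphs is a consequence, not a further requirement.\<close>

inductive graph_class :: "'v set \<Rightarrow> 'v set set \<Rightarrow> bool" where
  edgeless: "simple_graph V {} \<Longrightarrow> graph_class V {}"
| disconnected: "simple_graph V E \<Longrightarrow> \<not> connected_graph V E \<Longrightarrow>
    (\<And>C. C \<in> components V E \<Longrightarrow> graph_class C (induced_edges E C)) \<Longrightarrow> graph_class V E"
| is_cycle: "simple_graph V E \<Longrightarrow> connected_graph V E \<Longrightarrow> cycle_graph V E \<Longrightarrow> graph_class V E"
| delete_edge: "simple_graph V E \<Longrightarrow> connected_graph V E \<Longrightarrow> \<not> cycle_graph V E \<Longrightarrow>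
    {x, y} \<in> E \<Longrightarrow> nbrs E x \<subseteq> closed_nbrs E y \<Longrightarrow> graph_class V (E - {{x, y}}) \<Longrightarrow>
    graph_class V E"

lemma graph_class_simple_graph: "graph_class V E \<Longrightarrow> simple_graph V E"
  by (induction rule: graph_class.induct) auto

lemma graph_class_connected_iff:
  assumes "simple_graph V E" "connected_graph V E" "E \<noteq> {}"
  shows "graph_class V E \<longleftrightarrow> cycle_graph V E \<or>
    \<not> cycle_graph V E \<and>
      (\<exists>x y. {x, y} \<in> E \<and> nbrs E x \<subseteq> closed_nbrs E y \<and> graph_class V (E - {{x, y}}))"
    (is "_ \<longleftrightarrow> ?rhs")
proof
  assume "graph_class V E"
  then show ?rhs
  proof cases
    case edgeless
    with assms(3) show ?thesis by simp
  next
    case disconnected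
    with assms(2) show ?thesis by simp
  next
    case is_cycle
    then show ?thesis by simp
  next
    case (delete_edge x y)
    show ?thesis by (rule disjI2) (use delete_edge in blast)
  qed
next
  assume ?rhs
  then show "graph_class V E"
    using graph_class.is_cycle[OF assms(1,2)] graph_class.delete_edge[OF assms(1,2)] by metis
qed

lemma graph_class_disconnected_iff:
  assumes "simple_graph V E" "\<not> connected_graph V E"
  shows "graph_class V E \<longleftrightarrow> (\<forall>C\<in>components V E. graph_class C (induced_edges E C))"
proof
  assume "graph_class V E"
  then show "\<forall>C\<in>components V E. graph_class C (induced_edges E C)"
  proof cases
    case edgeless
    have "graph_class C (induced_edges E C)" if "C \<in> components V E" for C
    proof -
      have "C \<subseteq> V" using that by (auto simp: components_def)
      then have "simple_graph C {}"
        using assms(1) by (auto simp: simple_graph_def intro: finite_subset)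
      then show ?thesis
        using edgeless by (simp add: induced_edges_def graph_class.edgeless)
    qed
    then show ?thesis by blast
  next
    case disconnected
    then show ?thesis by blast
  next
    case is_cycle
    with assms(2) show ?thesis by simp
  next
    case delete_edge
    with assms(2) show ?thesis by simp
  qed
next
  assume "\<forall>C\<in>components V E. graph_class C (induced_edges E C)"
  then show "graph_class V E"
    by (intro graph_class.disconnected[OF assms]) simp
qed

section \<open>Polynomial rings and edge ideals\<close>

text \<open>Monomials are finitely supported exponent functions and polynomials are finitely supported
  coefficient functions on monomials. The polynomial ring over the field \<open>'k\<close> in the variables
  indexed by \<open>V\<close> is a subring of this type.\<close>

type_synonym ('v, 'k) mpolynomial = "('v \<Rightarrow>\<^sub>0 nat) \<Rightarrow>\<^sub>0 'k"

definition poly_ring :: "'v set \<Rightarrow> ('v, 'k::field) mpolynomial set" where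
  "poly_ring V = {p. \<forall>m\<in>Poly_Mapping.keys p. Poly_Mapping.keys m \<subseteq> V}"

definition pvar :: "'v \<Rightarrow> ('v, 'k::field) mpolynomial" where
  "pvar v = Poly_Mapping.single (Poly_Mapping.single v 1) 1"

definition mdeg :: "('v \<Rightarrow>\<^sub>0 nat) \<Rightarrow> nat" where
  "mdeg m = (\<Sum>v\<in>Poly_Mapping.keys m. Poly_Mapping.lookup m v)"

definition homogeneous :: "int \<Rightarrow> ('v, 'k::field) mpolynomial \<Rightarrow> bool" where
  "homogeneous d p \<longleftrightarrow> (\<forall>m\<in>Poly_Mapping.keys p. int (mdeg m) = d)"

definition edge_ideal :: "'v set \<Rightarrow> 'v set set \<Rightarrow> ('v, 'k::field) mpolynomial set" where
  "edge_ideal V E = {\<Sum>e\<in>E. c e * (\<Prod>v\<in>e. pvar v) | c. \<forall>e\<in>E. c e \<in> poly_ring V}"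

section \<open>Graded free resolutions and graded Betti numbers\<close>

text \<open>A record \<open>F\<close> describes a sequence of graded free modules of finite rank over
  \<open>R = poly_ring V\<close> and maps
  \[\cdots \to F_2 \to F_1 \to F_0 \to R/I.\]
  \<open>F_i\<close> has the basis \<open>e_0, \<dots>, e_{r-1}\<close> with \<open>r = rank F i\<close>, where \<open>e_l\<close> has degree
  \<open>shift F i l\<close>. The polynomial \<open>bd F i k l\<close> is the \<open>k\<close>-th coordinate of the image in \<open>F_i\<close> of the
  \<open>l\<close>-th basis element of \<open>F_{i+1}\<close>, and \<open>aug F l\<close> represents the image in \<open>R/I\<close> of the \<open>l\<close>-th
  basis element of \<open>F_0\<close>. Values outside these index ranges are irrelevant.\<close>

record (overloaded) ('v, 'k) graded_free_complex =
  rank :: "nat \<Rightarrow> nat"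
  shift :: "nat \<Rightarrow> nat \<Rightarrow> int"
  bd :: "nat \<Rightarrow> nat \<Rightarrow> nat \<Rightarrow> ('v, 'k) mpolynomial"
  aug :: "nat \<Rightarrow> ('v, 'k) mpolynomial"

definition free_module :: "'v set \<Rightarrow> nat \<Rightarrow> (nat \<Rightarrow> ('v, 'k::field) mpolynomial) set" where
  "free_module V r = {a. (\<forall>k<r. a k \<in> poly_ring V) \<and> (\<forall>k\<ge>r. a k = 0)}"

definition bd_map :: "('v, 'k::field) graded_free_complex \<Rightarrow> nat \<Rightarrow>
    (nat \<Rightarrow> ('v, 'k) mpolynomial) \<Rightarrow> nat \<Rightarrow> ('v, 'k) mpolynomial" where
  "bd_map F i a = (\<lambda>k. if k < rank F i then \<Sum>l<rank F (Suc i). bd F i k l * a l else 0)"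

definition aug_map :: "('v, 'k::field) graded_free_complex \<Rightarrow>
    (nat \<Rightarrow> ('v, 'k) mpolynomial) \<Rightarrow> ('v, 'k) mpolynomial" where
  "aug_map F a = (\<Sum>l<rank F 0. aug F l * a l)"

text \<open>The maps are homogeneous of degree 0, the augmentation is onto \<open>R/I\<close>, and the sequence is
  exact at every \<open>F_i\<close>.\<close>

definition graded_free_resolution ::
    "'v set \<Rightarrow> ('v, 'k::field) mpolynomial set \<Rightarrow> ('v, 'k) graded_free_complex \<Rightarrow> bool" where
  "graded_free_resolution V I F \<longleftrightarrow>
     (\<forall>l<rank F 0. aug F l \<in> poly_ring V \<and> homogeneous (shift F 0 l) (aug F l)) \<and>
     (\<forall>i. \<forall>k<rank F i. \<forall>l<rank F (Suc i).
        bd F i k l \<in> poly_ring V \<and>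
        homogeneous (shift F (Suc i) l - shift F i k) (bd F i k l)) \<and>
     (\<forall>p\<in>poly_ring V. \<exists>a\<in>free_module V (rank F 0). p - aug_map F a \<in> I) \<and>
     (\<forall>a\<in>free_module V (rank F 0).
        aug_map F a \<in> I \<longleftrightarrow> a \<in> bd_map F 0 ` free_module V (rank F 1)) \<and>
     (\<forall>i. \<forall>a\<in>free_module V (rank F (Suc i)).
        bd_map F i a = (\<lambda>_. 0) \<longleftrightarrow>
        a \<in> bd_map F (Suc i) ` free_module V (rank F (Suc (Suc i))))"

text \<open>Minimality: the image of \<open>F_{i+1}\<close> lies in the product of \<open>F_i\<close> with the ideal generated by
  the variables, that is, no entry of a differential has a constant term.\<close>

definition minimal_graded_free_resolution ::
    "'v set \<Rightarrow> ('v, 'k::field) mpolynomial set \<Rightarrow> ('v, 'k) graded_free_complex \<Rightarrow> bool" where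
  "minimal_graded_free_resolution V I F \<longleftrightarrow> graded_free_resolution V I F \<and>
     (\<forall>i. \<forall>k<rank F i. \<forall>l<rank F (Suc i). Poly_Mapping.lookup (bd F i k l) 0 = 0)"

text \<open>The number of summands \<open>R(-j)\<close> of \<open>F_i\<close> in the minimal graded free resolution of \<open>R/I\<close>,
  which exists for homogeneous \<open>I\<close> and is unique up to isomorphism.\<close>

definition graded_betti ::
    "'v set \<Rightarrow> ('v, 'k::field) mpolynomial set \<Rightarrow> nat \<Rightarrow> int \<Rightarrow> nat" where
  "graded_betti V I i j =
     (let F = (SOME F. minimal_graded_free_resolution V I F)
      in card {l. l < rank F i \<and> shift F i l = j})"

text \<open>In \<^typ>\<open>ereal\<close> the supremum of the empty set is \<open>-\<infinity>\<close>.\<close>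

definition max_shift :: "'v set \<Rightarrow> ('v, 'k::field) mpolynomial set \<Rightarrow> nat \<Rightarrow> ereal" where
  "max_shift V I i = (SUP j\<in>{j. graded_betti V I i j \<noteq> 0}. ereal (real_of_int j))"

text \<open>The projective dimension of \<open>R/I\<close>, as the least length of a graded free resolution; over
  \<open>poly_ring V\<close> finitely generated graded projective modules are free.\<close>

definition proj_dim :: "'v set \<Rightarrow> ('v, 'k::field) mpolynomial set \<Rightarrow> enat" where
  "proj_dim V I =
     (INF F\<in>{F. graded_free_resolution V I F}. SUP i\<in>{i. rank F i \<noteq> 0}. enat i)"

end

theory Submission
  imports Defs "HOL-Library.Function_Algebras"
begin

text \<open>
  The Betti number \<open>\<beta>\<^sub>i\<^sub>,\<^sub>j\<close> of \<open>R/I(G)\<close> is nonzero iff the Koszul homology \<open>H\<^sub>i(R/I(G))\<close> is nonzero in some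
  squarefree multidegree \<open>\<sigma>\<close> with \<open>j\<close> elements, and this only depends on the induced subgraph on \<open>\<sigma>\<close>.
  Hence it suffices to show: if the homology is nonzero in homological degree \<open>a + b\<close> at \<open>\<sigma>\<close>, then
  there are \<open>\<sigma>1, \<sigma>2 \<subseteq> \<sigma>\<close> with nonzero homology in degrees \<open>a\<close> and \<open>b\<close> and \<open>|\<sigma>| \<le> |\<sigma>1| + |\<sigma>2|\<close>.

  If \<open>e = {x, y}\<close> is an edge with \<open>N(x) \<subseteq> N[y]\<close>, then \<open>I(G - e) : xy = I(G - e) : y\<close>, so that
  multiplication by \<open>xy\<close> is zero on Koszul homology. The resulting short exact sequence shows that the
  homology of \<open>G\<close> at \<open>\<sigma>\<close> is that of \<open>G - e\<close>, or arises from \<open>\<sigma> - N[y]\<close> by a shift of the homological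
  degree by the degree \<open>d\<close> of \<open>y\<close> in \<open>\<sigma>\<close>. In the second case the claim at \<open>\<sigma> - N[y]\<close> yields \<open>\<tau>1\<close> and
  \<open>\<tau>2\<close>, and distributing \<open>d\<close> over the two degrees means adding to them \<open>y\<close> together with some
  neighbours of \<open>y\<close>. For cycles, removing a vertex leaves paths, whose homology is computed by the same
  recursion.
\<close>

section \<open>Koszul complexes\<close>

text \<open>Subadditivity compares only supports of Betti numbers, so no dimension is computed:
  \<open>hom_nz\<close> records nonvanishing, and the long exact sequence is used through single
  implications. As \<open>graded_betti\<close> refers to an arbitrarily chosen minimal resolution,
  one has to be constructed, and in every one of them the degrees of the generators have to be
  recovered from Koszul homology, by dimension shifting along the syzygies.

  The inequality on cardinalities has just enough slack. For d = c1 + c2, each positive ci is paid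
  with ci neighbours of y and y itself, while only d + 1 vertices of \<sigma> have to be replaced; y
  may be used twice. The edge still splits on the enlarged sets if x is among the chosen neighbours,
  and x may be used twice as well. Removing a full cycle lowers the homological degree by the
  integer part H of (2n + 1)/3. A path on ceil(3q/2) vertices accounts for the degree q and leaves
  out a vertex of the cycle if q < H. Since 3H >= 2n - 1, two such paths whose degrees add up to H
  have at least n vertices together.\<close>

definition sgn_act :: "nat \<Rightarrow> 'm::ab_group_add \<Rightarrow> 'm" where
  "sgn_act n m = (if even n then m else - m)"

lemma sgn_act_zero [simp]: "sgn_act n 0 = 0"
  by (simp add: sgn_act_def)

lemma sact_0 [simp]: "sgn_act 0 m = m"
  by (simp add: sgn_act_def)

lemma sgn_act_add: "sgn_act n (a + b) = sgn_act n a + sgn_act n b"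
  by (simp add: sgn_act_def)

lemma sgn_act_diff: "sgn_act n (a - b) = sgn_act n a - sgn_act n b"
  by (simp add: sgn_act_def)

lemma sgn_act_sact: "sgn_act m (sgn_act n a) = sgn_act (m + n) a"
  by (simp add: sgn_act_def)

lemma sgn_act_twice [simp]: "sgn_act n (sgn_act n a) = a"
  by (simp add: sgn_act_def)

lemma sgn_act_minus: "sgn_act n (- a) = - sgn_act n a"
  by (simp add: sgn_act_def)

lemma sgn_act_sum: "sgn_act n (sum f B) = (\<Sum>x\<in>B. sgn_act n (f x))"
  by (simp add: sgn_act_def sum_negf)

lemma sgn_act_Suc: "sgn_act (Suc n) a = - sgn_act n a"
  by (simp add: sgn_act_def)

text \<open>The exponent of the sign with which the exterior factor \<open>v\<close> passes those of
  \<open>A\<close>. Signs need an order on the vertices; any injective numbering \<open>ord\<close>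
  serves.\<close>

definition below :: "('v \<Rightarrow> nat) \<Rightarrow> 'v \<Rightarrow> 'v set \<Rightarrow> nat" where
  "below ord v A = card {w\<in>A. ord w < ord v}"

lemma below_insert:
  assumes "finite A" "w \<notin> A"
  shows "below ord v (insert w A) = (if ord w < ord v then Suc (below ord v A) else below ord v A)"
proof (cases "ord w < ord v")
  case True
  then have "{u \<in> insert w A. ord u < ord v} = insert w {u\<in>A. ord u < ord v}" by auto
  with True assms show ?thesis by (simp add: below_def)
next
  case False
  then have "{u \<in> insert w A. ord u < ord v} = {u\<in>A. ord u < ord v}" by auto
  with False show ?thesis by (simp add: below_def)
qed

lemma below_Un:
  assumes "finite A" "finite B" "A \<inter> B = {}"
  shows "below ord v (A \<union> B) = below ord v A + below ord v B"
proof -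
  have "{u \<in> A \<union> B. ord u < ord v} = {u\<in>A. ord u < ord v} \<union> {u\<in>B. ord u < ord v}" by auto
  moreover have "{u\<in>A. ord u < ord v} \<inter> {u\<in>B. ord u < ord v} = {}" using assms(3) by auto
  ultimately show ?thesis using assms(1,2) by (simp add: below_def card_Un_disjoint)
qed

text \<open>The two orders of inserting \<open>v\<close> and \<open>w\<close> produce exponents of
  opposite parity; this is the cancellation behind \<open>K_K\<close>.\<close>

lemma below_swap:
  assumes "finite A" "v \<notin> A" "w \<notin> A" "ord v < ord w"
  shows "below ord w A + below ord v (insert w A) = below ord v A + below ord w A"
    and "below ord v A + below ord w (insert v A) = Suc (below ord v A + below ord w A)"
  using assms by (auto simp: below_insert)

text \<open>Each ordered pair with \<open>ord v < ord w\<close> cancels against its swap, and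
  injectivity of \<open>ord\<close> leaves no other pairs.\<close>

lemma sum_antisym_pairs:
  fixes T :: "'v \<Rightarrow> 'v \<Rightarrow> 'm::ab_group_add" and ord :: "'v \<Rightarrow> nat"
  assumes "finite B" "inj_on ord B"
    and T: "\<And>v w. v \<in> B \<Longrightarrow> w \<in> B \<Longrightarrow> ord v < ord w \<Longrightarrow> T v w = - T w v"
  shows "(\<Sum>v\<in>B. \<Sum>w\<in>B - {v}. T v w) = 0"
proof -
  let ?P = "SIGMA v:B. B - {v}"
  let ?L = "{p\<in>?P. ord (fst p) < ord (snd p)}" and ?G = "{p\<in>?P. ord (snd p) < ord (fst p)}"
  have fin: "finite ?P" using assms(1) by auto
  have P: "?P = ?L \<union> ?G" using assms(2) by (fastforce simp: inj_on_def)
  have "(\<Sum>v\<in>B. \<Sum>w\<in>B - {v}. T v w) = (\<Sum>p\<in>?P. T (fst p) (snd p))"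
    using assms(1) by (subst sum.Sigma) (auto simp: case_prod_unfold)
  also have "\<dots> = (\<Sum>p\<in>?L \<union> ?G. T (fst p) (snd p))" using P by simp
  also have "\<dots> = (\<Sum>p\<in>?L. T (fst p) (snd p)) + (\<Sum>p\<in>?G. T (fst p) (snd p))"
    by (rule sum.union_disjoint) (use fin in auto)
  also have "(\<Sum>p\<in>?G. T (fst p) (snd p)) = (\<Sum>p\<in>?L. T (snd p) (fst p))"
    by (rule sum.reindex_bij_witness[where i = prod.swap and j = prod.swap]) auto
  also have "(\<Sum>p\<in>?L. T (fst p) (snd p)) + \<dots> = (\<Sum>p\<in>?L. T (fst p) (snd p) + T (snd p) (fst p))"
    by (simp add: sum.distrib)
  also have "\<dots> = 0" using T by (intro sum.neutral) auto
  finally show ?thesis .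
qed

text \<open>The Koszul differential, coefficient by coefficient: the exterior basis elements that
  reach \<open>A\<close> are those of \<open>A\<close> with one vertex added, and \<open>X v\<close>
  is the action of the variable. A chain is a function on all subsets, so the homological degree
  enters only through \<open>chain\<close>, \<open>cycle\<close> and
  \<open>boundary\<close>.\<close>

definition koszul_d :: "('v \<Rightarrow> nat) \<Rightarrow> 'v set \<Rightarrow> ('v \<Rightarrow> 'm::ab_group_add \<Rightarrow> 'm) \<Rightarrow> ('v set \<Rightarrow> 'm) \<Rightarrow> 'v set \<Rightarrow> 'm" where
  "koszul_d ord V X c A = (\<Sum>v\<in>V - A. sgn_act (below ord v A) (X v (c (insert v A))))"

definition chain :: "'v set \<Rightarrow> ('v set \<Rightarrow> 'm set) \<Rightarrow> nat \<Rightarrow> ('v set \<Rightarrow> 'm) \<Rightarrow> bool" where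
  "chain V S p c \<longleftrightarrow> (\<forall>A. A \<subseteq> V \<longrightarrow> card A = p \<longrightarrow> c A \<in> S A)"

text \<open>A representative of a cycle in the quotient by \<open>T\<close>. The cardinality
  \<open>p - 1\<close> is expressed with \<open>Suc\<close>, which makes the condition void for
  \<open>p = 0\<close>.\<close>

definition cycle :: "('v \<Rightarrow> nat) \<Rightarrow> 'v set \<Rightarrow> ('v \<Rightarrow> 'm::ab_group_add \<Rightarrow> 'm) \<Rightarrow> ('v set \<Rightarrow> 'm set) \<Rightarrow> nat
    \<Rightarrow> ('v set \<Rightarrow> 'm) \<Rightarrow> bool" where
  "cycle ord V X T p c \<longleftrightarrow> (\<forall>A. A \<subseteq> V \<longrightarrow> Suc (card A) = p \<longrightarrow> koszul_d ord V X c A \<in> T A)"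

definition boundary :: "('v \<Rightarrow> nat) \<Rightarrow> 'v set \<Rightarrow> ('v \<Rightarrow> 'm::ab_group_add \<Rightarrow> 'm) \<Rightarrow> ('v set \<Rightarrow> 'm set)
    \<Rightarrow> ('v set \<Rightarrow> 'm set) \<Rightarrow> nat \<Rightarrow> ('v set \<Rightarrow> 'm) \<Rightarrow> bool" where
  "boundary ord V X S T p c \<longleftrightarrow>
     (\<exists>d. chain V S (Suc p) d \<and> chain V T p (\<lambda>A. c A - koszul_d ord V X d A))"

text \<open>Nonvanishing of the \<open>p\<close>-th homology of the Koszul complex with coefficients in \<open>S/T\<close>. A chain
  assigns to every \<open>p\<close>-subset \<open>A\<close> of \<open>V\<close> the coefficient of the exterior basis element indexed by \<open>A\<close>.
  The coefficient groups may depend on \<open>A\<close>, which allows the restriction to a single degree or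
  multidegree.\<close>

definition hom_nz :: "('v \<Rightarrow> nat) \<Rightarrow> 'v set \<Rightarrow> ('v \<Rightarrow> 'm::ab_group_add \<Rightarrow> 'm) \<Rightarrow> ('v set \<Rightarrow> 'm set)
    \<Rightarrow> ('v set \<Rightarrow> 'm set) \<Rightarrow> nat \<Rightarrow> bool" where
  "hom_nz ord V X S T p \<longleftrightarrow>
     (\<exists>c. chain V S p c \<and> cycle ord V X T p c \<and> \<not> boundary ord V X S T p c)"

text \<open>Closure is asked along the moves of the differential, from \<open>insert v A\<close> to
  \<open>A\<close>; the groups for different \<open>A\<close> may therefore be graded pieces of
  different degrees.\<close>

definition subfam :: "'v set \<Rightarrow> ('v \<Rightarrow> 'm::ab_group_add \<Rightarrow> 'm) \<Rightarrow> ('v set \<Rightarrow> 'm set) \<Rightarrow> bool" where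
  "subfam V X U \<longleftrightarrow>
     (\<forall>A. A \<subseteq> V \<longrightarrow> 0 \<in> U A \<and> (\<forall>a\<in>U A. \<forall>b\<in>U A. a + b \<in> U A \<and> a - b \<in> U A)) \<and>
     (\<forall>A. A \<subseteq> V \<longrightarrow> (\<forall>v\<in>V - A. \<forall>m\<in>U (insert v A). X v m \<in> U A))"

lemma subfam_zero: "subfam V X U \<Longrightarrow> A \<subseteq> V \<Longrightarrow> 0 \<in> U A"
  and subfam_add: "subfam V X U \<Longrightarrow> A \<subseteq> V \<Longrightarrow> a \<in> U A \<Longrightarrow> b \<in> U A \<Longrightarrow> a + b \<in> U A"
  and subfam_diff: "subfam V X U \<Longrightarrow> A \<subseteq> V \<Longrightarrow> a \<in> U A \<Longrightarrow> b \<in> U A \<Longrightarrow> a - b \<in> U A"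
  and subfam_X: "subfam V X U \<Longrightarrow> A \<subseteq> V \<Longrightarrow> v \<in> V - A \<Longrightarrow> m \<in> U (insert v A) \<Longrightarrow> X v m \<in> U A"
  by (simp_all add: subfam_def)

lemma subfam_sgn_act: "subfam V X U \<Longrightarrow> A \<subseteq> V \<Longrightarrow> a \<in> U A \<Longrightarrow> sgn_act n a \<in> U A"
  using subfam_diff[of V X U A 0 a] by (auto simp: sgn_act_def subfam_zero)

lemma subfam_sum:
  assumes "subfam V X U" "A \<subseteq> V" "\<And>x. x \<in> B \<Longrightarrow> f x \<in> U A"
  shows "sum f B \<in> U A"
  using assms(3)
  by (induction B rule: infinite_finite_induct)
     (auto simp: subfam_zero[OF assms(1,2)] intro: subfam_add[OF assms(1,2)])

lemma koszul_d_closed: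
  assumes "subfam V X U" "A \<subseteq> V" "\<And>v. v \<in> V - A \<Longrightarrow> c (insert v A) \<in> U (insert v A)"
  shows "koszul_d ord V X c A \<in> U A"
  unfolding koszul_d_def
  by (rule subfam_sum[OF assms(1,2)], rule subfam_sgn_act[OF assms(1,2)], rule subfam_X[OF assms(1,2)])
     (use assms(3) in auto)

lemma koszul_d_chain:
  assumes "finite V" "subfam V X U" "chain V U (Suc p) c"
  shows "chain V U p (koszul_d ord V X c)"
  unfolding chain_def
proof (intro allI impI)
  fix A assume A: "A \<subseteq> V" "card A = p"
  then have "finite A" using assms(1) finite_subset by auto
  then show "koszul_d ord V X c A \<in> U A"
    using A assms(3) by (intro koszul_d_closed[OF assms(2) A(1)]) (auto simp: chain_def)
qed

lemma chain_mono: "chain V T p c \<Longrightarrow> (\<And>A. A \<subseteq> V \<Longrightarrow> T A \<subseteq> S A) \<Longrightarrow> chain V S p c"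
  by (auto simp: chain_def)

lemma chain_diff:
  assumes "subfam V X S" "chain V S p c" "chain V S p d"
  shows "chain V S p (\<lambda>A. c A - d A)"
  using assms(2,3) subfam_diff[OF assms(1)] by (simp add: chain_def)

lemma chain_add:
  assumes "subfam V X S" "chain V S p c" "chain V S p d"
  shows "chain V S p (\<lambda>A. c A + d A)"
  using assms(2,3) subfam_add[OF assms(1)] by (simp add: chain_def)

section \<open>The differential and the long exact sequence of homology\<close>

locale koszul =
  fixes ord :: "'v \<Rightarrow> nat" and V :: "'v set" and X :: "'v \<Rightarrow> 'm::ab_group_add \<Rightarrow> 'm"
  assumes finV: "finite V" and inj_ord: "inj_on ord V"
    and X_add: "X v (a + b) = X v a + X v b"
    and X_comm: "X v (X w a) = X w (X v a)"
begin

lemma X_zero [simp]: "X v 0 = 0"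
  using X_add[of v 0 0] by simp

lemma X_minus: "X v (- a) = - X v a"
  using X_add[of v a "- a"] by (simp add: eq_neg_iff_add_eq_0 add.commute)

lemma X_diff: "X v (a - b) = X v a - X v b"
  using X_add[of v a "- b"] by (simp add: X_minus)

lemma X_sgn_act: "X v (sgn_act n a) = sgn_act n (X v a)"
  by (simp add: sgn_act_def X_minus)

lemma X_sum: "X v (sum f B) = (\<Sum>x\<in>B. X v (f x))"
  by (induction B rule: infinite_finite_induct) (auto simp: X_add)

abbreviation "K \<equiv> koszul_d ord V X"

lemma K_add: "K (\<lambda>A. c A + d A) A = K c A + K d A"
  by (simp add: koszul_d_def X_add sgn_act_add sum.distrib)

lemma K_diff: "K (\<lambda>A. c A - d A) A = K c A - K d A"
  by (simp add: koszul_d_def X_diff sgn_act_diff sum_subtractf)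

lemma K_K:
  assumes "A \<subseteq> V"
  shows "K (K c) A = 0"
proof -
  have finA: "finite A" using assms finV finite_subset by auto
  define T where "T v w = sgn_act (below ord v A + below ord w (insert v A))
    (X v (X w (c (insert w (insert v A)))))" for v w
  have "K (K c) A = (\<Sum>v\<in>V - A. \<Sum>w\<in>(V - A) - {v}. T v w)"
    unfolding koszul_d_def
  proof (rule sum.cong[OF refl])
    fix v assume "v \<in> V - A"
    have "V - insert v A = V - A - {v}" by auto
    then show "sgn_act (below ord v A) (X v (\<Sum>w\<in>V - insert v A. sgn_act (below ord w (insert v A)) (X w (c (insert w (insert v A))))))
       = (\<Sum>w\<in>V - A - {v}. T v w)"
      by (simp add: X_sum sgn_act_sum X_sgn_act sgn_act_sact T_def)
  qed
  also have "\<dots> = 0"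
  proof (rule sum_antisym_pairs[of _ ord])
    show "finite (V - A)" "inj_on ord (V - A)" using finV inj_ord by (auto intro: inj_on_diff)
    fix v w assume vw: "v \<in> V - A" "w \<in> V - A" "ord v < ord w"
    have "T v w = - sgn_act (below ord v A + below ord w A) (X v (X w (c (insert w (insert v A)))))"
      unfolding T_def using below_swap(2)[OF finA, of v w ord] vw by (simp add: sgn_act_Suc)
    moreover have "T w v = sgn_act (below ord v A + below ord w A) (X w (X v (c (insert v (insert w A)))))"
      unfolding T_def using below_swap(1)[OF finA, of v w ord] vw by (simp add: add.commute)
    ultimately show "T v w = - T w v" by (simp add: X_comm insert_commute)
  qed
  finally show ?thesis .
qed

text \<open>For 0 -> T/U -> S/U -> S/T -> 0 this is exactness at the homology of S/T: a class killed
  by the connecting map lifts to S/U.\<close>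

lemma les_connecting:
  assumes fam: "subfam V X S" "subfam V X T" "subfam V X U"
    and le: "\<And>A. A \<subseteq> V \<Longrightarrow> U A \<subseteq> T A" "\<And>A. A \<subseteq> V \<Longrightarrow> T A \<subseteq> S A"
    and "hom_nz ord V X S T (Suc p)"
  shows "hom_nz ord V X S U (Suc p) \<or> hom_nz ord V X T U p"
proof (rule ccontr)
  assume neg: "\<not> ?thesis"
  obtain c where c: "chain V S (Suc p) c" "cycle ord V X T (Suc p) c" "\<not> boundary ord V X S T (Suc p) c"
    using assms(6) by (auto simp: hom_nz_def)
  have "chain V T p (K c)" using c(2) by (simp add: chain_def cycle_def)
  moreover have "cycle ord V X U p (K c)"
    using subfam_zero[OF fam(3)] by (simp add: cycle_def K_K)
  ultimately have "boundary ord V X T U p (K c)" using neg by (auto simp: hom_nz_def)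
  then obtain k where k: "chain V T (Suc p) k" "chain V U p (\<lambda>A. K c A - K k A)"
    by (auto simp: boundary_def)
  \<comment> \<open>Subtracting \<open>k\<close> does not change the class modulo \<open>T\<close>
    and turns \<open>c\<close> into a cycle modulo \<open>U\<close>.\<close>
  have "chain V S (Suc p) (\<lambda>A. c A - k A)"
    by (rule chain_diff[OF fam(1) c(1) chain_mono[OF k(1) le(2)]])
  moreover have "cycle ord V X U (Suc p) (\<lambda>A. c A - k A)"
    using k(2) by (auto simp: cycle_def chain_def K_diff)
  ultimately have "boundary ord V X S U (Suc p) (\<lambda>A. c A - k A)" using neg by (auto simp: hom_nz_def)
  then obtain d where d: "chain V S (Suc (Suc p)) d" "chain V U (Suc p) (\<lambda>A. c A - k A - K d A)"
    by (auto simp: boundary_def)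
  have "chain V T (Suc p) (\<lambda>A. c A - K d A)"
    unfolding chain_def
  proof (intro allI impI)
    fix A assume A: "A \<subseteq> V" "card A = Suc p"
    have "k A \<in> T A" "c A - k A - K d A \<in> T A"
      using A k(1) d(2) le(1)[of A] by (auto simp: chain_def)
    then have "k A + (c A - k A - K d A) \<in> T A" using subfam_add[OF fam(2)] A by blast
    then show "c A - K d A \<in> T A" by simp
  qed
  then show False using c(3) d(1) by (auto simp: boundary_def)
qed

text \<open>In degree 0 every chain is a cycle, so the homology of S/U maps onto that of
  S/T.\<close>

lemma les_zero:
  assumes le: "\<And>A. A \<subseteq> V \<Longrightarrow> U A \<subseteq> T A" and "hom_nz ord V X S T 0"
  shows "hom_nz ord V X S U 0"
proof -
  obtain c where c: "chain V S 0 c" "\<not> boundary ord V X S T 0 c"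
    using assms(2) by (auto simp: hom_nz_def)
  have "\<not> boundary ord V X S U 0 c"
  proof
    assume "boundary ord V X S U 0 c"
    then obtain d where d: "chain V S (Suc 0) d" "chain V U 0 (\<lambda>A. c A - K d A)"
      by (auto simp: boundary_def)
    from chain_mono[OF d(2) le] d(1) c(2) show False by (simp add: boundary_def)
  qed
  with c(1) show ?thesis by (auto simp: hom_nz_def cycle_def)
qed

text \<open>The assumption \<open>zm\<close> says that the map from the homology of T/U to that of
  S/U is zero in degree \<open>p\<close>. By exactness every class of T/U then comes from the
  connecting map, and the chain \<open>f\<close> that bounds it in \<open>S\<close> is a
  preimage.\<close>

lemma les_zero_map_lift:
  assumes fam: "subfam V X S" "subfam V X T" "subfam V X U"
    and le: "\<And>A. A \<subseteq> V \<Longrightarrow> U A \<subseteq> T A" "\<And>A. A \<subseteq> V \<Longrightarrow> T A \<subseteq> S A"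
    and zm: "\<And>c. chain V T p c \<Longrightarrow> cycle ord V X U p c \<Longrightarrow> boundary ord V X S U p c"
    and "hom_nz ord V X T U p"
  shows "hom_nz ord V X S T (Suc p)"
proof -
  obtain k where k: "chain V T p k" "cycle ord V X U p k" "\<not> boundary ord V X T U p k"
    using assms(7) by (auto simp: hom_nz_def)
  obtain f where f: "chain V S (Suc p) f" "chain V U p (\<lambda>A. k A - K f A)"
    using zm[OF k(1,2)] by (auto simp: boundary_def)
  have cyc: "cycle ord V X T (Suc p) f"
    unfolding cycle_def
  proof (intro allI impI)
    fix A assume A: "A \<subseteq> V" "Suc (card A) = Suc p"
    have "k A - K f A \<in> T A" "k A \<in> T A"
      using A f(2) k(1) le(1)[of A] by (auto simp: chain_def)
    then have "k A - (k A - K f A) \<in> T A" using subfam_diff[OF fam(2)] A by blast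
    then show "K f A \<in> T A" by simp
  qed
  have "\<not> boundary ord V X S T (Suc p) f"
  proof
    assume "boundary ord V X S T (Suc p) f"
    then obtain g where g: "chain V S (Suc (Suc p)) g" "chain V T (Suc p) (\<lambda>A. f A - K g A)"
      by (auto simp: boundary_def)
    have "chain V U p (\<lambda>A. k A - K (\<lambda>A. f A - K g A) A)"
      using f(2) by (simp add: chain_def K_diff K_K)
    with g(2) k(3) show False by (auto simp: boundary_def)
  qed
  with f(1) cyc show ?thesis by (auto simp: hom_nz_def)
qed

text \<open>When the map from the homology of T/U is zero, the homology of S/U embeds into that of
  S/T.\<close>

lemma les_zero_map_restrict:
  assumes fam: "subfam V X S" "subfam V X T" "subfam V X U"
    and le: "\<And>A. A \<subseteq> V \<Longrightarrow> U A \<subseteq> T A" "\<And>A. A \<subseteq> V \<Longrightarrow> T A \<subseteq> S A"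
    and zm: "\<And>c. chain V T p c \<Longrightarrow> cycle ord V X U p c \<Longrightarrow> boundary ord V X S U p c"
    and "hom_nz ord V X S U p"
  shows "hom_nz ord V X S T p"
proof -
  obtain f where f: "chain V S p f" "cycle ord V X U p f" "\<not> boundary ord V X S U p f"
    using assms(7) by (auto simp: hom_nz_def)
  have "cycle ord V X T p f" using f(2) le(1) by (auto simp: cycle_def)
  moreover have "\<not> boundary ord V X S T p f"
  proof
    assume "boundary ord V X S T p f"
    then obtain g where g: "chain V S (Suc p) g" "chain V T p (\<lambda>A. f A - K g A)"
      by (auto simp: boundary_def)
    have "cycle ord V X U p (\<lambda>A. f A - K g A)"
      using f(2) by (simp add: cycle_def K_diff K_K)
    from zm[OF g(2) this] obtain h where h: "chain V S (Suc p) h"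
      "chain V U p (\<lambda>A. f A - K g A - K h A)" by (auto simp: boundary_def)
    have "chain V S (Suc p) (\<lambda>A. g A + h A)"
      by (rule chain_add[OF fam(1) g(1) h(1)])
    moreover have "chain V U p (\<lambda>A. f A - K (\<lambda>A. g A + h A) A)"
      using h(2) by (simp add: chain_def K_add diff_diff_eq)
    ultimately show False using f(3) by (auto simp: boundary_def)
  qed
  ultimately show ?thesis using f(1) by (auto simp: hom_nz_def)
qed

text \<open>Exactness at the homology of S/U. If that of T/U vanishes, its map to S/U is zero and
  \<open>les_zero_map_restrict\<close> applies.\<close>

lemma les_middle:
  assumes fam: "subfam V X S" "subfam V X T" "subfam V X U"
    and le: "\<And>A. A \<subseteq> V \<Longrightarrow> U A \<subseteq> T A" "\<And>A. A \<subseteq> V \<Longrightarrow> T A \<subseteq> S A"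
    and "hom_nz ord V X S U p"
  shows "hom_nz ord V X T U p \<or> hom_nz ord V X S T p"
proof (cases "hom_nz ord V X T U p")
  case False
  show ?thesis
  proof (rule disjI2, rule les_zero_map_restrict[OF fam le _ assms(6)])
    fix c assume "chain V T p c" "cycle ord V X U p c"
    with False have "boundary ord V X T U p c" by (auto simp: hom_nz_def)
    then obtain d where d: "chain V T (Suc p) d" "chain V U p (\<lambda>A. c A - K d A)"
      by (auto simp: boundary_def)
    then show "boundary ord V X S U p c"
      unfolding boundary_def by (intro exI[of _ d] conjI chain_mono[OF d(1) le(2)])
  qed
qed simp

end

section \<open>Change of coefficients\<close>

locale koszul_hom =
  src: koszul ord V Y + tgt: koszul ord V X
  for ord :: "'v \<Rightarrow> nat" and V and Y :: "'v \<Rightarrow> 'n::ab_group_add \<Rightarrow> 'n"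
    and X :: "'v \<Rightarrow> 'm::ab_group_add \<Rightarrow> 'm" +
  fixes \<phi> :: "'n \<Rightarrow> 'm"
  assumes \<phi>_add: "\<phi> (a + b) = \<phi> a + \<phi> b" and \<phi>_X: "\<phi> (Y v a) = X v (\<phi> a)"
begin

lemma \<phi>_zero [simp]: "\<phi> 0 = 0"
  using \<phi>_add[of 0 0] by simp

lemma \<phi>_minus: "\<phi> (- a) = - \<phi> a"
  using \<phi>_add[of a "- a"] by (simp add: eq_neg_iff_add_eq_0 add.commute)

lemma \<phi>_diff: "\<phi> (a - b) = \<phi> a - \<phi> b"
  using \<phi>_add[of a "- b"] by (simp add: \<phi>_minus)

lemma \<phi>_sgn_act: "\<phi> (sgn_act n a) = sgn_act n (\<phi> a)"
  by (simp add: sgn_act_def \<phi>_minus)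

lemma \<phi>_sum: "\<phi> (sum f B) = (\<Sum>x\<in>B. \<phi> (f x))"
  by (induction B rule: infinite_finite_induct) (auto simp: \<phi>_add)

lemma \<phi>_koszul_d: "\<phi> (koszul_d ord V Y c A) = koszul_d ord V X (\<lambda>B. \<phi> (c B)) A"
  by (simp add: koszul_d_def \<phi>_sum \<phi>_sgn_act \<phi>_X)

text \<open>The assumptions make \<phi> induce an isomorphism from each quotient of
  \<open>F A\<close> by \<open>Z A\<close> to that of \<open>S A\<close> by \<open>T A\<close>.
  Chains are carried over by choosing preimages modulo \<open>T\<close> separately for every
  subset.\<close>

lemma hom_nz_iff:
  assumes fam: "subfam V X S" "subfam V X T" "subfam V Y F"
    and le: "\<And>A. A \<subseteq> V \<Longrightarrow> T A \<subseteq> S A"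
    and \<phi>_in: "\<And>A a. A \<subseteq> V \<Longrightarrow> a \<in> F A \<Longrightarrow> \<phi> a \<in> S A"
    and onto: "\<And>A m. A \<subseteq> V \<Longrightarrow> m \<in> S A \<Longrightarrow> \<exists>a\<in>F A. m - \<phi> a \<in> T A"
    and Z: "\<And>A. A \<subseteq> V \<Longrightarrow> Z A = {a\<in>F A. \<phi> a \<in> T A}"
  shows "hom_nz ord V X S T p \<longleftrightarrow> hom_nz ord V Y F Z p"
proof
  have lift: "\<exists>C. chain V F q C \<and> chain V T q (\<lambda>A. c A - \<phi> (C A))" if "chain V S q c" for q c
  proof -
    have "\<forall>A. \<exists>a. A \<subseteq> V \<longrightarrow> card A = q \<longrightarrow> a \<in> F A \<and> c A - \<phi> a \<in> T A"
      using that onto[of _ "c _"] by (auto simp: chain_def Bex_def)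
    from choice[OF this] obtain C
      where "\<forall>A. A \<subseteq> V \<longrightarrow> card A = q \<longrightarrow> C A \<in> F A \<and> c A - \<phi> (C A) \<in> T A" ..
    then show ?thesis by (intro exI[of _ C]) (simp add: chain_def)
  qed
  assume "hom_nz ord V X S T p"
  then obtain c where c: "chain V S p c" "cycle ord V X T p c" "\<not> boundary ord V X S T p c"
    by (auto simp: hom_nz_def)
  obtain C where C: "chain V F p C" "chain V T p (\<lambda>A. c A - \<phi> (C A))" using lift[OF c(1)] by auto
  have cyc: "cycle ord V Y Z p C"
    unfolding cycle_def
  proof (intro allI impI)
    fix A assume A: "A \<subseteq> V" "Suc (card A) = p"
    then have fA: "chain V F (Suc (card A)) C" "chain V T (Suc (card A)) (\<lambda>A. c A - \<phi> (C A))" using C by simp_all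
    have 1: "koszul_d ord V Y C A \<in> F A"
      using koszul_d_chain[OF src.finV fam(3) fA(1), of ord] A by (simp add: chain_def)
    have "\<phi> (koszul_d ord V Y C A) = koszul_d ord V X c A - koszul_d ord V X (\<lambda>A. c A - \<phi> (C A)) A"
      by (simp add: \<phi>_koszul_d tgt.K_diff)
    also have "\<dots> \<in> T A"
      using koszul_d_chain[OF src.finV fam(2) fA(2), of ord] A c(2) subfam_diff[OF fam(2)]
      by (simp add: chain_def cycle_def)
    finally show "koszul_d ord V Y C A \<in> Z A" using 1 Z A by simp
  qed
  have "\<not> boundary ord V Y F Z p C"
  proof
    assume "boundary ord V Y F Z p C"
    then obtain D where D: "chain V F (Suc p) D" "chain V Z p (\<lambda>A. C A - koszul_d ord V Y D A)"
      by (auto simp: boundary_def)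
    have "chain V S (Suc p) (\<lambda>A. \<phi> (D A))" using D(1) \<phi>_in by (auto simp: chain_def)
    moreover have "chain V T p (\<lambda>A. c A - koszul_d ord V X (\<lambda>A. \<phi> (D A)) A)"
      unfolding chain_def
    proof (intro allI impI)
      fix A assume A: "A \<subseteq> V" "card A = p"
      have "\<phi> (C A - koszul_d ord V Y D A) \<in> T A" using D(2) A Z by (auto simp: chain_def)
      moreover have "c A - \<phi> (C A) \<in> T A" using C(2) A by (auto simp: chain_def)
      ultimately have "(c A - \<phi> (C A)) + \<phi> (C A - koszul_d ord V Y D A) \<in> T A"
        using subfam_add[OF fam(2)] A by blast
      then show "c A - koszul_d ord V X (\<lambda>A. \<phi> (D A)) A \<in> T A" by (simp add: \<phi>_diff \<phi>_koszul_d)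
    qed
    ultimately show False using c(3) by (auto simp: boundary_def)
  qed
  with C(1) cyc show "hom_nz ord V Y F Z p" by (auto simp: hom_nz_def)
next
  have lift: "\<exists>C. chain V F q C \<and> chain V T q (\<lambda>A. c A - \<phi> (C A))" if "chain V S q c" for q c
  proof -
    have "\<forall>A. \<exists>a. A \<subseteq> V \<longrightarrow> card A = q \<longrightarrow> a \<in> F A \<and> c A - \<phi> a \<in> T A"
      using that onto[of _ "c _"] by (auto simp: chain_def Bex_def)
    from choice[OF this] obtain C
      where "\<forall>A. A \<subseteq> V \<longrightarrow> card A = q \<longrightarrow> C A \<in> F A \<and> c A - \<phi> (C A) \<in> T A" ..
    then show ?thesis by (intro exI[of _ C]) (simp add: chain_def)
  qed
  assume "hom_nz ord V Y F Z p"
  then obtain C where C: "chain V F p C" "cycle ord V Y Z p C" "\<not> boundary ord V Y F Z p C"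
    by (auto simp: hom_nz_def)
  have "chain V S p (\<lambda>A. \<phi> (C A))" using C(1) \<phi>_in by (auto simp: chain_def)
  moreover have "cycle ord V X T p (\<lambda>A. \<phi> (C A))"
    using C(2) Z by (auto simp: cycle_def \<phi>_koszul_d[symmetric])
  moreover have "\<not> boundary ord V X S T p (\<lambda>A. \<phi> (C A))"
  proof
    assume "boundary ord V X S T p (\<lambda>A. \<phi> (C A))"
    then obtain d where d: "chain V S (Suc p) d" "chain V T p (\<lambda>A. \<phi> (C A) - koszul_d ord V X d A)"
      by (auto simp: boundary_def)
    obtain D where D: "chain V F (Suc p) D" "chain V T (Suc p) (\<lambda>A. d A - \<phi> (D A))"
      using lift[OF d(1)] by auto
    have "chain V Z p (\<lambda>A. C A - koszul_d ord V Y D A)"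
      unfolding chain_def
    proof (intro allI impI)
      fix A assume A: "A \<subseteq> V" "card A = p"
      have 1: "C A - koszul_d ord V Y D A \<in> F A"
        using A C(1) koszul_d_chain[OF src.finV fam(3) D(1), of ord] subfam_diff[OF fam(3)]
        by (simp add: chain_def)
      have "\<phi> (C A - koszul_d ord V Y D A) =
         (\<phi> (C A) - koszul_d ord V X d A) + koszul_d ord V X (\<lambda>A. d A - \<phi> (D A)) A"
        by (simp add: \<phi>_koszul_d \<phi>_diff tgt.K_diff)
      also have "\<dots> \<in> T A"
        using A d(2) koszul_d_chain[OF src.finV fam(2) D(2), of ord] subfam_add[OF fam(2)]
        by (simp add: chain_def)
      finally show "C A - koszul_d ord V Y D A \<in> Z A" using 1 Z A by simp
    qed
    with D(1) C(3) show False by (auto simp: boundary_def)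
  qed
  ultimately show "hom_nz ord V X S T p" by (auto simp: hom_nz_def)
qed

end

section \<open>Single multidegrees: constant coefficients on a family of subsets\<close>

definition scalar :: "'v \<Rightarrow> 'm \<Rightarrow> 'm" where
  "scalar v m = m"

lemma koszul_scalar:
  "finite V \<Longrightarrow> inj_on ord V \<Longrightarrow> koszul ord V (scalar :: 'v \<Rightarrow> 'm::ab_group_add \<Rightarrow> 'm)"
  by unfold_locales (auto simp: scalar_def)

lemma koszul_d_cong:
  "(\<And>v. v \<in> V - A \<Longrightarrow> c (insert v A) = d (insert v A)) \<Longrightarrow> koszul_d ord V X c A = koszul_d ord V X d A"
  by (simp add: koszul_d_def)

lemma hom_nz_cong:
  assumes "\<And>A. A \<subseteq> V \<Longrightarrow> S A = S' A" "\<And>A. A \<subseteq> V \<Longrightarrow> T A = T' A"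
  shows "hom_nz ord V X S T p \<longleftrightarrow> hom_nz ord V X S' T' p"
proof -
  have "chain V S q c = chain V S' q c" "chain V T q c = chain V T' q c"
    "cycle ord V X T q c = cycle ord V X T' q c" for q c
    using assms by (auto simp: chain_def cycle_def)
  then show ?thesis by (simp add: hom_nz_def boundary_def)
qed

text \<open>In a single multidegree the pieces of R/I are zero or the field, and variables act
  between nonzero ones as the identity, hence \<open>scalar\<close>. Modulo
  \<open>zero_on \<Delta>\<close> a coefficient survives exactly on \<Delta>.\<close>

definition zero_on :: "'v set set \<Rightarrow> 'v set \<Rightarrow> 'm::zero set" where
  "zero_on \<Delta> A = (if A \<in> \<Delta> then {0} else UNIV)"

lemma subfam_zero_on:
  "(\<And>A v. A \<subseteq> V \<Longrightarrow> v \<in> V - A \<Longrightarrow> A \<in> \<Delta> \<Longrightarrow> insert v A \<in> \<Delta>) \<Longrightarrow> subfam V scalar (zero_on \<Delta>)"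
  by (auto simp: subfam_def zero_on_def scalar_def)

lemma subfam_UNIV: "subfam V X (\<lambda>_. UNIV)"
  by (simp add: subfam_def)

lemma chain_UNIV [simp]: "chain V (\<lambda>_. UNIV) p c"
  by (simp add: chain_def)

text \<open>The sign \<open>\<Sum>v\<in>A. below ord v N\<close> is the one that moves the exterior factor indexed by \<open>N\<close> out of
  the way, so that the part of the complex supported between \<open>N\<close> and \<open>N \<union> \<tau>\<close> becomes the shifted
  complex on \<open>\<tau>\<close>.\<close>

lemma hom_nz_interval:
  fixes S T :: "'v set \<Rightarrow> 'm::ab_group_add set"
  assumes fin: "finite V" and inj: "inj_on ord V"
    and sub: "N \<subseteq> V" "\<tau> \<subseteq> V" "N \<inter> \<tau> = {}"
    and fam: "subfam V scalar S" "subfam V scalar T"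
    and le: "\<And>A. A \<subseteq> V \<Longrightarrow> T A \<subseteq> S A"
    and eq: "\<And>A. A \<subseteq> V \<Longrightarrow> \<not> (N \<subseteq> A \<and> A \<subseteq> N \<union> \<tau>) \<Longrightarrow> S A \<subseteq> T A"
  shows "hom_nz ord V scalar S T p \<longleftrightarrow>
    card N \<le> p \<and> hom_nz ord \<tau> scalar (\<lambda>A. S (N \<union> A)) (\<lambda>A. T (N \<union> A)) (p - card N)"
proof -
  let ?S = "\<lambda>A. S (N \<union> A)" and ?T = "\<lambda>A. T (N \<union> A)"
  let ?K = "koszul_d ord V scalar" and ?k = "koszul_d ord \<tau> scalar"
  define tw where "tw A = (\<Sum>v\<in>A. below ord v N)" for A
  define down where "down c A = sgn_act (tw A) (c (N \<union> A))" for c :: "'v set \<Rightarrow> 'm" and A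
  define up where "up c A = (if N \<subseteq> A \<and> A \<subseteq> N \<union> \<tau> then sgn_act (tw (A - N)) (c (A - N)) else 0)"
    for c :: "'v set \<Rightarrow> 'm" and A
  have finN: "finite N" and fint: "finite \<tau>" using fin sub by (auto intro: finite_subset)
  have cardN: "card (N \<union> A) = card N + card A" if "A \<subseteq> \<tau>" for A
    using that sub(3) finN fint by (intro card_Un_disjoint) (auto intro: finite_subset)
  have down_up: "down (up c) A = c A" if "A \<subseteq> \<tau>" for c A
  proof -
    have "N \<union> A - N = A" using that sub(3) by auto
    then show ?thesis using that by (simp add: down_def up_def Un_subset_iff le_supI2)
  qed
  \<comment> \<open>Vertices outside N and \<tau> lead to sets on which \<open>S\<close> is
    contained in \<open>T\<close>, so up to \<open>T\<close> the differential only sees the vertices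
    of \<tau>.\<close>
  have key: "?K c (N \<union> A) - sgn_act (tw A) (?k (down c) A) \<in> T (N \<union> A)"
    if A: "A \<subseteq> \<tau>" and c: "chain V S (Suc (card (N \<union> A))) c" for c A
  proof -
    have NA: "N \<union> A \<subseteq> V" using A sub by auto
    have finA: "finite A" using A fint finite_subset by auto
    have V: "V - (N \<union> A) = (\<tau> - A) \<union> (V - (N \<union> \<tau>))" using A sub by auto
    have 1: "sgn_act (tw A) (?k (down c) A) =
        (\<Sum>v\<in>\<tau> - A. sgn_act (below ord v (N \<union> A)) (scalar v (c (insert v (N \<union> A)))))"
      unfolding koszul_d_def sgn_act_sum
    proof (rule sum.cong[OF refl])
      fix v assume v: "v \<in> \<tau> - A"
      have tw: "tw (insert v A) = below ord v N + tw A"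
        using v finA by (simp add: tw_def)
      have b: "below ord v (N \<union> A) = below ord v N + below ord v A"
        using finN finA A sub(3) by (intro below_Un) auto
      have "even (tw A + (below ord v A + (below ord v N + tw A))) \<longleftrightarrow>
        even (below ord v N + below ord v A)" by auto
      then show "sgn_act (tw A) (sgn_act (below ord v A) (scalar v (down c (insert v A)))) =
         sgn_act (below ord v (N \<union> A)) (scalar v (c (insert v (N \<union> A))))"
        by (simp add: scalar_def down_def sgn_act_sact tw b) (simp add: sgn_act_def)
    qed
    have "?K c (N \<union> A) - sgn_act (tw A) (?k (down c) A) =
        (\<Sum>v\<in>V - (N \<union> \<tau>). sgn_act (below ord v (N \<union> A)) (scalar v (c (insert v (N \<union> A)))))"
      unfolding 1 unfolding koszul_d_def V
      by (subst sum.union_disjoint) (use fin fint sub in auto)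
    also have "\<dots> \<in> T (N \<union> A)"
    proof (rule subfam_sum[OF fam(2) NA], rule subfam_sgn_act[OF fam(2) NA], rule subfam_X[OF fam(2) NA])
      fix v assume v: "v \<in> V - (N \<union> \<tau>)"
      then show "v \<in> V - (N \<union> A)" using A by auto
      have "finite (N \<union> A)" "v \<notin> N \<union> A" using finN finA v A by auto
      then have "card (insert v (N \<union> A)) = Suc (card (N \<union> A))" by simp
      moreover have "insert v (N \<union> A) \<subseteq> V" using NA v by auto
      ultimately have "c (insert v (N \<union> A)) \<in> S (insert v (N \<union> A))"
        using c by (auto simp: chain_def)
      moreover have "S (insert v (N \<union> A)) \<subseteq> T (insert v (N \<union> A))"
        using v NA by (intro eq) auto
      ultimately show "c (insert v (N \<union> A)) \<in> T (insert v (N \<union> A))" by auto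
    qed
    finally show ?thesis .
  qed
  have T_iff: "a \<in> T A \<longleftrightarrow> b \<in> T A" if "a - b \<in> T A" "A \<subseteq> V" for a b A
    using subfam_add[OF fam(2) that(2) that(1), of b] subfam_diff[OF fam(2) that(2) _ that(1), of a]
    by auto
  have T_sgn_act: "sgn_act n a \<in> T A \<longleftrightarrow> a \<in> T A" if "A \<subseteq> V" for n a A
    using subfam_sgn_act[OF fam(2) that, of a n] subfam_sgn_act[OF fam(2) that, of "sgn_act n a" n] by auto
  have split: "\<exists>A'. A' \<subseteq> \<tau> \<and> A = N \<union> A'" if "N \<subseteq> A" "A \<subseteq> N \<union> \<tau>" for A
    using that by (intro exI[of _ "A - N"]) auto
  have cyc: "cycle ord V scalar T (card N + q) c \<longleftrightarrow> cycle ord \<tau> scalar ?T q (down c)"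
    if c: "chain V S (card N + q) c" for c q
  proof -
    have iff: "?K c (N \<union> A) \<in> T (N \<union> A) \<longleftrightarrow> ?k (down c) A \<in> T (N \<union> A)"
      if A: "A \<subseteq> \<tau>" "Suc (card A) = q" for A
    proof -
      have NA: "N \<union> A \<subseteq> V" using A sub by auto
      have "chain V S (Suc (card (N \<union> A))) c" using c cardN[OF A(1)] A(2) by auto
      from T_iff[OF key[OF A(1) this] NA] T_sgn_act[OF NA] show ?thesis by simp
    qed
    show ?thesis
    proof
      assume L: "cycle ord V scalar T (card N + q) c"
      show "cycle ord \<tau> scalar ?T q (down c)"
        unfolding cycle_def
      proof (intro allI impI)
        fix A assume A: "A \<subseteq> \<tau>" "Suc (card A) = q"
        have "?K c (N \<union> A) \<in> T (N \<union> A)"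
          using L A sub cardN[OF A(1)] unfolding cycle_def by auto
        then show "?k (down c) A \<in> T (N \<union> A)" using iff[OF A] by simp
      qed
    next
      assume R: "cycle ord \<tau> scalar ?T q (down c)"
      show "cycle ord V scalar T (card N + q) c"
        unfolding cycle_def
      proof (intro allI impI)
        fix A assume A: "A \<subseteq> V" "Suc (card A) = card N + q"
        show "?K c A \<in> T A"
        proof (cases "N \<subseteq> A \<and> A \<subseteq> N \<union> \<tau>")
          case True
          then obtain A' where A': "A' \<subseteq> \<tau>" "A = N \<union> A'" using split[of A] by blast
          then have "Suc (card A') = q" using A(2) cardN[OF A'(1)] by auto
          then show ?thesis using R iff[OF A'(1)] A' by (auto simp: cycle_def)
        next
          case False
          have "chain V S (card A) (?K c)"
            using koszul_d_chain[OF fin fam(1)] c A(2) by auto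
          then show ?thesis using eq[OF A(1) False] A by (auto simp: chain_def)
        qed
      qed
    qed
  qed
  have bnd1: "chain V T (card N + q) (\<lambda>A. c A - ?K d A) \<longleftrightarrow>
      chain \<tau> ?T q (\<lambda>A. down c A - ?k (down d) A)"
    if c: "chain V S (card N + q) c" and d: "chain V S (Suc (card N + q)) d" for c d q
  proof -
    have iff: "c (N \<union> A) - ?K d (N \<union> A) \<in> T (N \<union> A) \<longleftrightarrow> down c A - ?k (down d) A \<in> T (N \<union> A)"
      if A: "A \<subseteq> \<tau>" "card A = q" for A
    proof -
      have NA: "N \<union> A \<subseteq> V" using A sub by auto
      have "chain V S (Suc (card (N \<union> A))) d" using d cardN[OF A(1)] A(2) by auto
      from key[OF A(1) this]
      have "sgn_act (tw A) (?K d (N \<union> A) - sgn_act (tw A) (?k (down d) A)) \<in> T (N \<union> A)"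
        using T_sgn_act[OF NA] by simp
      then have "(sgn_act (tw A) (?K d (N \<union> A))) - ?k (down d) A \<in> T (N \<union> A)"
        by (simp add: sgn_act_diff)
      then have "(down c A - ?k (down d) A) - sgn_act (tw A) (c (N \<union> A) - ?K d (N \<union> A)) \<in> T (N \<union> A)"
        by (simp add: down_def sgn_act_diff)
      from T_iff[OF this NA] T_sgn_act[OF NA] show ?thesis by simp
    qed
    show ?thesis
    proof
      assume L: "chain V T (card N + q) (\<lambda>A. c A - ?K d A)"
      show "chain \<tau> ?T q (\<lambda>A. down c A - ?k (down d) A)"
        unfolding chain_def
      proof (intro allI impI)
        fix A assume A: "A \<subseteq> \<tau>" "card A = q"
        have "c (N \<union> A) - ?K d (N \<union> A) \<in> T (N \<union> A)"
          using L A sub cardN[OF A(1)] unfolding chain_def by auto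
        then show "down c A - ?k (down d) A \<in> T (N \<union> A)" using iff[OF A] by simp
      qed
    next
      assume R: "chain \<tau> ?T q (\<lambda>A. down c A - ?k (down d) A)"
      show "chain V T (card N + q) (\<lambda>A. c A - ?K d A)"
        unfolding chain_def
      proof (intro allI impI)
        fix A assume A: "A \<subseteq> V" "card A = card N + q"
        show "c A - ?K d A \<in> T A"
        proof (cases "N \<subseteq> A \<and> A \<subseteq> N \<union> \<tau>")
          case True
          then obtain A' where A': "A' \<subseteq> \<tau>" "A = N \<union> A'" using split[of A] by blast
          then have "card A' = q" using A(2) cardN[OF A'(1)] by auto
          then show ?thesis using R iff[OF A'(1)] A' by (auto simp: chain_def)
        next
          case False
          have "chain V S (card A) (?K d)"
            using koszul_d_chain[OF fin fam(1)] d A(2) by auto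
          then have "c A - ?K d A \<in> S A"
            using subfam_diff[OF fam(1) A(1)] c A by (simp add: chain_def)
          then show ?thesis using eq[OF A(1) False] by auto
        qed
      qed
    qed
  qed
  have down_chain: "chain \<tau> ?S q (down c)" if "chain V S (card N + q) c" for c q
    unfolding chain_def
  proof (intro allI impI)
    fix A assume A: "A \<subseteq> \<tau>" "card A = q"
    have NA: "N \<union> A \<subseteq> V" using A sub by auto
    then have "c (N \<union> A) \<in> S (N \<union> A)" using that A cardN[OF A(1)] by (simp add: chain_def)
    then show "down c A \<in> S (N \<union> A)" by (simp add: down_def subfam_sgn_act[OF fam(1) NA])
  qed
  have up_chain: "chain V S (card N + q) (up c)" if "chain \<tau> ?S q c" for c q
    unfolding chain_def
  proof (intro allI impI)
    fix A assume A: "A \<subseteq> V" "card A = card N + q"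
    show "up c A \<in> S A"
    proof (cases "N \<subseteq> A \<and> A \<subseteq> N \<union> \<tau>")
      case True
      then obtain A' where A': "A' \<subseteq> \<tau>" "A = N \<union> A'" using split[of A] by blast
      have "card A' = q" using A(2) cardN[OF A'(1)] A' by auto
      moreover have "N \<union> A' - N = A'" using A' sub(3) by auto
      ultimately show ?thesis
        using that A' True subfam_sgn_act[OF fam(1) A(1)] by (simp add: up_def chain_def)
    next
      case False
      then show ?thesis using subfam_zero[OF fam(1) A(1)] by (auto simp: up_def)
    qed
  qed
  have eqk: "?k (down (up c)) A = ?k c A" if "A \<subseteq> \<tau>" for c A
    by (rule koszul_d_cong) (use that down_up in auto)
  have chain_dd: "chain \<tau> ?T q (\<lambda>A. down (up c) A - ?k d A) \<longleftrightarrow> chain \<tau> ?T q (\<lambda>A. c A - ?k d A)"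
    for c d q by (auto simp: chain_def down_up)
  have chain_dd2: "chain \<tau> ?T q (\<lambda>A. c A - ?k (down (up d)) A) \<longleftrightarrow> chain \<tau> ?T q (\<lambda>A. c A - ?k d A)"
    for c d q by (auto simp: chain_def eqk)
  have bnd: "boundary ord V scalar S T (card N + q) c \<longleftrightarrow> boundary ord \<tau> scalar ?S ?T q (down c)"
    if c: "chain V S (card N + q) c" for c q
  proof
    assume "boundary ord V scalar S T (card N + q) c"
    then obtain d where d: "chain V S (Suc (card N + q)) d" "chain V T (card N + q) (\<lambda>A. c A - ?K d A)"
      by (auto simp: boundary_def)
    have "chain \<tau> ?S (Suc q) (down d)" using down_chain[of "Suc q" d] d(1) by simp
    moreover have "chain \<tau> ?T q (\<lambda>A. down c A - ?k (down d) A)" using bnd1[OF c d(1)] d(2) by simp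
    ultimately show "boundary ord \<tau> scalar ?S ?T q (down c)" by (auto simp: boundary_def)
  next
    assume "boundary ord \<tau> scalar ?S ?T q (down c)"
    then obtain d where d: "chain \<tau> ?S (Suc q) d" "chain \<tau> ?T q (\<lambda>A. down c A - ?k d A)"
      by (auto simp: boundary_def)
    have u: "chain V S (Suc (card N + q)) (up d)" using up_chain[OF d(1)] by simp
    moreover have "chain V T (card N + q) (\<lambda>A. c A - ?K (up d) A)"
      using bnd1[OF c u] d(2) chain_dd2 by simp
    ultimately show "boundary ord V scalar S T (card N + q) c" by (auto simp: boundary_def)
  qed
  have cyc_dd: "cycle ord \<tau> scalar ?T q (down (up c)) = cycle ord \<tau> scalar ?T q c" for q c
    by (auto simp: cycle_def eqk)
  have bnd_dd: "boundary ord \<tau> scalar ?S ?T q (down (up c)) = boundary ord \<tau> scalar ?S ?T q c" for q c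
    by (simp add: boundary_def chain_dd)
  have main: "hom_nz ord V scalar S T (card N + q) \<longleftrightarrow> hom_nz ord \<tau> scalar ?S ?T q" for q
  proof
    assume "hom_nz ord V scalar S T (card N + q)"
    then show "hom_nz ord \<tau> scalar ?S ?T q"
      unfolding hom_nz_def using cyc bnd down_chain by blast
  next
    assume "hom_nz ord \<tau> scalar ?S ?T q"
    then obtain c where c: "chain \<tau> ?S q c" "cycle ord \<tau> scalar ?T q c" "\<not> boundary ord \<tau> scalar ?S ?T q c"
      by (auto simp: hom_nz_def)
    show "hom_nz ord V scalar S T (card N + q)"
      unfolding hom_nz_def
      using up_chain[OF c(1)] cyc[OF up_chain[OF c(1)]] bnd[OF up_chain[OF c(1)]] c(2,3) cyc_dd bnd_dd
      by (intro exI[of _ "up c"]) simp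
  qed
  show ?thesis
  proof (cases "card N \<le> p")
    case True
    then show ?thesis using main[of "p - card N"] by simp
  next
    case False
    \<comment> \<open>A set with fewer than \<open>card N\<close> vertices does not contain
      \<open>N\<close>, so all chains of degree \<open>p\<close> lie in \<open>T\<close> and are
      bounded by 0.\<close>
    have "boundary ord V scalar S T p c" if c: "chain V S p c" for c
      unfolding boundary_def
    proof (intro exI[of _ "\<lambda>_. 0"] conjI)
      show "chain V S (Suc p) (\<lambda>_. 0)" using subfam_zero[OF fam(1)] by (simp add: chain_def)
      show "chain V T p (\<lambda>A. c A - ?K (\<lambda>_. 0) A)"
        unfolding chain_def
      proof (intro allI impI)
        fix A assume A: "A \<subseteq> V" "card A = p"
        have "\<not> N \<subseteq> A" using A False card_mono[of A N] fin finite_subset by fastforce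
        then have "c A \<in> T A" using eq[OF A(1)] c A by (auto simp: chain_def)
        then show "c A - ?K (\<lambda>_. 0) A \<in> T A" by (simp add: koszul_d_def scalar_def)
      qed
    qed
    then show ?thesis using False by (auto simp: hom_nz_def)
  qed
qed

text \<open>Multiplication with the exterior variable \<open>v\<close> is a contracting homotopy.\<close>

lemma cone_exact:
  fixes c :: "'v set \<Rightarrow> 'm::ab_group_add"
  assumes fin: "finite V" and inj: "inj_on ord V" and v: "v \<in> V"
    and \<Delta>: "\<And>A. A \<subseteq> V \<Longrightarrow> A \<in> \<Delta> \<Longrightarrow> A - {v} \<in> \<Delta>"
    and cyc: "\<And>A. A \<subseteq> V \<Longrightarrow> A \<in> \<Delta> \<Longrightarrow> Suc (card A) = p \<Longrightarrow> koszul_d ord V scalar c A = 0"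
  shows "\<exists>d. \<forall>A. A \<subseteq> V \<longrightarrow> A \<in> \<Delta> \<longrightarrow> card A = p \<longrightarrow> c A = koszul_d ord V scalar d A"
proof -
  define d where "d A = (if v \<in> A then sgn_act (below ord v (A - {v})) (c (A - {v})) else 0)" for A
  have "c A = koszul_d ord V scalar d A" if A: "A \<subseteq> V" "A \<in> \<Delta>" "card A = p" for A
  proof (cases "v \<in> A")
    case False
    \<comment> \<open>Only adding \<open>v\<close> leads to a set on which \<open>d\<close> can be
      nonzero.\<close>
    have "koszul_d ord V scalar d A = (\<Sum>w\<in>V - A. if w = v then c A else 0)"
      unfolding koszul_d_def
    proof (rule sum.cong[OF refl])
      fix w assume "w \<in> V - A"
      show "sgn_act (below ord w A) (scalar w (d (insert w A))) = (if w = v then c A else 0)"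
        using False by (auto simp: d_def scalar_def)
    qed
    also have "\<dots> = c A" using v False fin by simp
    finally show ?thesis ..
  next
    case True
    define B where "B = A - {v}"
    have AB: "A = insert v B" "v \<notin> B" using True by (auto simp: B_def)
    have finA: "finite A" using A fin finite_subset by auto
    then have finB: "finite B" by (simp add: B_def)
    have "card A = Suc (card B)"
      using card_insert_disjoint[OF finB AB(2)] unfolding AB(1)[symmetric] .
    with A(3) have cB: "Suc (card B) = p" by (rule trans[OF sym, rotated])
    have "B \<subseteq> V" "B \<in> \<Delta>" using \<Delta>[OF A(1,2)] A(1) by (auto simp: B_def)
    \<comment> \<open>The cycle condition at \<open>B\<close>, which lies in \<Delta> as well,
      expresses \<open>c A\<close> through the values of \<open>c\<close> that occur in the
      differential of \<open>d\<close>.\<close>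
    from cyc[OF this cB] have "koszul_d ord V scalar c B = 0" .
    moreover have VB: "V - B = insert v (V - A)" using AB v by auto
    have "koszul_d ord V scalar c B = sgn_act (below ord v B) (c A) + (\<Sum>w\<in>V - A. sgn_act (below ord w B) (c (insert w B)))"
      unfolding koszul_d_def VB
      by (subst sum.insert) (use fin True in \<open>auto simp: scalar_def AB(1)[symmetric]\<close>)
    ultimately have 0: "sgn_act (below ord v B) (c A) + (\<Sum>w\<in>V - A. sgn_act (below ord w B) (c (insert w B))) = 0"
      by simp
    have "koszul_d ord V scalar d A = (\<Sum>w\<in>V - A. - sgn_act (below ord v B) (sgn_act (below ord w B) (c (insert w B))))"
      unfolding koszul_d_def
    proof (rule sum.cong[OF refl])
      fix w assume w: "w \<in> V - A"
      then have wB: "w \<notin> B" "w \<noteq> v" "w \<in> V" "w \<notin> A" using AB by auto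
      have dA: "d (insert w A) = sgn_act (below ord v (insert w B)) (c (insert w B))"
      proof -
        have "insert w A - {v} = insert w B" using AB wB by auto
        then show ?thesis using True by (simp add: d_def)
      qed
      have "ord w \<noteq> ord v" using inj v wB by (auto simp: inj_on_def)
      then consider "ord v < ord w" | "ord w < ord v" by linarith
      then have "even (below ord w A + below ord v (insert w B)) \<longleftrightarrow>
          odd (below ord v B + below ord w B)"
        by cases (use AB wB finB in \<open>auto simp: below_insert\<close>)
      then show "sgn_act (below ord w A) (scalar w (d (insert w A))) =
          - sgn_act (below ord v B) (sgn_act (below ord w B) (c (insert w B)))"
        by (simp add: dA scalar_def sgn_act_sact) (simp add: sgn_act_def)
    qed
    also have "\<dots> = sgn_act (below ord v B) (- (\<Sum>w\<in>V - A. sgn_act (below ord w B) (c (insert w B))))"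
      by (simp add: sgn_act_sum sum_negf sgn_act_minus)
    also have "- (\<Sum>w\<in>V - A. sgn_act (below ord w B) (c (insert w B))) = sgn_act (below ord v B) (c A)"
      using 0 by (simp add: add_eq_0_iff)
    finally show ?thesis by simp
  qed
  then show ?thesis by blast
qed

lemma cone_acyclic:
  assumes "finite V" "inj_on ord V" "v \<in> V" "\<And>A. A \<subseteq> V \<Longrightarrow> A \<in> \<Delta> \<Longrightarrow> A - {v} \<in> \<Delta>"
  shows "\<not> hom_nz ord V (scalar :: 'v \<Rightarrow> 'm::ab_group_add \<Rightarrow> 'm) (\<lambda>_. UNIV) (zero_on \<Delta>) p"
proof
  assume "hom_nz ord V (scalar :: 'v \<Rightarrow> 'm \<Rightarrow> 'm) (\<lambda>_. UNIV) (zero_on \<Delta>) p"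
  then obtain c :: "'v set \<Rightarrow> 'm" where c: "cycle ord V scalar (zero_on \<Delta>) p c"
    "\<not> boundary ord V scalar (\<lambda>_. UNIV) (zero_on \<Delta>) p c"
    by (auto simp: hom_nz_def)
  have "\<exists>d. \<forall>A. A \<subseteq> V \<longrightarrow> A \<in> \<Delta> \<longrightarrow> card A = p \<longrightarrow> c A = koszul_d ord V scalar d A"
  proof (rule cone_exact[OF assms(1-4)])
    fix A assume "A \<subseteq> V" "A \<in> \<Delta>" "Suc (card A) = p"
    then show "koszul_d ord V scalar c A = 0" using c(1) by (auto simp: cycle_def zero_on_def)
  qed
  then obtain d where "\<forall>A. A \<subseteq> V \<longrightarrow> A \<in> \<Delta> \<longrightarrow> card A = p \<longrightarrow> c A = koszul_d ord V scalar d A" ..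
  then have "chain V (zero_on \<Delta>) p (\<lambda>A. c A - koszul_d ord V scalar d A)"
    by (simp add: chain_def zero_on_def)
  then show False using c(2) by (auto simp: boundary_def)
qed

section \<open>Squarefree Koszul homology of edge ideals\<close>

definition indep :: "'v set set \<Rightarrow> 'v set \<Rightarrow> bool" where
  "indep E B \<longleftrightarrow> (\<forall>e\<in>E. \<not> e \<subseteq> B)"

text \<open>The complements in \<sigma> of the faces of the independence complex. Unlike the faces,
  they are closed under adding vertices, the direction that \<open>subfam_zero_on\<close>
  requires.\<close>

definition cofaces :: "'v set set \<Rightarrow> 'v set \<Rightarrow> 'v set set" where
  "cofaces E \<sigma> = {A. indep E (\<sigma> - A)}"

text \<open>The Koszul homology of \<open>R/I(G)\<close> in the squarefree multidegree \<open>\<sigma>\<close>: the exterior basis element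
  indexed by \<open>A\<close> carries the monomial with support \<open>\<sigma> - A\<close>, which is zero in \<open>R/I(G)\<close> unless this set
  is independent.\<close>

definition betti_nz :: "'k::field itself \<Rightarrow> ('v \<Rightarrow> nat) \<Rightarrow> 'v set set \<Rightarrow> nat \<Rightarrow> 'v set \<Rightarrow> bool" where
  "betti_nz k ord E p \<sigma> \<longleftrightarrow> hom_nz ord \<sigma> (scalar :: 'v \<Rightarrow> 'k \<Rightarrow> 'k) (\<lambda>_. UNIV) (zero_on (cofaces E \<sigma>)) p"

lemma cofacesD: "A \<in> cofaces E \<sigma> \<Longrightarrow> e \<in> E \<Longrightarrow> \<not> e \<subseteq> \<sigma> - A"
  by (auto simp: cofaces_def indep_def)

lemma indep_mono: "indep E B \<Longrightarrow> B' \<subseteq> B \<Longrightarrow> indep E B'"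
  by (auto simp: indep_def)

lemma betti_nz_cong:
  fixes k :: "'k::field itself" and ord :: "'v \<Rightarrow> nat"
  assumes "\<And>e. e \<subseteq> \<sigma> \<Longrightarrow> e \<in> E \<longleftrightarrow> e \<in> E'"
  shows "betti_nz k ord E p \<sigma> \<longleftrightarrow> betti_nz k ord E' p \<sigma>"
proof -
  have "indep E (\<sigma> - A) \<longleftrightarrow> indep E' (\<sigma> - A)" for A
  proof -
    have "e \<in> E \<longleftrightarrow> e \<in> E'" if "e \<subseteq> \<sigma> - A" for e using that assms[of e] by blast
    then show ?thesis by (auto simp: indep_def)
  qed
  then have "cofaces E \<sigma> = cofaces E' \<sigma>" by (simp add: cofaces_def)
  then show ?thesis by (simp add: betti_nz_def)
qed

lemma betti_nz_empty:
  fixes k :: "'k::field itself" and ord :: "'v \<Rightarrow> nat"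
  assumes "{} \<notin> E"
  shows "betti_nz k ord E p {} \<longleftrightarrow> p = 0"
proof (cases "p = 0")
  case True
  have "\<not> boundary ord {} (scalar :: 'v \<Rightarrow> 'k \<Rightarrow> 'k) (\<lambda>_. UNIV) (zero_on (cofaces E {})) 0 (\<lambda>_. 1::'k)"
    using assms by (auto simp: boundary_def chain_def zero_on_def cofaces_def indep_def koszul_d_def)
  then have "betti_nz k ord E 0 {}"
    unfolding betti_nz_def hom_nz_def by (intro exI[of _ "\<lambda>_. 1"]) (auto simp: cycle_def)
  with True show ?thesis by simp
next
  case False
  then show ?thesis
    by (auto simp: betti_nz_def hom_nz_def boundary_def chain_def)
qed

text \<open>An isolated vertex of the induced subgraph can be added to every independent set, so the
  cofaces form a cone with apex \<open>v\<close>.\<close>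

lemma betti_nz_isolated:
  fixes k :: "'k::field itself" and ord :: "'v \<Rightarrow> nat"
  assumes "finite \<sigma>" "inj_on ord \<sigma>" "v \<in> \<sigma>" "\<And>e. e \<in> E \<Longrightarrow> e \<subseteq> \<sigma> \<Longrightarrow> v \<notin> e"
  shows "\<not> betti_nz k ord E p \<sigma>"
  unfolding betti_nz_def
proof (rule cone_acyclic[OF assms(1-3)])
  fix A assume A: "A \<subseteq> \<sigma>" "A \<in> cofaces E \<sigma>"
  show "A - {v} \<in> cofaces E \<sigma>"
    unfolding cofaces_def indep_def
  proof (clarify)
    fix e assume e: "e \<in> E" "e \<subseteq> \<sigma> - (A - {v})"
    then have "v \<notin> e" using assms(4)[OF e(1)] by blast
    then have "e \<subseteq> \<sigma> - A" using e(2) by blast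
    with A(2) e(1) show False by (auto simp: cofaces_def indep_def)
  qed
qed

lemma subfam_cofaces:
  shows "subfam \<sigma> scalar (zero_on (cofaces E \<sigma> \<inter> {A. x \<in> A}))"
    and "subfam \<sigma> scalar (zero_on (cofaces E \<sigma>))"
  by (auto intro!: subfam_zero_on simp: cofaces_def indep_def)

text \<open>The sequence of the submodule generated by \<open>x\<close> in R/I and its quotient. A
  multiple of \<open>x\<close> is nonzero only if the neighbours of \<open>x\<close> lie in the
  exterior part; this shifts the degree by their number and leaves \<sigma> without the closed
  neighbourhood. Modulo \<open>x\<close>, the vertex itself lies in the exterior part, a shift by
  1.\<close>

lemma betti_nz_vertex:
  fixes k :: "'k::field itself" and ord :: "'v \<Rightarrow> nat"
  assumes fin: "finite \<sigma>" and inj: "inj_on ord \<sigma>" and x: "x \<in> \<sigma>"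
    and E: "\<And>e. e \<in> E \<Longrightarrow> card e = 2" and betti_nz: "betti_nz k ord E p \<sigma>"
  shows "1 \<le> p \<and> betti_nz k ord E (p - 1) (\<sigma> - {x}) \<or>
    card (nbrs E x \<inter> \<sigma>) \<le> p \<and> betti_nz k ord E (p - card (nbrs E x \<inter> \<sigma>)) (\<sigma> - closed_nbrs E x)"
proof -
  let ?X = "scalar :: 'v \<Rightarrow> 'k \<Rightarrow> 'k" and ?S = "\<lambda>_. UNIV :: 'k set"
  let ?U = "zero_on (cofaces E \<sigma>) :: 'v set \<Rightarrow> 'k set"
  let ?T = "zero_on (cofaces E \<sigma> \<inter> {A. x \<in> A}) :: 'v set \<Rightarrow> 'k set"
  let ?N = "nbrs E x \<inter> \<sigma>" and ?\<tau> = "\<sigma> - closed_nbrs E x"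
  interpret koszul ord \<sigma> ?X by (rule koszul_scalar[OF fin inj])
  have UT: "?U A \<subseteq> ?T A" for A by (auto simp: zero_on_def)
  have edge: "f = {x, w}" if "f \<in> E" "x \<in> f" "w \<in> f" "w \<noteq> x" for f w
    using E[OF that(1)] that by (auto simp: card_2_iff)
  have noloop: "{x} \<notin> E" using E[of "{x}"] by auto
  then have xN: "x \<notin> nbrs E x" by (auto simp: nbrs_def)
  have "hom_nz ord \<sigma> ?X ?T ?U p \<or> hom_nz ord \<sigma> ?X ?S ?T p"
    by (rule les_middle[OF subfam_UNIV subfam_cofaces]) (use betti_nz UT in \<open>auto simp: betti_nz_def\<close>)
  then show ?thesis
  proof
    assume h: "hom_nz ord \<sigma> ?X ?T ?U p"
    have "hom_nz ord \<sigma> ?X ?T ?U p \<longleftrightarrow> card ?N \<le> p \<and>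
      hom_nz ord ?\<tau> ?X (\<lambda>A. ?T (?N \<union> A)) (\<lambda>A. ?U (?N \<union> A)) (p - card ?N)"
    proof (rule hom_nz_interval[OF fin inj _ _ _ subfam_cofaces UT])
      fix A assume A: "A \<subseteq> \<sigma>" "\<not> (?N \<subseteq> A \<and> A \<subseteq> ?N \<union> ?\<tau>)"
      have "x \<in> A" if "A \<in> cofaces E \<sigma>"
      proof (rule ccontr)
        assume xA: "x \<notin> A"
        have "?N \<subseteq> A"
        proof
          fix w assume w: "w \<in> ?N"
          then have "{x, w} \<in> E" "w \<in> \<sigma>" by (auto simp: nbrs_def)
          then show "w \<in> A" using cofacesD[OF that, of "{x, w}"] x xA by blast
        qed
        moreover have "A \<subseteq> ?N \<union> ?\<tau>" using A(1) xA by (auto simp: closed_nbrs_def)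
        ultimately show False using A(2) by auto
      qed
      then show "?T A \<subseteq> ?U A" by (auto simp: zero_on_def)
    qed (auto simp: closed_nbrs_def)
    moreover have "hom_nz ord ?\<tau> ?X (\<lambda>A. ?T (?N \<union> A)) (\<lambda>A. ?U (?N \<union> A)) (p - card ?N) \<longleftrightarrow>
      betti_nz k ord E (p - card ?N) ?\<tau>"
      unfolding betti_nz_def
    proof (rule hom_nz_cong)
      fix A assume A: "A \<subseteq> ?\<tau>"
      then have "x \<notin> ?N \<union> A" using xN by (auto simp: closed_nbrs_def)
      then show "?T (?N \<union> A) = ?S A" by (auto simp: zero_on_def)
      have eq: "\<sigma> - (?N \<union> A) = insert x (?\<tau> - A)"
        using A x xN by (auto simp: closed_nbrs_def)
      have "indep E (insert x (?\<tau> - A)) \<longleftrightarrow> indep E (?\<tau> - A)"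
      proof
        assume ind: "indep E (?\<tau> - A)"
        show "indep E (insert x (?\<tau> - A))"
          unfolding indep_def
        proof (intro ballI notI)
          fix f assume f: "f \<in> E" "f \<subseteq> insert x (?\<tau> - A)"
          have "x \<in> f" using ind f by (auto simp: indep_def)
          moreover obtain w where w: "w \<in> f" "w \<noteq> x" using E[OF f(1)] by (auto simp: card_2_iff)
          ultimately have "f = {x, w}" using edge f(1) by blast
          then have "w \<in> nbrs E x" using f(1) by (simp add: nbrs_def)
          then show False using w f(2) by (auto simp: closed_nbrs_def)
        qed
      qed (auto intro: indep_mono)
      then show "?U (?N \<union> A) = zero_on (cofaces E ?\<tau>) A"
        by (simp add: zero_on_def cofaces_def eq)
    qed
    ultimately show ?thesis using h by blast
  next
    assume h: "hom_nz ord \<sigma> ?X ?S ?T p"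
    have "hom_nz ord \<sigma> ?X ?S ?T p \<longleftrightarrow> card {x} \<le> p \<and>
      hom_nz ord (\<sigma> - {x}) ?X (\<lambda>A. UNIV) (\<lambda>A. ?T ({x} \<union> A)) (p - card {x})"
      by (rule hom_nz_interval[OF fin inj _ _ _ subfam_UNIV subfam_cofaces(1)])
         (use x in \<open>auto simp: zero_on_def\<close>)
    moreover have "hom_nz ord (\<sigma> - {x}) ?X (\<lambda>A. UNIV) (\<lambda>A. ?T ({x} \<union> A)) (p - card {x}) \<longleftrightarrow>
      betti_nz k ord E (p - 1) (\<sigma> - {x})"
    proof -
      have eq: "\<sigma> - ({x} \<union> A) = \<sigma> - {x} - A" for A by auto
      have "?T ({x} \<union> A) = zero_on (cofaces E (\<sigma> - {x})) A" for A
        unfolding zero_on_def cofaces_def Int_iff mem_Collect_eq eq by simp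
      then show ?thesis by (simp add: betti_nz_def)
    qed
    ultimately show ?thesis using h by auto
  qed
qed

text \<open>With \<open>?U\<close> and \<open>?T\<close> belonging to G - e and G, their quotient is
  concentrated on the sets \<open>A\<close> whose complement is independent but for e. These lie
  between \<open>?N\<close> and its union with \<open>?\<tau>\<close>. As every neighbour of
  \<open>x\<close> in \<sigma> is \<open>y\<close> or a neighbour of \<open>y\<close>, the complex
  on this interval is the one of \<open>?\<tau>\<close>, shifted by one less than the degree of
  \<open>y\<close>; the connecting map supplies the missing 1.\<close>

lemma betti_nz_splitting_edge:
  fixes k :: "'k::field itself" and ord :: "'v \<Rightarrow> nat"
  assumes fin: "finite \<sigma>" and inj: "inj_on ord \<sigma>" and xy: "x \<in> \<sigma>" "y \<in> \<sigma>"
    and E: "\<And>e. e \<in> E \<Longrightarrow> card e = 2" and e: "{x, y} \<in> E"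
    and N: "nbrs E x \<inter> \<sigma> \<subseteq> closed_nbrs E y"
  shows "betti_nz k ord E p \<sigma> \<longleftrightarrow> betti_nz k ord (E - {{x, y}}) p \<sigma> \<or>
    card (nbrs E y \<inter> \<sigma>) \<le> p \<and> betti_nz k ord E (p - card (nbrs E y \<inter> \<sigma>)) (\<sigma> - closed_nbrs E y)"
proof -
  let ?X = "scalar :: 'v \<Rightarrow> 'k \<Rightarrow> 'k" and ?S = "\<lambda>_. UNIV :: 'k set"
  let ?E = "E - {{x, y}}"
  let ?U = "zero_on (cofaces ?E \<sigma>) :: 'v set \<Rightarrow> 'k set"
  let ?T = "zero_on (cofaces E \<sigma>) :: 'v set \<Rightarrow> 'k set"
  let ?N = "nbrs E y \<inter> \<sigma> - {x}" and ?\<tau> = "\<sigma> - closed_nbrs E y"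
  interpret koszul ord \<sigma> ?X by (rule koszul_scalar[OF fin inj])
  have fam: "subfam \<sigma> ?X ?S" "subfam \<sigma> ?X ?T" "subfam \<sigma> ?X ?U"
    by (simp_all only: subfam_UNIV subfam_cofaces)
  have le: "\<And>A. A \<subseteq> \<sigma> \<Longrightarrow> ?U A \<subseteq> ?T A" "\<And>A. A \<subseteq> \<sigma> \<Longrightarrow> ?T A \<subseteq> ?S A"
    by (auto simp: zero_on_def cofaces_def indep_def)
  have edge: "f = {z, w}" if "f \<in> E" "z \<in> f" "w \<in> f" "w \<noteq> z" for f w z
    using E[OF that(1)] that by (auto simp: card_2_iff)
  have noloop: "{z} \<notin> E" for z using E[of "{z}"] by auto
  then have zN: "z \<notin> nbrs E z" for z by (auto simp: nbrs_def)
  have xne: "x \<noteq> y" using E[OF e] by auto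
  have xNy: "x \<in> nbrs E y" using e by (simp add: nbrs_def insert_commute)
  have cN: "card (nbrs E y \<inter> \<sigma>) = Suc (card ?N)"
    using xNy xy fin by (simp add: card_Suc_Diff1 del: card_Diff_insert)
  have diff: "x \<notin> A \<and> y \<notin> A \<and> ?N \<subseteq> A \<and> A \<subseteq> ?N \<union> ?\<tau>"
    if "A \<subseteq> \<sigma>" "A \<in> cofaces ?E \<sigma>" "A \<notin> cofaces E \<sigma>" for A
  proof -
    have xA: "x \<notin> A" "y \<notin> A" using that by (auto simp: cofaces_def indep_def)
    have "?N \<subseteq> A"
    proof
      fix w assume w: "w \<in> ?N"
      then have "{y, w} \<in> E" "{y, w} \<noteq> {x, y}" "w \<in> \<sigma>" using xne by (auto simp: nbrs_def doubleton_eq_iff)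
      then show "w \<in> A" using cofacesD[OF that(2), of "{y, w}"] xA xy by blast
    qed
    moreover have "A \<subseteq> ?N \<union> ?\<tau>" using that(1) xA by (auto simp: closed_nbrs_def)
    ultimately show ?thesis using xA by auto
  qed
  have TU: "hom_nz ord \<sigma> ?X ?T ?U q \<longleftrightarrow> card ?N \<le> q \<and> betti_nz k ord E (q - card ?N) ?\<tau>" for q
  proof -
    have "hom_nz ord \<sigma> ?X ?T ?U q \<longleftrightarrow> card ?N \<le> q \<and>
      hom_nz ord ?\<tau> ?X (\<lambda>A. ?T (?N \<union> A)) (\<lambda>A. ?U (?N \<union> A)) (q - card ?N)"
    proof (rule hom_nz_interval[OF fin inj _ _ _ fam(2,3) le(1)])
      fix A assume A: "A \<subseteq> \<sigma>" "\<not> (?N \<subseteq> A \<and> A \<subseteq> ?N \<union> ?\<tau>)"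
      then show "?T A \<subseteq> ?U A" using diff[OF A(1)] by (auto simp: zero_on_def)
    qed (auto simp: closed_nbrs_def)
    also have "hom_nz ord ?\<tau> ?X (\<lambda>A. ?T (?N \<union> A)) (\<lambda>A. ?U (?N \<union> A)) (q - card ?N) \<longleftrightarrow>
      betti_nz k ord E (q - card ?N) ?\<tau>"
      unfolding betti_nz_def
    proof (rule hom_nz_cong)
      fix A assume A: "A \<subseteq> ?\<tau>"
      then have "x \<notin> ?N \<union> A" "y \<notin> ?N \<union> A" using zN xNy by (auto simp: closed_nbrs_def)
      then have "?N \<union> A \<notin> cofaces E \<sigma>" using cofacesD[OF _ e, of "?N \<union> A" \<sigma>] xy by blast
      then show "?T (?N \<union> A) = ?S A" by (auto simp: zero_on_def)
      have eq: "\<sigma> - (?N \<union> A) = insert x (insert y (?\<tau> - A))"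
        using A xy zN xNy by (auto simp: closed_nbrs_def)
      have "indep ?E (insert x (insert y (?\<tau> - A))) \<longleftrightarrow> indep E (?\<tau> - A)"
      proof
        assume ind: "indep E (?\<tau> - A)"
        show "indep ?E (insert x (insert y (?\<tau> - A)))"
          unfolding indep_def
        proof (intro ballI notI)
          fix f assume f: "f \<in> ?E" "f \<subseteq> insert x (insert y (?\<tau> - A))"
          then have fE: "f \<in> E" and fne: "f \<noteq> {x, y}" by auto
          have "x \<in> f \<or> y \<in> f" using ind f by (auto simp: indep_def)
          then obtain z where z: "z = x \<or> z = y" "z \<in> f" by auto
          obtain w where w: "w \<in> f" "w \<noteq> z" using E[OF fE] by (auto simp: card_2_iff)
          then have fz: "f = {z, w}" using edge fE z(2) by blast
          then have wN: "w \<in> nbrs E z" using fE by (simp add: nbrs_def)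
          have wxy: "w \<noteq> x" "w \<noteq> y" using fne fz z(1) w(2) by (auto simp: insert_commute)
          then have "w \<in> ?\<tau>" using w f(2) by auto
          moreover have "w \<in> closed_nbrs E y"
            using z(1) wN N \<open>w \<in> ?\<tau>\<close> by (auto simp: closed_nbrs_def)
          ultimately show False by auto
        qed
      next
        assume ind: "indep ?E (insert x (insert y (?\<tau> - A)))"
        have "y \<notin> ?\<tau>" by (simp add: closed_nbrs_def)
        then show "indep E (?\<tau> - A)" using ind by (auto simp: indep_def)
      qed
      then show "?U (?N \<union> A) = zero_on (cofaces E ?\<tau>) A"
        by (simp add: zero_on_def cofaces_def eq)
    qed
    finally show ?thesis .
  qed
  \<comment> \<open>A cycle with values in \<open>?T\<close> is zero on the cofaces of G - e that
    contain \<open>y\<close>, so only sets avoiding \<open>y\<close> matter. These form a cone with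
    apex \<open>x\<close>: if adding \<open>x\<close> to a complement created an edge {x, w} other
    than e, then {y, w} would already be an edge inside that complement.\<close>
  have zm: "boundary ord \<sigma> ?X ?S ?U q c" if c: "chain \<sigma> ?T q c" "cycle ord \<sigma> ?X ?U q c" for q c
  proof -
    define \<Delta> where "\<Delta> = cofaces ?E \<sigma> \<inter> {A. y \<notin> A}"
    have Vy: "\<sigma> - {y} - A = \<sigma> - A - {y}" for A by auto
    have "\<exists>d. \<forall>A. A \<subseteq> \<sigma> - {y} \<longrightarrow> A \<in> \<Delta> \<longrightarrow> card A = q \<longrightarrow> c A = koszul_d ord (\<sigma> - {y}) scalar d A"
    proof (rule cone_exact[of _ _ x])
      show "finite (\<sigma> - {y})" "inj_on ord (\<sigma> - {y})" using fin inj by (auto intro: inj_on_diff)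
      show "x \<in> \<sigma> - {y}" using xy xne by auto
    next
      fix A assume A: "A \<subseteq> \<sigma> - {y}" "A \<in> \<Delta>"
      have ind: "indep ?E (\<sigma> - A)" "y \<notin> A" using A(2) by (auto simp: \<Delta>_def cofaces_def)
      have "indep ?E (\<sigma> - (A - {x}))"
        unfolding indep_def
      proof (intro ballI notI)
        fix f assume f: "f \<in> ?E" "f \<subseteq> \<sigma> - (A - {x})"
        then have fE: "f \<in> E" and fne: "f \<noteq> {x, y}" by auto
        have "x \<in> f" using ind f by (auto simp: indep_def)
        obtain w where w: "w \<in> f" "w \<noteq> x" using E[OF fE] by (auto simp: card_2_iff)
        then have fz: "f = {x, w}" using edge fE \<open>x \<in> f\<close> by blast
        then have wy: "w \<noteq> y" using fne by auto
        have w2: "w \<in> \<sigma>" "w \<notin> A" using f(2) w by auto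
        have "w \<in> nbrs E x" using fE fz by (simp add: nbrs_def)
        then have "w \<in> nbrs E y" using N w2 wy by (auto simp: closed_nbrs_def)
        then have "{y, w} \<in> ?E" using wy w(2) xne by (auto simp: nbrs_def doubleton_eq_iff)
        moreover have "{y, w} \<subseteq> \<sigma> - A" using xy ind(2) w2 by auto
        ultimately show False using ind(1) unfolding indep_def by blast
      qed
      then show "A - {x} \<in> \<Delta>" using ind by (auto simp: \<Delta>_def cofaces_def)
    next
      fix A assume A: "A \<subseteq> \<sigma> - {y}" "A \<in> \<Delta>" "Suc (card A) = q"
      have y: "y \<notin> A" "A \<subseteq> \<sigma>" "finite A" using A fin finite_subset by auto
      have ins: "insert y A \<subseteq> \<sigma>" "card (insert y A) = q" using A y xy by auto
      have "insert y A \<in> cofaces ?E \<sigma>" using A(2) by (auto simp: \<Delta>_def cofaces_def indep_def)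
      then have "insert y A \<in> cofaces E \<sigma>" using diff[OF ins(1)] by blast
      moreover have "c (insert y A) \<in> ?T (insert y A)" using c(1) ins unfolding chain_def by blast
      ultimately have c0: "c (insert y A) = 0" by (simp add: zero_on_def)
      have "koszul_d ord \<sigma> scalar c A = 0"
        using c(2) A y by (auto simp: cycle_def zero_on_def \<Delta>_def)
      moreover have "koszul_d ord \<sigma> scalar c A = koszul_d ord (\<sigma> - {y}) scalar c A"
        unfolding koszul_d_def Vy using fin xy y c0
        by (subst sum.remove[of _ y]) (auto simp: scalar_def)
      ultimately show "koszul_d ord (\<sigma> - {y}) scalar c A = 0" by simp
    qed
    then obtain d where d: "\<forall>A. A \<subseteq> \<sigma> - {y} \<longrightarrow> A \<in> \<Delta> \<longrightarrow> card A = q \<longrightarrow>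
        c A = koszul_d ord (\<sigma> - {y}) scalar d A" ..
    \<comment> \<open>Extended by zero, the bounding chain has zero differential at sets containing
      \<open>y\<close>; there \<open>c\<close> vanishes too on the cofaces of G - e.\<close>
    define d' where "d' A = (if y \<in> A then 0 else d A)" for A
    show ?thesis
      unfolding boundary_def
    proof (intro exI[of _ d'] conjI)
      show "chain \<sigma> ?U q (\<lambda>A. c A - koszul_d ord \<sigma> ?X d' A)"
        unfolding chain_def
      proof (intro allI impI)
        fix A assume A: "A \<subseteq> \<sigma>" "card A = q"
        have "c A - koszul_d ord \<sigma> ?X d' A = 0" if cof: "A \<in> cofaces ?E \<sigma>"
        proof (cases "y \<in> A")
          case True
          then have "A \<in> cofaces E \<sigma>" using diff[OF A(1) cof] by blast
          then have "c A = 0" using c(1) A by (auto simp: chain_def zero_on_def)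
          moreover have "koszul_d ord \<sigma> ?X d' A = 0" using True by (simp add: koszul_d_def d'_def scalar_def)
          ultimately show ?thesis by simp
        next
          case False
          have "koszul_d ord \<sigma> ?X d' A = koszul_d ord (\<sigma> - {y}) ?X d' A"
            unfolding koszul_d_def Vy using fin xy False
            by (subst sum.remove[of _ y]) (auto simp: scalar_def d'_def)
          also have "\<dots> = koszul_d ord (\<sigma> - {y}) ?X d A"
            by (rule koszul_d_cong) (use False in \<open>auto simp: d'_def\<close>)
          also have "\<dots> = c A"
          proof -
            have "A \<subseteq> \<sigma> - {y}" "A \<in> \<Delta>" using A False cof by (auto simp: \<Delta>_def)
            then show ?thesis using d A(2) by metis
          qed
          finally show ?thesis by simp
        qed
        then show "c A - koszul_d ord \<sigma> ?X d' A \<in> ?U A" by (simp add: zero_on_def)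
      qed
    qed simp
  qed
  have U: "betti_nz k ord ?E p \<sigma> = hom_nz ord \<sigma> ?X ?S ?U p" "betti_nz k ord E p \<sigma> = hom_nz ord \<sigma> ?X ?S ?T p" for p
    by (simp_all add: betti_nz_def)
  show ?thesis
  proof
    assume l: "betti_nz k ord E p \<sigma>"
    show "betti_nz k ord ?E p \<sigma> \<or>
      card (nbrs E y \<inter> \<sigma>) \<le> p \<and> betti_nz k ord E (p - card (nbrs E y \<inter> \<sigma>)) ?\<tau>"
    proof (cases p)
      case 0
      then show ?thesis using l les_zero[of ?U ?T ?S] le(1) unfolding U by blast
    next
      case (Suc q)
      then have "hom_nz ord \<sigma> ?X ?S ?U p \<or> hom_nz ord \<sigma> ?X ?T ?U q"
        using l les_connecting[OF fam le] unfolding U by blast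
      then show ?thesis unfolding U TU cN Suc by auto
    qed
  next
    assume r: "betti_nz k ord ?E p \<sigma> \<or>
      card (nbrs E y \<inter> \<sigma>) \<le> p \<and> betti_nz k ord E (p - card (nbrs E y \<inter> \<sigma>)) ?\<tau>"
    then show "betti_nz k ord E p \<sigma>"
    proof
      assume "betti_nz k ord ?E p \<sigma>"
      then show ?thesis unfolding U using les_zero_map_restrict[OF fam le zm] by blast
    next
      assume h: "card (nbrs E y \<inter> \<sigma>) \<le> p \<and> betti_nz k ord E (p - card (nbrs E y \<inter> \<sigma>)) ?\<tau>"
      then obtain q where q: "p = Suc q" using cN by (cases p) auto
      then have "hom_nz ord \<sigma> ?X ?T ?U q" using h unfolding TU cN by auto
      then show ?thesis unfolding U q using les_zero_map_lift[OF fam le zm] by blast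
    qed
  qed
qed

section \<open>Subadditivity for squarefree degrees\<close>

text \<open>Walking around the cycle from \<open>j\<close>, \<open>P\<close> must be entered
  somewhere. When \<open>P\<close> says that an edge is present, this place is the end of a gap,
  hence a leaf.\<close>

lemma mod_cycle_step:
  fixes P :: "nat \<Rightarrow> bool"
  assumes "i < n" "P i" "j < n" "\<not> P j"
  shows "\<exists>l<n. \<not> P l \<and> P ((l + 1) mod n)"
proof (rule ccontr)
  assume neg: "\<not> ?thesis"
  have "\<not> P ((j + t) mod n)" for t
  proof (induction t)
    case 0
    then show ?case using assms by simp
  next
    case (Suc t)
    have "(j + t) mod n < n" using assms by simp
    then have "\<not> P (((j + t) mod n + 1) mod n)" using neg Suc by blast
    then show ?case by (simp add: mod_simps)
  qed
  from this[of "n - j + i"] show False using assms by simp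
qed

lemma mod_Suc_inj: "i < n \<Longrightarrow> j < n \<Longrightarrow> (i + 1) mod n = (j + 1) mod n \<Longrightarrow> i = j" for i j n :: nat
  by (auto simp: mod_Suc split: if_splits)

section \<open>Subadditivity and splitting edges\<close>

locale vertex_order =
  fixes k :: "'k::field itself" and ord :: "'v \<Rightarrow> nat" and V :: "'v set"
  assumes finV: "finite V" and inj_ord: "inj_on ord V"
begin

abbreviation "NV \<equiv> betti_nz k ord"

definition edges :: "'v set set \<Rightarrow> bool" where
  "edges E \<longleftrightarrow> (\<forall>e\<in>E. e \<subseteq> V \<and> card e = 2)"

text \<open>The two sets are sought inside \<sigma>, not just in \<open>V\<close>: those found in
  \<sigma> - N[y] get enlarged by \<open>y\<close> and neighbours of \<open>y\<close>, which have to
  be new vertices.\<close>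

definition subadd_at :: "'v set set \<Rightarrow> 'v set \<Rightarrow> bool" where
  "subadd_at E \<sigma> \<longleftrightarrow> (\<forall>a b. NV E (a + b) \<sigma> \<longrightarrow>
     (\<exists>\<sigma>1 \<sigma>2. \<sigma>1 \<subseteq> \<sigma> \<and> \<sigma>2 \<subseteq> \<sigma> \<and> NV E a \<sigma>1 \<and> NV E b \<sigma>2 \<and> card \<sigma> \<le> card \<sigma>1 + card \<sigma>2))"

definition subadd :: "'v set set \<Rightarrow> bool" where
  "subadd E \<longleftrightarrow> (\<forall>\<sigma>\<subseteq>V. subadd_at E \<sigma>)"

lemma subadd_atD:
  assumes "subadd_at E \<sigma>" "NV E (a + b) \<sigma>"
  obtains \<sigma>1 \<sigma>2 where "\<sigma>1 \<subseteq> \<sigma>" "\<sigma>2 \<subseteq> \<sigma>" "NV E a \<sigma>1" "NV E b \<sigma>2" "card \<sigma> \<le> card \<sigma>1 + card \<sigma>2"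
proof -
  from assms have "\<exists>\<sigma>1 \<sigma>2. \<sigma>1 \<subseteq> \<sigma> \<and> \<sigma>2 \<subseteq> \<sigma> \<and> NV E a \<sigma>1 \<and> NV E b \<sigma>2 \<and> card \<sigma> \<le> card \<sigma>1 + card \<sigma>2"
    by (simp only: subadd_at_def)
  then show ?thesis using that by metis
qed

lemma sub_V: "\<sigma> \<subseteq> V \<Longrightarrow> finite \<sigma>" "\<sigma> \<subseteq> V \<Longrightarrow> inj_on ord \<sigma>"
  using finV inj_ord by (auto intro: finite_subset inj_on_subset)

lemma edges_empty: "edges E \<Longrightarrow> {} \<notin> E"
  by (auto simp: edges_def)

lemma edges_doubleton: "edges E \<Longrightarrow> e \<in> E \<Longrightarrow> x \<in> e \<Longrightarrow> y \<in> e \<Longrightarrow> x \<noteq> y \<Longrightarrow> e = {x, y}"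
  by (fastforce simp: edges_def card_2_iff)

lemma edges_neq: "edges E \<Longrightarrow> {x, y} \<in> E \<Longrightarrow> x \<noteq> y"
  by (auto simp: edges_def)

lemma NV_splitting_edge:
  assumes "edges E" "\<sigma> \<subseteq> V" "x \<in> \<sigma>" "y \<in> \<sigma>" "{x, y} \<in> E" "nbrs E x \<inter> \<sigma> \<subseteq> closed_nbrs E y"
  shows "NV E p \<sigma> \<longleftrightarrow> NV (E - {{x, y}}) p \<sigma> \<or>
    card (nbrs E y \<inter> \<sigma>) \<le> p \<and> NV E (p - card (nbrs E y \<inter> \<sigma>)) (\<sigma> - closed_nbrs E y)"
  using assms by (intro betti_nz_splitting_edge) (auto simp: sub_V edges_def)

lemma NV_empty: "edges E \<Longrightarrow> NV E 0 {}"
  using betti_nz_empty[OF edges_empty] by auto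

text \<open>The empty set has homology in degree 0, so \<sigma> and the empty set work if
  \<open>a\<close> or \<open>b\<close> is 0.\<close>

lemma subadd_atI_trivial:
  assumes E: "edges E" and "\<And>a b. 0 < a \<Longrightarrow> 0 < b \<Longrightarrow> NV E (a + b) \<sigma> \<Longrightarrow>
    (\<exists>\<sigma>1 \<sigma>2. \<sigma>1 \<subseteq> \<sigma> \<and> \<sigma>2 \<subseteq> \<sigma> \<and> NV E a \<sigma>1 \<and> NV E b \<sigma>2 \<and> card \<sigma> \<le> card \<sigma>1 + card \<sigma>2)"
  shows "subadd_at E \<sigma>"
  unfolding subadd_at_def
proof (intro allI impI)
  fix a b assume nz: "NV E (a + b) \<sigma>"
  consider "a = 0" | "b = 0" | "0 < a" "0 < b" by blast
  then show "\<exists>\<sigma>1 \<sigma>2. \<sigma>1 \<subseteq> \<sigma> \<and> \<sigma>2 \<subseteq> \<sigma> \<and> NV E a \<sigma>1 \<and> NV E b \<sigma>2 \<and> card \<sigma> \<le> card \<sigma>1 + card \<sigma>2"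
  proof cases
    case 1
    then show ?thesis using nz NV_empty[OF E] by (intro exI[of _ "{}"] exI[of _ \<sigma>]) auto
  next
    case 2
    then show ?thesis using nz NV_empty[OF E] by (intro exI[of _ \<sigma>] exI[of _ "{}"]) auto
  next
    case 3
    then show ?thesis using assms(2) nz by blast
  qed
qed

lemma subadd_splitting_edge:
  assumes E: "edges E" and e: "{x, y} \<in> E" and N: "nbrs E x \<subseteq> closed_nbrs E y"
    and SA: "subadd (E - {{x, y}})"
  shows "subadd E"
  unfolding subadd_def
proof (intro allI impI)
  fix \<sigma> assume \<sigma>: "\<sigma> \<subseteq> V"
  let ?E = "E - {{x, y}}" and ?\<tau> = "\<sigma> - closed_nbrs E y"
  have split: "NV E p \<tau> \<longleftrightarrow> NV ?E p \<tau> \<or>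
    card (nbrs E y \<inter> \<tau>) \<le> p \<and> NV E (p - card (nbrs E y \<inter> \<tau>)) (\<tau> - closed_nbrs E y)"
    if "\<tau> \<subseteq> V" "x \<in> \<tau>" "y \<in> \<tau>" for p \<tau>
    using that N e E by (intro NV_splitting_edge) auto
  have cong: "NV ?E p \<tau> \<longleftrightarrow> NV E p \<tau>" if "\<not> (x \<in> \<tau> \<and> y \<in> \<tau>)" for p \<tau>
    by (rule betti_nz_cong) (use that in auto)
  have mono: "NV E p \<tau>" if "NV ?E p \<tau>" "\<tau> \<subseteq> V" for p \<tau>
    using that cong[of \<tau> p] split[of \<tau> p] by blast
  have yN: "y \<notin> nbrs E y" using edges_neq[OF E, of y y] by (auto simp: nbrs_def)
  have xy: "x \<noteq> y" "x \<in> nbrs E y" using edges_neq[OF E e] e by (auto simp: nbrs_def insert_commute)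
  show "subadd_at E \<sigma>"
    unfolding subadd_at_def
  proof (intro allI impI)
    fix a b assume nz: "NV E (a + b) \<sigma>"
    show "\<exists>\<sigma>1 \<sigma>2. \<sigma>1 \<subseteq> \<sigma> \<and> \<sigma>2 \<subseteq> \<sigma> \<and> NV E a \<sigma>1 \<and> NV E b \<sigma>2 \<and> card \<sigma> \<le> card \<sigma>1 + card \<sigma>2"
    proof (cases "NV ?E (a + b) \<sigma>")
      case True
      then obtain \<sigma>1 \<sigma>2 where h: "\<sigma>1 \<subseteq> \<sigma>" "\<sigma>2 \<subseteq> \<sigma>" "NV ?E a \<sigma>1" "NV ?E b \<sigma>2"
        "card \<sigma> \<le> card \<sigma>1 + card \<sigma>2"
        using SA \<sigma> subadd_atD[OF _ True] unfolding subadd_def by metis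
      have "NV E a \<sigma>1" "NV E b \<sigma>2" using h \<sigma> mono by auto
      with h show ?thesis by blast
    next
      case False
      then have in\<sigma>: "x \<in> \<sigma>" "y \<in> \<sigma>" using nz cong[of \<sigma>] by auto
      let ?N = "nbrs E y \<inter> \<sigma>"
      define d where "d = card ?N"
      have d: "d \<le> a + b" "NV E (a + b - d) ?\<tau>" using split[OF \<sigma> in\<sigma>] nz False by (auto simp: d_def)
      have finN: "finite ?N" using sub_V(1)[OF \<sigma>] by auto
      have d1: "1 \<le> d" unfolding d_def using xy in\<sigma> finN
        by (metis IntI One_nat_def Suc_leI card_gt_0_iff empty_iff)
      \<comment> \<open>Since \<open>?\<tau>\<close> avoids \<open>y\<close>, the edge makes no
        difference there, and the hypothesis on G - e applies.\<close>
      have "NV ?E (a + b - d) ?\<tau>" using cong[of ?\<tau>] d(2) by (auto simp: closed_nbrs_def)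
      \<comment> \<open>Any split of \<open>d\<close> into parts bounded by \<open>a\<close> and
        \<open>b\<close> works; here \<open>a\<close> takes as much as it can.\<close>
      define a1 where "a1 = min a d"
      define b1 where "b1 = d - a1"
      have ab: "a + b - d = (a - a1) + (b - b1)" "a1 \<le> a" "b1 \<le> b" "a1 + b1 = d"
        using d(1) by (auto simp: a1_def b1_def)
      have "NV ?E ((a - a1) + (b - b1)) ?\<tau>" using \<open>NV ?E (a + b - d) ?\<tau>\<close> ab(1) by simp
      moreover have "?\<tau> \<subseteq> V" using \<sigma> by blast
      then have "subadd_at ?E ?\<tau>" using SA by (simp add: subadd_def)
      ultimately obtain \<tau>1 \<tau>2 where h: "\<tau>1 \<subseteq> ?\<tau>" "\<tau>2 \<subseteq> ?\<tau>" "NV ?E (a - a1) \<tau>1"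
        "NV ?E (b - b1) \<tau>2" "card ?\<tau> \<le> card \<tau>1 + card \<tau>2"
        using subadd_atD by metis
      \<comment> \<open>The degree is raised by \<open>c\<close> with \<open>c\<close> neighbours of
        \<open>y\<close> and \<open>y\<close> itself. The vertex \<open>x\<close> is one of them, so
        that the edge lies in the enlarged set and \<open>split\<close> applies.\<close>
      have ext: "\<exists>\<sigma>'. \<sigma>' \<subseteq> \<sigma> \<and> NV E (m + c) \<sigma>' \<and> card \<tau>' + c + (if c = 0 then 0 else 1) \<le> card \<sigma>'"
        if \<tau>': "\<tau>' \<subseteq> ?\<tau>" and nv': "NV ?E m \<tau>'" and c: "c \<le> d" for \<tau>' m c
      proof (cases "c = 0")
        case True
        then show ?thesis using \<tau>' mono[OF nv'] \<sigma> by (intro exI[of _ \<tau>']) auto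
      next
        case False
        have "c - 1 \<le> card (?N - {x})"
          using c xy in\<sigma> finN by (simp add: d_def)
        then obtain A0 where A0: "A0 \<subseteq> ?N - {x}" "card A0 = c - 1" "finite A0"
          using obtain_subset_with_card_n by metis
        define A1 where "A1 = insert x A0"
        have A1: "A1 \<subseteq> ?N" "card A1 = c" "finite A1" "x \<in> A1"
          using A0 xy in\<sigma> False by (auto simp: A1_def card_insert_if)
        define \<sigma>' where "\<sigma>' = \<tau>' \<union> insert y A1"
        have sub: "\<sigma>' \<subseteq> \<sigma>" using \<tau>' A1 in\<sigma> by (auto simp: \<sigma>'_def)
        have fin': "finite \<tau>'" using \<tau>' sub_V(1)[OF \<sigma>] finite_subset by blast
        have 1: "nbrs E y \<inter> \<sigma>' = A1"
          using \<tau>' A1 yN by (auto simp: \<sigma>'_def closed_nbrs_def)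
        have 2: "\<sigma>' - closed_nbrs E y = \<tau>'"
          using \<tau>' A1 by (auto simp: \<sigma>'_def closed_nbrs_def)
        have "NV E (m + c) \<sigma>'"
        proof -
          have "\<sigma>' \<subseteq> V" "\<tau>' \<subseteq> V" "x \<in> \<sigma>'" "y \<in> \<sigma>'"
            using sub \<sigma> \<tau>' A1 unfolding \<sigma>'_def by blast+
          then show ?thesis using split[of \<sigma>' "m + c"] mono[OF nv'] A1(2) unfolding 1 2 by simp
        qed
        moreover have "card \<sigma>' = card \<tau>' + Suc c"
        proof -
          have "\<tau>' \<inter> insert y A1 = {}" using \<tau>' A1 by (auto simp: closed_nbrs_def)
          then have "card \<sigma>' = card \<tau>' + card (insert y A1)"
            unfolding \<sigma>'_def using fin' A1 by (intro card_Un_disjoint) auto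
          moreover have "y \<notin> A1" using A1 yN by auto
          ultimately show ?thesis using A1 by simp
        qed
        ultimately show ?thesis using sub False by (intro exI[of _ \<sigma>']) auto
      qed
      obtain \<sigma>1 where s1: "\<sigma>1 \<subseteq> \<sigma>" "NV E (a - a1 + a1) \<sigma>1"
          "card \<tau>1 + a1 + (if a1 = 0 then 0 else 1) \<le> card \<sigma>1"
        using ext[OF h(1,3), of a1] ab(4) by auto
      obtain \<sigma>2 where s2: "\<sigma>2 \<subseteq> \<sigma>" "NV E (b - b1 + b1) \<sigma>2"
          "card \<tau>2 + b1 + (if b1 = 0 then 0 else 1) \<le> card \<sigma>2"
        using ext[OF h(2,4), of b1] ab(4) by auto
      have "card \<sigma> = card ?\<tau> + Suc d"
      proof -
        have "\<sigma> = ?\<tau> \<union> insert y ?N" using in\<sigma> by (auto simp: closed_nbrs_def)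
        moreover have "card (?\<tau> \<union> insert y ?N) = card ?\<tau> + card (insert y ?N)"
          by (rule card_Un_disjoint) (use sub_V(1)[OF \<sigma>] in \<open>auto simp: closed_nbrs_def\<close>)
        moreover have "card (insert y ?N) = Suc d" using finN yN by (simp add: d_def)
        ultimately show ?thesis by simp
      qed
      \<comment> \<open>As \<open>d\<close> is positive, so is \<open>a1\<close> or
        \<open>b1\<close>, and the extra vertex it brings compensates for \<open>y\<close>.\<close>
      then have "card \<sigma> \<le> card \<sigma>1 + card \<sigma>2"
        using h(5) s1(3) s2(3) ab(4) d1 by (auto split: if_splits)
      then show ?thesis using s1 s2 ab by auto
    qed
  qed
qed

end

section \<open>A cycle next to a disjoint subadditive graph\<close>

locale cycle_plus = vertex_order k ord V
  for k :: "'k::field itself" and ord :: "'v \<Rightarrow> nat" and V :: "'v set" +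
  fixes n :: nat and f :: "nat \<Rightarrow> 'v" and C :: "'v set" and E' :: "'v set set"
  assumes n3: "3 \<le> n" and bij: "bij_betw f {..<n} C" and CV: "C \<subseteq> V"
    and E': "edges E'" and disj: "\<And>e. e \<in> E' \<Longrightarrow> e \<inter> C = {}" and SA': "subadd E'"
begin

definition g :: "nat \<Rightarrow> 'v set" where
  "g i = {f i, f ((i + 1) mod n)}"

definition EC :: "'v set set" where
  "EC = g ` {..<n}"

abbreviation "E \<equiv> EC \<union> E'"

lemma f_eq: "i < n \<Longrightarrow> j < n \<Longrightarrow> f i = f j \<longleftrightarrow> i = j"
  using bij by (auto simp: bij_betw_def inj_on_def)

lemma f_in: "i < n \<Longrightarrow> f i \<in> C"
  using bij by (auto simp: bij_betw_def)

lemma C_eq: "C = f ` {..<n}"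
  using bij by (auto simp: bij_betw_def)

lemma g_sub: "i < n \<Longrightarrow> g i \<subseteq> C"
  using n3 by (auto simp: g_def f_in)

lemma edges_EC: "edges EC"
proof -
  have "card (g i) = 2" if "i < n" for i
  proof -
    have "(i + 1) mod n \<noteq> i" using that n3 by (simp add: mod_Suc)
    then have "f i \<noteq> f ((i + 1) mod n)" using that n3 f_eq[of i "(i + 1) mod n"] by auto
    then show ?thesis by (simp add: g_def)
  qed
  then show ?thesis using g_sub CV by (auto simp: edges_def EC_def)
qed

lemma edges_E: "edges E"
  using edges_EC E' by (auto simp: edges_def)

text \<open>Both alternatives identify the edge as some \<open>g j\<close>, because
  \<open>subadd_proper\<close> has to decide whether it belongs to a given set of cycle
  edges.\<close>

lemma f_edge: "i < n \<Longrightarrow> {f i, w} \<in> E \<Longrightarrow>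
    w = f ((i + 1) mod n) \<and> {f i, w} = g i \<or> (\<exists>j<n. (j + 1) mod n = i \<and> w = f j \<and> {f i, w} = g j)"
proof -
  assume i: "i < n" and e: "{f i, w} \<in> E"
  have "{f i, w} \<notin> E'" using disj f_in[OF i] by blast
  then obtain j where j: "j < n" "{f i, w} = g j" using e by (auto simp: EC_def)
  then have "f i = f j \<and> w = f ((j + 1) mod n) \<or> f i = f ((j + 1) mod n) \<and> w = f j"
    by (auto simp: g_def doubleton_eq_iff)
  then show ?thesis
  proof
    assume "f i = f j \<and> w = f ((j + 1) mod n)"
    then show ?thesis using f_eq[OF i j(1)] j by auto
  next
    assume "f i = f ((j + 1) mod n) \<and> w = f j"
    moreover have "(j + 1) mod n < n" using n3 by simp
    ultimately show ?thesis using f_eq[OF i, of "(j + 1) mod n"] j by auto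
  qed
qed

text \<open>A proper subset of the cycle edges forms paths. If \<open>g l\<close> is missing and the
  next edge is present, their common vertex is a leaf, so the present edge is a splitting edge;
  deleting it keeps the subset proper.\<close>

lemma subadd_proper:
  assumes "F \<subset> EC"
  shows "subadd (F \<union> E')"
proof -
  have "finite EC" by (simp add: EC_def)
  then have "finite F" using assms finite_subset by blast
  then show ?thesis using assms
  proof (induction F rule: finite_psubset_induct)
    case (psubset F)
    show ?case
    proof (cases "F = {}")
      case True
      then show ?thesis using SA' by simp
    next
      case False
      obtain i where i: "i < n" "g i \<in> F" using False psubset.prems by (auto simp: EC_def)
      obtain j where j: "j < n" "g j \<notin> F" using psubset.prems by (auto simp: EC_def)
      obtain l where l: "l < n" "g l \<notin> F" "g ((l + 1) mod n) \<in> F"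
        using mod_cycle_step[of i n "\<lambda>i. g i \<in> F" j] i j by auto
      define m where "m = (l + 1) mod n"
      have m: "m < n" using n3 by (simp add: m_def)
      let ?x = "f m" and ?y = "f ((m + 1) mod n)"
      have xy: "{?x, ?y} = g m" by (simp add: g_def)
      have sub: "F \<union> E' \<subseteq> E" using psubset.prems by auto
      have "nbrs (F \<union> E') ?x \<subseteq> closed_nbrs (F \<union> E') ?y"
      proof
        fix w assume "w \<in> nbrs (F \<union> E') ?x"
        then have e: "{?x, w} \<in> F \<union> E'" by (simp add: nbrs_def)
        then have "{?x, w} \<in> E" using sub by blast
        from f_edge[OF m this] show "w \<in> closed_nbrs (F \<union> E') ?y"
        proof
          assume "w = ?y \<and> {?x, w} = g m" then show ?thesis by (simp add: closed_nbrs_def)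
        next
          assume "\<exists>j<n. (j + 1) mod n = m \<and> w = f j \<and> {?x, w} = g j"
          then obtain j where j: "j < n" "(j + 1) mod n = m" "{?x, w} = g j" by auto
          then have "j = l" using mod_Suc_inj[OF j(1) l(1)] by (simp add: m_def)
          then have "{?x, w} \<in> E'" using e j l(2) by auto
          then show ?thesis using disj f_in[OF m] by blast
        qed
      qed
      moreover have "{?x, ?y} \<in> F \<union> E'" using l xy by (simp add: m_def)
      moreover have "edges (F \<union> E')" using edges_E sub by (auto simp: edges_def)
      moreover have "F \<union> E' - {{?x, ?y}} = (F - {g m}) \<union> E'"
        unfolding xy using disj[of "g m"] f_in[OF m] by (auto simp: g_def)
      moreover have "subadd ((F - {g m}) \<union> E')"
        using l psubset.prems by (intro psubset.IH) (auto simp: m_def)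
      ultimately show ?thesis using subadd_splitting_edge[of "F \<union> E'" ?x ?y] by simp
    qed
  qed
qed

text \<open>A missing vertex removes an edge of the cycle from the induced subgraph, which reduces
  the claim to a proper subset of the cycle edges.\<close>

lemma subadd_at_not_full:
  assumes \<sigma>: "\<sigma> \<subseteq> V" and "\<not> C \<subseteq> \<sigma>"
  shows "subadd_at E \<sigma>"
proof -
  obtain i where i: "i < n" "f i \<notin> \<sigma>" using assms(2) by (auto simp: C_eq)
  define F where "F = {e\<in>EC. e \<subseteq> \<sigma>}"
  have "g i \<in> EC" "g i \<notin> F" using i by (auto simp: EC_def F_def g_def)
  then have "F \<subset> EC" by (auto simp: F_def)
  then have "subadd_at (F \<union> E') \<sigma>" using subadd_proper \<sigma> by (auto simp: subadd_def)
  moreover have "NV (F \<union> E') p \<tau> \<longleftrightarrow> NV E p \<tau>" if "\<tau> \<subseteq> \<sigma>" for p \<tau>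
    by (rule betti_nz_cong) (use that in \<open>auto simp: F_def\<close>)
  ultimately show ?thesis unfolding subadd_at_def
    by (metis order_refl)
qed

definition path :: "nat \<Rightarrow> nat \<Rightarrow> 'v set" where
  "path s m = f ` {s..<s + m}"

lemma path_mem: "s + m \<le> n \<Longrightarrow> i < n \<Longrightarrow> f i \<in> path s m \<longleftrightarrow> s \<le> i \<and> i < s + m"
  using f_eq[of i] by (auto simp: path_def image_iff)

text \<open>The leaf edge of a path is a splitting edge, and using it removes three vertices at a time.\<close>

lemma NV_path:
  assumes "1 \<le> s" "s + m \<le> n" "\<tau> \<subseteq> V" "\<tau> \<inter> C = {}"
  shows "NV E p (path s m \<union> \<tau>) \<longleftrightarrow> m mod 3 \<noteq> 1 \<and> 2 * m div 3 \<le> p \<and> NV E (p - 2 * m div 3) \<tau>"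
  using assms
proof (induction m arbitrary: s p rule: less_induct)
  case (less m)
  let ?\<sigma> = "path s m \<union> \<tau>"
  have \<sigma>V: "?\<sigma> \<subseteq> V" using less.prems CV f_in by (auto simp: path_def)
  have fnt: "f i \<notin> \<tau>" if "i < n" for i using less.prems(4) f_in[OF that] by auto
  have fin: "f i \<in> ?\<sigma> \<longleftrightarrow> s \<le> i \<and> i < s + m" if "i < n" for i
    using fnt[OF that] path_mem[OF less.prems(2) that] by blast
  have tC: "w \<in> \<tau> \<Longrightarrow> w \<noteq> f i" if "i < n" for w i using fnt[OF that] by auto
  \<comment> \<open>Since \<open>1 \<le> s\<close>, the vertex \<open>f 0\<close> is not on the
    path. The edge closing the cycle therefore does not occur, and neighbours have consecutive
    indices.\<close>
  have nb: "w = f (i + 1) \<and> i + 1 < s + m \<or> w = f (i - 1) \<and> s \<le> i - 1 \<and> i \<noteq> 0"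
    if i: "s \<le> i" "i < s + m" and w: "{f i, w} \<in> E" "w \<in> ?\<sigma>" for i w
  proof -
    have il: "i < n" using i less.prems by auto
    from f_edge[OF il w(1)] show ?thesis
    proof
      assume "w = f ((i + 1) mod n) \<and> {f i, w} = g i"
      then have w': "w = f ((i + 1) mod n)" by simp
      show ?thesis
      proof (cases "i + 1 = n")
        case True
        then have "w = f 0" using w' by simp
        then show ?thesis using fin[of 0] w(2) less.prems n3 by auto
      next
        case False
        then have "w = f (i + 1)" "i + 1 < n" using w' il by auto
        then show ?thesis using fin[of "i + 1"] w(2) by auto
      qed
    next
      assume "\<exists>j<n. (j + 1) mod n = i \<and> w = f j \<and> {f i, w} = g j"
      then obtain j where j: "j < n" "(j + 1) mod n = i" "w = f j" by auto
      then have "j + 1 = i" using i less.prems(1) by (auto simp: mod_Suc split: if_splits)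
      then show ?thesis using j fin[of j] w(2) by auto
    qed
  qed
  have ed: "{f i, f (i + 1)} \<in> E" if "i + 1 < n" for i
  proof -
    have "{f i, f (i + 1)} = g i" using that by (simp add: g_def)
    then show ?thesis using that by (auto simp: EC_def)
  qed
  consider "m = 0" | "m = 1" | "2 \<le> m" by linarith
  then show ?case
  proof cases
    case 1
    then show ?thesis by (simp add: path_def)
  next
    case 2
    have "\<not> NV E p ?\<sigma>"
    proof (rule betti_nz_isolated[of _ _ "f s"])
      show "finite ?\<sigma>" "inj_on ord ?\<sigma>" using sub_V[OF \<sigma>V] by auto
      show s\<sigma>: "f s \<in> ?\<sigma>" using 2 by (auto simp: path_def)
      fix e assume e: "e \<in> E" "e \<subseteq> ?\<sigma>"
      show "f s \<notin> e"
      proof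
        assume s: "f s \<in> e"
        have "card e = 2" using edges_E e(1) by (auto simp: edges_def)
        then obtain w where w: "w \<in> e" "w \<noteq> f s" using s by (auto simp: card_2_iff)
        have "e = {f s, w}" using edges_doubleton[OF edges_E e(1) s w(1)] w(2) by auto
        then have "{f s, w} \<in> E" "w \<in> ?\<sigma>" using e w by auto
        from nb[OF _ _ this] 2 show False by auto
      qed
    qed
    then show ?thesis using 2 by simp
  next
    case 3
    let ?x = "f s" and ?y = "f (s + 1)"
    have sn: "s < n" "s + 1 < n" using 3 less.prems by auto
    have x\<sigma>: "?x \<in> ?\<sigma>" and y\<sigma>: "?y \<in> ?\<sigma>" using fin[OF sn(1)] fin[OF sn(2)] 3 by auto
    have xy: "{?x, ?y} \<in> E" using ed sn by auto
    have nbx: "w = ?y" if "w \<in> nbrs E ?x \<inter> ?\<sigma>" for w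
      using that nb[of s w] 3 by (auto simp: nbrs_def)
    \<comment> \<open>Without its leaf edge the end \<open>?x\<close> is isolated, so only the
      second alternative of the splitting remains.\<close>
    have "\<not> NV (E - {{?x, ?y}}) p ?\<sigma>"
    proof (rule betti_nz_isolated[of _ _ ?x])
      show "finite ?\<sigma>" "inj_on ord ?\<sigma>" using sub_V[OF \<sigma>V] by auto
      show "?x \<in> ?\<sigma>" by (rule x\<sigma>)
      fix e assume e: "e \<in> E - {{?x, ?y}}" "e \<subseteq> ?\<sigma>"
      show "?x \<notin> e"
      proof
        assume s: "?x \<in> e"
        have "card e = 2" using edges_E e(1) by (auto simp: edges_def)
        then obtain w where w: "w \<in> e" "w \<noteq> ?x" using s by (auto simp: card_2_iff)
        have ew: "e = {?x, w}" using edges_doubleton[OF edges_E _ s w(1)] w(2) e(1) by auto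
        then have "w \<in> nbrs E ?x \<inter> ?\<sigma>" using e w by (auto simp: nbrs_def)
        from nbx[OF this] ew e(1) show False by auto
      qed
    qed
    moreover have "nbrs E ?x \<inter> ?\<sigma> \<subseteq> closed_nbrs E ?y" using nbx by (auto simp: closed_nbrs_def)
    ultimately have split: "NV E p ?\<sigma> \<longleftrightarrow>
        card (nbrs E ?y \<inter> ?\<sigma>) \<le> p \<and> NV E (p - card (nbrs E ?y \<inter> ?\<sigma>)) (?\<sigma> - closed_nbrs E ?y)"
      using NV_splitting_edge[OF edges_E \<sigma>V x\<sigma> y\<sigma> xy, of p] by blast
    have nby1: "w = f (s + 2) \<and> 3 \<le> m \<or> w = ?x" if "w \<in> nbrs E ?y \<inter> ?\<sigma>" for w
      using that nb[of "s + 1" w] 3 by (auto simp: nbrs_def)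
    have xNy: "?x \<in> nbrs E ?y" using xy by (simp add: nbrs_def insert_commute)
    show ?thesis
    proof (cases "m = 2")
      case True
      \<comment> \<open>A path on two vertices shifts by 1 only, since \<open>?y\<close> has the
        single neighbour \<open>?x\<close>; this agrees with \<open>2 * 2 div 3\<close>.\<close>
      have "w = ?x" if "w \<in> nbrs E ?y \<inter> ?\<sigma>" for w using nby1[OF that] True by simp
      then have N: "nbrs E ?y \<inter> ?\<sigma> = {?x}" using xNy x\<sigma> by blast
      have "?\<sigma> - closed_nbrs E ?y = ?\<sigma> - (nbrs E ?y \<inter> ?\<sigma>) - {?y}" by (auto simp: closed_nbrs_def)
      also have "\<dots> = \<tau>"
      proof -
        have "path s m = {?x, ?y}" using True by (auto simp: path_def image_iff less_Suc_eq le_less)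
        then show ?thesis unfolding N using fnt sn by auto
      qed
      finally show ?thesis using split True unfolding N by simp
    next
      case False
      then have m3: "3 \<le> m" using 3 by simp
      have s2: "s + 2 < n" using m3 less.prems by auto
      have "f (s + 2) \<in> nbrs E ?y" using ed[of "s + 1"] s2 by (simp add: nbrs_def)
      moreover have "f (s + 2) \<in> ?\<sigma>" using fin[OF s2] m3 by simp
      ultimately have N: "nbrs E ?y \<inter> ?\<sigma> = {?x, f (s + 2)}" using nby1 xNy x\<sigma> by auto
      have cN: "card (nbrs E ?y \<inter> ?\<sigma>) = 2" unfolding N using f_eq[OF sn(1) s2] by simp
      have "?\<sigma> - closed_nbrs E ?y = ?\<sigma> - (nbrs E ?y \<inter> ?\<sigma>) - {?y}" by (auto simp: closed_nbrs_def)
      also have "\<dots> = path (s + 3) (m - 3) \<union> \<tau>"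
      proof -
        have int: "{s..<s + m} = {s, s + 1, s + 2} \<union> {s + 3..<s + 3 + (m - 3)}" using m3 by auto
        have p: "path s m = {?x, ?y, f (s + 2)} \<union> path (s + 3) (m - 3)"
          unfolding path_def int by auto
        have "f i \<notin> path (s + 3) (m - 3)" if "i < s + 3" for i
          using that path_mem[of "s + 3" "m - 3" i] less.prems m3 by simp
        then have "{?x, ?y, f (s + 2)} \<inter> path (s + 3) (m - 3) = {}" by auto
        moreover have "{?x, ?y, f (s + 2)} \<inter> \<tau> = {}" using fnt sn s2 by auto
        ultimately show ?thesis unfolding N unfolding p by auto
      qed
      finally have "NV E p ?\<sigma> \<longleftrightarrow> 2 \<le> p \<and> NV E (p - 2) (path (s + 3) (m - 3) \<union> \<tau>)"
        using split unfolding cN by simp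
      also have "NV E (p - 2) (path (s + 3) (m - 3) \<union> \<tau>) \<longleftrightarrow> (m - 3) mod 3 \<noteq> 1 \<and>
          2 * (m - 3) div 3 \<le> p - 2 \<and> NV E (p - 2 - 2 * (m - 3) div 3) \<tau>"
        using less.prems m3 by (intro less.IH) auto
      also have "(m - 3) mod 3 = m mod 3" using m3 by (simp add: le_mod_geq)
      finally have "NV E p ?\<sigma> \<longleftrightarrow> 2 \<le> p \<and> m mod 3 \<noteq> 1 \<and>
          2 * (m - 3) div 3 \<le> p - 2 \<and> NV E (p - 2 - 2 * (m - 3) div 3) \<tau>" .
      moreover obtain t where "m = t + 3" using m3 le_Suc_ex[of 3 m] by auto
      then have "2 * m div 3 = 2 + 2 * (m - 3) div 3" by simp
      ultimately show ?thesis by auto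
    qed
  qed
qed

text \<open>By the vertex sequence at \<open>f 0\<close>: deleting this vertex shifts by 1 and
  leaves a path on n - 1 vertices, deleting its closed neighbourhood shifts by 2 and leaves a path
  on n - 3 vertices. Whenever the path contributes, the total shift is (2n - 1)/3 rounded up, the
  same in both cases.\<close>

lemma NV_full_cycle:
  assumes \<tau>: "\<tau> \<subseteq> V" "\<tau> \<inter> C = {}" and nz: "NV E p (C \<union> \<tau>)"
  shows "(2 * n + 1) div 3 \<le> p \<and> NV E (p - (2 * n + 1) div 3) \<tau>"
proof -
  let ?\<sigma> = "C \<union> \<tau>"
  have \<sigma>V: "?\<sigma> \<subseteq> V" using \<tau> CV by auto
  have n0: "0 < n" using n3 by simp
  have f0: "f 0 \<in> ?\<sigma>" using f_in[OF n0] by auto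
  have f0t: "f i \<notin> \<tau>" if "i < n" for i using \<tau> f_in[OF that] by auto
  have N: "nbrs E (f 0) = {f 1, f (n - 1)}"
  proof
    show "nbrs E (f 0) \<subseteq> {f 1, f (n - 1)}"
    proof
      fix w assume "w \<in> nbrs E (f 0)"
      then have "{f 0, w} \<in> E" by (simp add: nbrs_def)
      from f_edge[OF n0 this] show "w \<in> {f 1, f (n - 1)}"
        using n3 by (auto simp: mod_Suc split: if_splits)
    qed
    have "{f 0, f 1} = g 0" "{f 0, f (n - 1)} = g (n - 1)" using n3 by (auto simp: g_def)
    then show "{f 1, f (n - 1)} \<subseteq> nbrs E (f 0)" using n3 by (auto simp: nbrs_def EC_def)
  qed
  have N\<sigma>: "nbrs E (f 0) \<inter> ?\<sigma> = {f 1, f (n - 1)}" unfolding N using f_in n3 by auto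
  have cN: "card (nbrs E (f 0) \<inter> ?\<sigma>) = 2" unfolding N\<sigma> using f_eq[of 1 "n - 1"] n3 by simp
  have s1: "?\<sigma> - {f 0} = path 1 (n - 1) \<union> \<tau>"
  proof -
    have int: "{..<n} = insert 0 {1..<1 + (n - 1)}" using n3 by auto
    have C: "C = insert (f 0) (path 1 (n - 1))" unfolding C_eq int path_def by simp
    have "f 0 \<notin> path 1 (n - 1)" using path_mem[of 1 "n - 1" 0] n3 by simp
    then show ?thesis unfolding C using f0t[OF n0] by auto
  qed
  have s2: "?\<sigma> - closed_nbrs E (f 0) = path 2 (n - 3) \<union> \<tau>"
  proof -
    have int: "{..<n} = {0, 1, n - 1} \<union> {2..<2 + (n - 3)}" using n3 by auto
    have C: "C = {f 0, f 1, f (n - 1)} \<union> path 2 (n - 3)" unfolding C_eq path_def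
      by (subst int) auto
    have "2 + (n - 3) \<le> n" using n3 by simp
    then have "f i \<notin> path 2 (n - 3)" if "i = 0 \<or> i = 1 \<or> i = n - 1" for i
      using that path_mem[of 2 "n - 3" i] n3 by auto
    then have "{f 0, f 1, f (n - 1)} \<inter> path 2 (n - 3) = {}" by auto
    moreover have "{f 0, f 1, f (n - 1)} \<inter> \<tau> = {}" using f0t n3 by auto
    ultimately show ?thesis unfolding closed_nbrs_def N C by auto
  qed
  have "1 \<le> p \<and> NV E (p - 1) (path 1 (n - 1) \<union> \<tau>) \<or> 2 \<le> p \<and> NV E (p - 2) (path 2 (n - 3) \<union> \<tau>)"
    using betti_nz_vertex[OF sub_V[OF \<sigma>V] f0 _ nz] edges_E unfolding cN s1 s2 by (auto simp: edges_def)
  then show ?thesis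
  proof
    assume h: "1 \<le> p \<and> NV E (p - 1) (path 1 (n - 1) \<union> \<tau>)"
    obtain m where "n = Suc m" using n3 by (cases n) auto
    then have eq: "(2 * n + 1) div 3 = 1 + 2 * (n - 1) div 3" by simp
    show ?thesis using h NV_path[of 1 "n - 1" \<tau> "p - 1"] \<tau> n3 eq by auto
  next
    assume h: "2 \<le> p \<and> NV E (p - 2) (path 2 (n - 3) \<union> \<tau>)"
    obtain m where m: "n = m + 3" using n3 le_Suc_ex[of 3 n] by auto
    \<comment> \<open>For \<open>m mod 3 = 1\<close> the two sides differ, but then the path carries
      no homology.\<close>
    have "(2 * m + 7) div 3 = 2 + 2 * m div 3" if "m mod 3 \<noteq> 1"
    proof -
      have "m mod 3 = 0 \<or> m mod 3 = 2" using that by linarith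
      then obtain u where "m = 3 * u \<or> m = 3 * u + 2" by (metis add_0_right mult_div_mod_eq)
      then show ?thesis
      proof
        assume "m = 3 * u + 2"
        then have "2 * m + 7 = 2 + 3 * (2 * u + 3)" "2 * m = 1 + 3 * (2 * u + 1)" by auto
        then show ?thesis by (simp only: div_mult_self2)
      qed simp
    qed
    then have eq: "(n - 3) mod 3 \<noteq> 1 \<Longrightarrow> (2 * n + 1) div 3 = 2 + 2 * (n - 3) div 3"
      by (simp add: m)
    show ?thesis using h NV_path[of 2 "n - 3" \<tau> "p - 2"] \<tau> n3 eq by auto
  qed
qed

lemma subadd_cycle: "subadd E"
  unfolding subadd_def
proof (intro allI impI)
  fix \<sigma> assume \<sigma>: "\<sigma> \<subseteq> V"
  show "subadd_at E \<sigma>"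
  proof (cases "C \<subseteq> \<sigma>")
    case False
    then show ?thesis using subadd_at_not_full \<sigma> by auto
  next
    case True
    define \<tau> where "\<tau> = \<sigma> - C"
    have \<tau>: "\<tau> \<subseteq> V" "\<tau> \<inter> C = {}" "\<sigma> = C \<union> \<tau>" using \<sigma> True by (auto simp: \<tau>_def)
    have cong: "NV E p \<tau>' \<longleftrightarrow> NV E' p \<tau>'" if "\<tau>' \<subseteq> \<tau>" for p \<tau>'
    proof (rule betti_nz_cong)
      fix e assume "e \<subseteq> \<tau>'"
      then have eC: "e \<inter> C = {}" using that \<tau>(2) by auto
      have "e \<notin> EC"
      proof
        assume "e \<in> EC"
        then obtain i where "i < n" "e = g i" by (auto simp: EC_def)
        then show False using eC f_in[of i] by (auto simp: g_def)
      qed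
      then show "e \<in> E \<longleftrightarrow> e \<in> E'" by simp
    qed
    show ?thesis
    proof (rule subadd_atI_trivial[OF edges_E])
      fix a b assume ab: "0 < a" "0 < b" and nz: "NV E (a + b) \<sigma>"
      define H where "H = (2 * n + 1) div 3"
      have H: "H \<le> a + b" "NV E (a + b - H) \<tau>" using NV_full_cycle[OF \<tau>(1,2)] nz \<tau>(3) by (auto simp: H_def)
      have H2: "2 \<le> H" using n3 by (simp add: H_def)
      \<comment> \<open>Both parts have to stay below \<open>H\<close>, so that each path leaves out
        a vertex of the cycle; positivity of \<open>a\<close> and \<open>b\<close> makes this
        possible.\<close>
      define a1 where "a1 = min a (H - 1)"
      define b1 where "b1 = H - a1"
      have c: "a + b - H = (a - a1) + (b - b1)" "a1 \<le> a" "b1 \<le> b" "a1 < H" "b1 < H" "a1 + b1 = H"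
        using H(1) H2 ab by (auto simp: a1_def b1_def)
      have "NV E' ((a - a1) + (b - b1)) \<tau>" using H(2) c(1) cong by auto
      moreover have "subadd_at E' \<tau>" using SA' \<tau> by (auto simp: subadd_def)
      ultimately obtain \<tau>1 \<tau>2 where h: "\<tau>1 \<subseteq> \<tau>" "\<tau>2 \<subseteq> \<tau>" "NV E' (a - a1) \<tau>1"
        "NV E' (b - b1) \<tau>2" "card \<tau> \<le> card \<tau>1 + card \<tau>2"
        using subadd_atD by metis
      have ext: "\<exists>\<sigma>'. \<sigma>' \<subseteq> \<sigma> \<and> NV E (m + q) \<sigma>' \<and> card \<sigma>' = card \<tau>' + (3 * q + 1) div 2"
        if \<tau>': "\<tau>' \<subseteq> \<tau>" "NV E' m \<tau>'" and q: "q < H" for q \<tau>' m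
      proof -
        \<comment> \<open>3q/2 rounded up is the only path length whose homology sits in degree
          \<open>q\<close>: it is 3u for q = 2u and 3u + 2 for q = 2u + 1.\<close>
        define r where "r = (3 * q + 1) div 2"
        have r: "1 + r \<le> n" "r mod 3 \<noteq> 1" "2 * r div 3 = q"
        proof -
          have q3: "3 * (q + 1) \<le> 2 * n + 1" using q unfolding H_def by presburger
          obtain u where "q = 2 * u \<or> q = 2 * u + 1" by (metis oddE evenE)
          then have "r = 3 * u \<and> q = 2 * u \<or> r = 3 * u + 2 \<and> q = 2 * u + 1"
            by (auto simp: r_def)
          moreover have "(3 * u + 2) mod 3 = 2" for u :: nat by presburger
          moreover have "2 * (3 * u + 2) div 3 = 2 * u + 1" for u :: nat by presburger
          ultimately have "1 + r \<le> n \<and> r mod 3 \<noteq> 1 \<and> 2 * r div 3 = q" using q3 by auto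
          then show "1 + r \<le> n" "r mod 3 \<noteq> 1" "2 * r div 3 = q" by blast+
        qed
        have \<tau>'V: "\<tau>' \<subseteq> V" "\<tau>' \<inter> C = {}" using \<tau>' \<tau> by auto
        have pC: "path 1 r \<subseteq> C" using r f_in by (auto simp: path_def)
        have "NV E (m + q) (path 1 r \<union> \<tau>')"
          using NV_path[of 1 r \<tau>' "m + q"] r \<tau>'V cong[OF \<tau>'(1)] \<tau>'(2) by simp
        moreover have "path 1 r \<union> \<tau>' \<subseteq> \<sigma>" using pC \<tau>' \<tau>(3) by auto
        moreover have "card (path 1 r \<union> \<tau>') = card \<tau>' + r"
        proof -
          have "inj_on f {1..<1 + r}" using f_eq r by (auto simp: inj_on_def)
          then have "card (path 1 r) = r" by (simp add: path_def card_image)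
          moreover have "card (path 1 r \<union> \<tau>') = card (path 1 r) + card \<tau>'"
            using sub_V(1)[OF \<tau>'V(1)] pC \<tau>'V(2) by (intro card_Un_disjoint) (auto simp: path_def)
          ultimately show ?thesis by simp
        qed
        ultimately show ?thesis unfolding r_def by blast
      qed
      obtain \<sigma>1 where s1: "\<sigma>1 \<subseteq> \<sigma>" "NV E (a - a1 + a1) \<sigma>1" "card \<sigma>1 = card \<tau>1 + (3 * a1 + 1) div 2"
        using ext[OF h(1,3) c(4)] by auto
      obtain \<sigma>2 where s2: "\<sigma>2 \<subseteq> \<sigma>" "NV E (b - b1 + b1) \<sigma>2" "card \<sigma>2 = card \<tau>2 + (3 * b1 + 1) div 2"
        using ext[OF h(2,4) c(5)] by auto
      have "card C = n" using bij by (simp add: bij_betw_same_card[symmetric])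
      then have "card \<sigma> = n + card \<tau>"
        using \<tau> sub_V(1)[OF CV] sub_V(1)[OF \<tau>(1)] by (simp add: card_Un_disjoint Int_commute)
      \<comment> \<open>As 3H >= 2n - 1, the sum is at least n - 1/2, and it is an integer.\<close>
      moreover have "n \<le> (3 * a1 + 1) div 2 + (3 * b1 + 1) div 2"
      proof -
        have 1: "x \<le> 2 * ((x + 1) div 2)" "x \<le> 3 * ((x + 1) div 3) + 1" for x :: nat by linarith+
        then show ?thesis using c(6) 1(1)[of "3 * a1"] 1(1)[of "3 * b1"] 1(2)[of "2 * n"]
          unfolding H_def by linarith
      qed
      ultimately have "card \<sigma> \<le> card \<sigma>1 + card \<sigma>2" using s1(3) s2(3) h(5) by linarith
      then show "\<exists>\<sigma>1 \<sigma>2. \<sigma>1 \<subseteq> \<sigma> \<and> \<sigma>2 \<subseteq> \<sigma> \<and> NV E a \<sigma>1 \<and> NV E b \<sigma>2 \<and> card \<sigma> \<le> card \<sigma>1 + card \<sigma>2"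
        using s1(1,2) s2(1,2) c(2,3) by auto
    qed
  qed
qed

end

section \<open>The graph class: components, cycles and edge deletion\<close>

context vertex_order
begin

lemma subadd_no_edges: "subadd {}"
  unfolding subadd_def subadd_at_def
proof (intro allI impI)
  fix \<sigma> a b assume \<sigma>: "\<sigma> \<subseteq> V" and nz: "NV {} (a + b) \<sigma>"
  have "\<sigma> = {}"
    using betti_nz_isolated[OF sub_V[OF \<sigma>], of _ "{}"] nz by auto
  then show "\<exists>\<sigma>1 \<sigma>2. \<sigma>1 \<subseteq> \<sigma> \<and> \<sigma>2 \<subseteq> \<sigma> \<and> NV {} a \<sigma>1 \<and> NV {} b \<sigma>2 \<and> card \<sigma> \<le> card \<sigma>1 + card \<sigma>2"
    using nz betti_nz_empty[of "{}" k ord] by auto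
qed

lemma component_facts:
  assumes "\<And>e. e \<in> E \<Longrightarrow> e \<subseteq> W \<and> card e = 2"
  shows "e \<in> E \<Longrightarrow> \<exists>C\<in>components W E. e \<subseteq> C"
    and "C \<in> components W E \<Longrightarrow> D \<in> components W E \<Longrightarrow> C \<inter> D \<noteq> {} \<Longrightarrow> C = D"
proof -
  have sym: "sym ((adj E)\<^sup>*)"
    by (rule sym_rtrancl) (auto simp: sym_def adj_def insert_commute)
  show "\<exists>C\<in>components W E. e \<subseteq> C" if e: "e \<in> E"
  proof -
    obtain u v where uv: "e = {u, v}" using assms[OF e] by (auto simp: card_2_iff)
    have "(u, v) \<in> (adj E)\<^sup>*" using e uv by (auto simp: adj_def)
    then show ?thesis using assms[OF e] uv by (auto simp: components_def)
  qed
  show "C = D" if C: "C \<in> components W E" and D: "D \<in> components W E" and ne: "C \<inter> D \<noteq> {}"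
  proof -
    obtain c d x where "C = {v \<in> W. (c, v) \<in> (adj E)\<^sup>*}" "D = {v \<in> W. (d, v) \<in> (adj E)\<^sup>*}"
      "(c, x) \<in> (adj E)\<^sup>*" "(d, x) \<in> (adj E)\<^sup>*" using C D ne by (auto simp: components_def)
    then show ?thesis using sym by (auto dest: symD intro: rtrancl_trans)
  qed
qed

text \<open>Carrying along an arbitrary disjoint graph \<open>E'\<close> replaces a Kuenneth formula: the
  components of a disconnected graph are added one at a time.\<close>

lemma subadd_graph_class_Un:
  assumes "graph_class W E" "W \<subseteq> V" "edges E'" "\<And>e. e \<in> E' \<Longrightarrow> e \<inter> W = {}" "subadd E'"
  shows "subadd (E \<union> E')"
  using assms
proof (induction W E arbitrary: E' rule: graph_class.induct)
  case (edgeless W)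
  then show ?case by simp
next
  case (disconnected W E)
  have E: "e \<subseteq> W \<and> card e = 2" if "e \<in> E" for e
    using disconnected.hyps(1) that by (auto simp: simple_graph_def)
  let ?K = "components W E"
  have CW: "C \<subseteq> W" if "C \<in> ?K" for C using that by (auto simp: components_def)
  have "finite ?K" using disconnected.hyps(1) by (simp add: components_def simple_graph_def)
  moreover have "subadd ((\<Union>C\<in>\<C>. induced_edges E C) \<union> E')" if "finite \<C>" "\<C> \<subseteq> ?K" for \<C>
    using that
  proof (induction \<C> rule: finite_induct)
    case empty
    then show ?case using disconnected.prems by simp
  next
    case (insert C \<C>)
    \<comment> \<open>The components treated so far, together with \<open>E'\<close>, are the
      disjoint graph to which \<open>C\<close> is added.\<close>
    let ?F = "(\<Union>C\<in>\<C>. induced_edges E C) \<union> E'"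
    have C: "C \<in> ?K" using insert by auto
    have "subadd (induced_edges E C \<union> ?F)"
    proof (rule disconnected.IH[OF C])
      show "C \<subseteq> V" using CW[OF C] disconnected.prems by auto
      show "edges ?F" using E disconnected.prems by (fastforce simp: edges_def induced_edges_def)
      show "subadd ?F" using insert by auto
      fix e assume e: "e \<in> ?F"
      show "e \<inter> C = {}"
      proof (cases "e \<in> E'")
        case True
        then show ?thesis using disconnected.prems(3) CW[OF C] by blast
      next
        case False
        then obtain D where D: "D \<in> \<C>" "e \<subseteq> D" using e by (auto simp: induced_edges_def)
        then have "C \<noteq> D" "D \<in> ?K" using insert by auto
        then have "C \<inter> D = {}" using component_facts(2)[OF E C] by blast
        then show ?thesis using D by auto
      qed
    qed
    then show ?case by (simp add: Un_assoc)
  qed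
  ultimately have "subadd ((\<Union>C\<in>?K. induced_edges E C) \<union> E')" by blast
  moreover have "(\<Union>C\<in>?K. induced_edges E C) = E"
    using component_facts(1)[OF E] by (auto simp: induced_edges_def)
  ultimately show ?case by simp
next
  case (is_cycle W E)
  obtain n f where nf: "n \<ge> (3::nat)" "bij_betw f {..<n} W" "E = {{f i, f ((i + 1) mod n)} | i. i < n}"
    using is_cycle.hyps(3) unfolding cycle_graph_def by blast
  interpret cyc: cycle_plus k ord V n f W E'
    by unfold_locales (use nf is_cycle.prems in auto)
  have "E = cyc.EC" unfolding nf(3) cyc.EC_def cyc.g_def by auto
  then show ?case using cyc.subadd_cycle by simp
next
  case (delete_edge W E x y)
  have E: "e \<subseteq> W \<and> card e = 2" if "e \<in> E" for e
    using delete_edge.hyps(1) that by (auto simp: simple_graph_def)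
  have xW: "x \<in> W" using E[OF delete_edge.hyps(4)] by auto
  \<comment> \<open>The graph \<open>E'\<close> does not meet \<open>W\<close>, so \<open>x\<close>
    gains no neighbours and the splitting condition persists.\<close>
  have notin: "{x, w} \<notin> E'" for w using delete_edge.prems(3)[of "{x, w}"] xW by auto
  show ?case
  proof (rule subadd_splitting_edge[of _ x y])
    show "edges (E \<union> E')" using E delete_edge.prems by (fastforce simp: edges_def)
    show "{x, y} \<in> E \<union> E'" using delete_edge.hyps by simp
    show "nbrs (E \<union> E') x \<subseteq> closed_nbrs (E \<union> E') y"
      using delete_edge.hyps(5) notin by (auto simp: nbrs_def closed_nbrs_def)
    have "E \<union> E' - {{x, y}} = (E - {{x, y}}) \<union> E'" using notin by auto
    moreover have "subadd ((E - {{x, y}}) \<union> E')" using delete_edge.prems by (intro delete_edge.IH) auto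
    ultimately show "subadd (E \<union> E' - {{x, y}})" by simp
  qed
qed

lemma subadd_graph_class: "graph_class V E \<Longrightarrow> subadd E"
  using subadd_graph_class_Un[of V E "{}"] subadd_no_edges by (simp add: edges_def)

end

section \<open>Koszul homology of edge ideals by multidegree\<close>

abbreviation "coeff \<equiv> Poly_Mapping.lookup"
abbreviation "supp \<equiv> Poly_Mapping.keys"
abbreviation "monom \<equiv> Poly_Mapping.single"

section \<open>Monomials and their degrees\<close>

lemma keys_add_nat: "supp (a + b) = supp a \<union> supp (b :: 'v \<Rightarrow>\<^sub>0 nat)"
  by (auto simp: in_keys_iff lookup_add)

lemma mdeg_superset:
  "finite W \<Longrightarrow> supp m \<subseteq> W \<Longrightarrow> mdeg m = (\<Sum>v\<in>W. coeff m v)"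
  unfolding mdeg_def by (rule sum.mono_neutral_left) (auto simp: in_keys_iff)

lemma mdeg_add: "mdeg (a + b) = mdeg a + mdeg b"
proof -
  let ?W = "supp a \<union> supp b"
  have "mdeg (a + b) = (\<Sum>v\<in>?W. coeff (a + b) v)"
    by (rule mdeg_superset) (auto simp: keys_add_nat)
  also have "\<dots> = mdeg a + mdeg b"
    by (simp add: lookup_add sum.distrib mdeg_superset[of ?W])
  finally show ?thesis .
qed

lemma mdeg_eq_0_iff: "mdeg m = 0 \<longleftrightarrow> m = 0"
proof
  assume "mdeg m = 0"
  then have "\<forall>v\<in>supp m. coeff m v = 0" by (simp add: mdeg_def)
  then show "m = 0" by (intro poly_mapping_eqI) (metis in_keys_iff lookup_zero)
qed (simp add: mdeg_def)

lemma finite_monomials: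
  assumes "finite V"
  shows "finite {m :: 'v \<Rightarrow>\<^sub>0 nat. supp m \<subseteq> V \<and> mdeg m \<le> d}"
proof -
  let ?M = "{m :: 'v \<Rightarrow>\<^sub>0 nat. supp m \<subseteq> V \<and> mdeg m \<le> d}"
  have "coeff ` ?M \<subseteq> {f. \<forall>x. (x \<in> V \<longrightarrow> f x \<in> {..d}) \<and> (x \<notin> V \<longrightarrow> f x = 0)}"
  proof (clarsimp, intro conjI allI impI)
    fix m :: "'v \<Rightarrow>\<^sub>0 nat" and v assume m: "supp m \<subseteq> V" "mdeg m \<le> d" and v: "v \<in> V"
    have "coeff m v \<le> (\<Sum>v\<in>V. coeff m v)"
      using v assms by (intro member_le_sum) auto
    then show "coeff m v \<le> d" using m mdeg_superset[OF assms m(1)] by simp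
  next
    fix m :: "'v \<Rightarrow>\<^sub>0 nat" and v assume "supp m \<subseteq> V" "v \<notin> V"
    then show "coeff m v = 0" by (auto simp: in_keys_iff)
  qed
  moreover have "finite {f. \<forall>x. (x \<in> V \<longrightarrow> f x \<in> {..d}) \<and> (x \<notin> V \<longrightarrow> f x = 0)}"
    by (rule finite_set_of_finite_funs[OF assms]) simp
  ultimately have "finite (coeff ` ?M)" by (rule finite_subset)
  then show ?thesis by (rule finite_imageD) (meson inj_onI poly_mapping.lookup_inject)
qed

definition sqmon :: "'v set \<Rightarrow> 'v \<Rightarrow>\<^sub>0 nat" where
  "sqmon A = (\<Sum>v\<in>A. monom v 1)"

lemma lookup_sqmon: "finite A \<Longrightarrow> coeff (sqmon A) v = (if v \<in> A then 1 else 0)"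
  by (simp add: sqmon_def lookup_sum lookup_single when_def)

lemma keys_sqmon: "finite A \<Longrightarrow> supp (sqmon A) = A"
  by (auto simp: in_keys_iff lookup_sqmon split: if_splits)

lemma mdeg_sqmon: "finite A \<Longrightarrow> mdeg (sqmon A) = card A"
  by (simp add: mdeg_def keys_sqmon lookup_sqmon)

lemma diff_sqmon_add: "finite A \<Longrightarrow> A \<subseteq> supp \<alpha> \<Longrightarrow> \<alpha> - sqmon A + sqmon A = \<alpha>"
  by (rule poly_mapping_eqI) (auto simp: lookup_add lookup_minus lookup_sqmon in_keys_iff)

lemma diff_sqmon_insert:
  "finite A \<Longrightarrow> v \<notin> A \<Longrightarrow> \<alpha> - sqmon (insert v A) = \<alpha> - sqmon A - monom v 1"
  by (rule poly_mapping_eqI) (auto simp: lookup_minus lookup_sqmon lookup_single when_def)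

lemma lookup_single_mult_add:
  fixes q :: "('v \<Rightarrow>\<^sub>0 nat) \<Rightarrow>\<^sub>0 'k::field"
  shows "coeff (monom t c * q) (t + s) = c * coeff q s"
proof -
  have "coeff (monom t c * q) (t + s) =
      (\<Sum>l. coeff (monom t c) l * (\<Sum>r. coeff q r when t + s = l + r))"
    by (rule lookup_mult)
  also have "\<dots> = (\<Sum>l. c * (\<Sum>r. coeff q r when t + s = l + r) when t = l)"
    by (simp add: lookup_single when_mult)
  also have "\<dots> = c * (\<Sum>r. coeff q r when t + s = t + r)" by simp
  also have "\<dots> = c * coeff q s" by simp
  finally show ?thesis .
qed

lemma lookup_single_mult_other:
  fixes q :: "('v \<Rightarrow>\<^sub>0 nat) \<Rightarrow>\<^sub>0 'k::field"
  assumes "\<And>s. m \<noteq> t + s"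
  shows "coeff (monom t c * q) m = 0"
proof -
  have "supp (monom t c * q) \<subseteq> {a + b |a b. a \<in> supp (monom t c) \<and> b \<in> supp q}"
    by (rule keys_mult)
  then have "m \<notin> supp (monom t c * q)"
    using assms by (auto split: if_splits)
  then show ?thesis by (simp add: in_keys_iff)
qed

lemma lookup_pvar_mult:
  fixes q :: "('v, 'k::field) mpolynomial"
  shows "coeff (pvar v * q) m =
    (if v \<in> supp m then coeff q (m - monom v 1) else 0)"
proof (cases "v \<in> supp m")
  case True
  then have "m = monom v 1 + (m - monom v 1)"
    by (intro poly_mapping_eqI) (auto simp: lookup_add lookup_minus lookup_single when_def in_keys_iff)
  then have "coeff (pvar v * q) m = 1 * coeff q (m - monom v 1)"
    unfolding pvar_def using lookup_single_mult_add by metis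
  then show ?thesis using True by simp
next
  case False
  have "m \<noteq> monom v 1 + s" for s
    using False by (auto simp: keys_add_nat)
  then show ?thesis using False by (simp add: pvar_def lookup_single_mult_other)
qed

section \<open>Polynomials, homogeneity and the edge ideal\<close>

lemma poly_ring_zero [simp]: "0 \<in> poly_ring V"
  by (simp add: poly_ring_def)

lemma poly_ring_one [simp]: "1 \<in> poly_ring V"
  by (simp add: poly_ring_def)

lemma poly_ring_lookup: "q \<in> poly_ring V \<longleftrightarrow> (\<forall>m. \<not> supp m \<subseteq> V \<longrightarrow> coeff q m = 0)"
  by (auto simp: poly_ring_def in_keys_iff)

lemma poly_ring_add: "a \<in> poly_ring V \<Longrightarrow> b \<in> poly_ring V \<Longrightarrow> a + b \<in> poly_ring V"
  by (simp add: poly_ring_lookup lookup_add)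

lemma poly_ring_diff: "a \<in> poly_ring V \<Longrightarrow> b \<in> poly_ring V \<Longrightarrow> a - b \<in> poly_ring V"
  by (simp add: poly_ring_lookup lookup_minus)

lemma poly_ring_sum: "(\<And>x. x \<in> B \<Longrightarrow> f x \<in> poly_ring V) \<Longrightarrow> sum f B \<in> poly_ring V"
  by (induction B rule: infinite_finite_induct) (auto simp: poly_ring_add)

lemma poly_ring_mult:
  assumes "a \<in> poly_ring V" "b \<in> poly_ring V"
  shows "a * b \<in> poly_ring V"
  unfolding poly_ring_def
proof (clarify)
  fix m v assume "m \<in> supp (a * b)" and v: "v \<in> supp m"
  then obtain s t where "m = s + t" "s \<in> supp a" "t \<in> supp b"
    using keys_mult[of a b] by auto
  then show "v \<in> V" using assms v by (fastforce simp: poly_ring_def keys_add_nat)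
qed

lemma poly_ring_single: "supp m \<subseteq> V \<Longrightarrow> monom m c \<in> poly_ring V"
  by (simp add: poly_ring_def)

lemma homogeneous_lookup:
  "homogeneous d q \<longleftrightarrow> (\<forall>m. int (mdeg m) \<noteq> d \<longrightarrow> coeff q m = 0)"
  by (auto simp: homogeneous_def in_keys_iff)

lemma homogeneous_zero [simp]: "homogeneous d 0"
  by (simp add: homogeneous_def)

lemma homogeneous_add: "homogeneous d a \<Longrightarrow> homogeneous d b \<Longrightarrow> homogeneous d (a + b)"
  by (simp add: homogeneous_lookup lookup_add)

lemma homogeneous_diff: "homogeneous d a \<Longrightarrow> homogeneous d b \<Longrightarrow> homogeneous d (a - b)"
  by (simp add: homogeneous_lookup lookup_minus)

lemma homogeneous_sum: "(\<And>x. x \<in> B \<Longrightarrow> homogeneous d (f x)) \<Longrightarrow> homogeneous d (sum f B)"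
  by (induction B rule: infinite_finite_induct) (auto simp: homogeneous_add)

lemma homogeneous_mult:
  assumes "homogeneous d a" "homogeneous e b"
  shows "homogeneous (d + e) (a * b)"
  unfolding homogeneous_def
proof
  fix m assume "m \<in> supp (a * b)"
  then obtain s t where "m = s + t" "s \<in> supp a" "t \<in> supp b"
    using keys_mult[of a b] by auto
  then show "int (mdeg m) = d + e" using assms by (auto simp: homogeneous_def mdeg_add)
qed

lemma mdeg_single [simp]: "mdeg (monom v n) = n"
  by (simp add: mdeg_def)

lemma pvar_poly_ring: "v \<in> V \<Longrightarrow> pvar v \<in> poly_ring V"
  by (simp add: poly_ring_def pvar_def)

lemma homogeneous_pvar: "homogeneous 1 (pvar v)"
  by (simp add: homogeneous_def pvar_def)

lemma homogeneous_pvar_mult: "homogeneous d q \<Longrightarrow> homogeneous (d + 1) (pvar v * q)"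
  using homogeneous_mult[OF homogeneous_pvar, of d q v] by (simp add: add.commute)

lemma sum_monomials: "(\<Sum>m\<in>supp q. monom m (coeff q m)) = q"
  by (rule poly_mapping_eqI)
     (auto simp: lookup_sum lookup_single when_def in_keys_iff cong: if_cong)

lemma prod_pvar: "finite A \<Longrightarrow> (\<Prod>v\<in>A. pvar v) = (monom (sqmon A) 1 :: ('v, 'k::field) mpolynomial)"
  by (induction A rule: finite_induct) (simp_all add: pvar_def sqmon_def mult_single)

text \<open>A monomial ideal contains a polynomial iff it contains all its monomials, and the
  generators are squarefree, so divisibility by one of them is a condition on the support.\<close>

lemma edge_ideal_iff:
  fixes q :: "('v, 'k::field) mpolynomial"
  assumes fin: "finite V" and E: "\<And>e. e \<in> E \<Longrightarrow> e \<subseteq> V"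
  shows "q \<in> edge_ideal V E \<longleftrightarrow>
    q \<in> poly_ring V \<and> (\<forall>m. indep E (supp m) \<longrightarrow> coeff q m = 0)"
proof -
  have finE: "finite E" using fin E by (meson Pow_iff finite_Pow_iff finite_subset subsetI)
  have fine: "finite e" if "e \<in> E" for e using E[OF that] fin finite_subset by blast
  have prod: "(\<Prod>v\<in>e. pvar v) = (monom (sqmon e) 1 :: ('v, 'k) mpolynomial)" if "e \<in> E" for e
    by (rule prod_pvar[OF fine[OF that]])
  show ?thesis
  proof
    assume "q \<in> edge_ideal V E"
    then obtain c where q: "q = (\<Sum>e\<in>E. c e * (\<Prod>v\<in>e. pvar v))" and c: "\<forall>e\<in>E. c e \<in> poly_ring V"
      by (auto simp: edge_ideal_def)
    have q': "q = (\<Sum>e\<in>E. monom (sqmon e) 1 * c e)"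
      unfolding q by (rule sum.cong) (auto simp: prod mult.commute)
    have "q \<in> poly_ring V"
      unfolding q' using c E fine by (intro poly_ring_sum poly_ring_mult poly_ring_single) (auto simp: keys_sqmon)
    moreover have "coeff q m = 0" if m: "indep E (supp m)" for m
      unfolding q' lookup_sum
    proof (intro sum.neutral ballI)
      fix e assume e: "e \<in> E"
      have "m \<noteq> sqmon e + s" for s
        using m e keys_sqmon[OF fine[OF e]] by (auto simp: indep_def keys_add_nat)
      then show "coeff (monom (sqmon e) 1 * c e) m = 0"
        by (rule lookup_single_mult_other)
    qed
    ultimately show "q \<in> poly_ring V \<and> (\<forall>m. indep E (supp m) \<longrightarrow> coeff q m = 0)"
      by blast
  next
    assume q: "q \<in> poly_ring V \<and> (\<forall>m. indep E (supp m) \<longrightarrow> coeff q m = 0)"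
    have "\<exists>e. m \<in> supp q \<longrightarrow> e \<in> E \<and> e \<subseteq> supp m" for m
      using q by (auto simp: indep_def in_keys_iff)
    \<comment> \<open>Every monomial of \<open>q\<close> is assigned to one edge dividing it;
      grouping by edges gives the coefficients \<open>c e\<close>.\<close>
    then obtain \<phi> where \<phi>: "\<And>m. m \<in> supp q \<Longrightarrow> \<phi> m \<in> E \<and> \<phi> m \<subseteq> supp m"
      by metis
    define c where "c e = (\<Sum>m | m \<in> supp q \<and> \<phi> m = e.
        monom (m - sqmon e) (coeff q m))" for e
    have "c e \<in> poly_ring V" for e
      unfolding c_def
    proof (intro poly_ring_sum poly_ring_single)
      fix m assume "m \<in> {m \<in> supp q. \<phi> m = e}"
      then have "supp m \<subseteq> V" using q by (auto simp: poly_ring_def)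
      moreover have "supp (m - sqmon e) \<subseteq> supp m"
        by (auto simp: in_keys_iff lookup_minus)
      ultimately show "supp (m - sqmon e) \<subseteq> V" by blast
    qed
    moreover have "q = (\<Sum>e\<in>E. c e * (\<Prod>v\<in>e. pvar v))"
    proof -
      have "(\<Sum>e\<in>E. c e * (\<Prod>v\<in>e. pvar v)) =
          (\<Sum>e\<in>E. \<Sum>m | m \<in> supp q \<and> \<phi> m = e. monom m (coeff q m))"
      proof (rule sum.cong[OF refl])
        fix e assume e: "e \<in> E"
        show "c e * (\<Prod>v\<in>e. pvar v) =
            (\<Sum>m | m \<in> supp q \<and> \<phi> m = e. monom m (coeff q m))"
          unfolding prod[OF e] c_def sum_distrib_right
        proof (rule sum.cong[OF refl])
          fix m assume "m \<in> {m \<in> supp q. \<phi> m = e}"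
          then have "m - sqmon e + sqmon e = m" using \<phi> fine[OF e] by (intro diff_sqmon_add) auto
          then show "monom (m - sqmon e) (coeff q m) * monom (sqmon e) 1 =
              monom m (coeff q m)" by (simp add: mult_single)
        qed
      qed
      also have "\<dots> = (\<Sum>m\<in>supp q. monom m (coeff q m))"
        by (rule sum.group) (use finE \<phi> in auto)
      finally show ?thesis by (simp add: sum_monomials)
    qed
    ultimately show "q \<in> edge_ideal V E" by (auto simp: edge_ideal_def)
  qed
qed

text \<open>Degrees are integers because \<open>j - int (card A)\<close> can be negative, where the
  piece is zero.\<close>

definition graded_piece :: "'v set \<Rightarrow> int \<Rightarrow> ('v, 'k::field) mpolynomial set" where
  "graded_piece V d = {q \<in> poly_ring V. homogeneous d q}"

definition pmult :: "'v \<Rightarrow> ('v, 'k::field) mpolynomial \<Rightarrow> ('v, 'k) mpolynomial" where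
  "pmult v q = pvar v * q"

lemma koszul_pmult: "finite V \<Longrightarrow> inj_on ord V \<Longrightarrow> koszul ord V (pmult :: 'v \<Rightarrow> ('v, 'k::field) mpolynomial \<Rightarrow> _)"
  by unfold_locales (auto simp: pmult_def algebra_simps)

lemma graded_piece_simps:
  "0 \<in> graded_piece V d"
  "a \<in> graded_piece V d \<Longrightarrow> b \<in> graded_piece V d \<Longrightarrow> a + b \<in> graded_piece V d"
  "a \<in> graded_piece V d \<Longrightarrow> b \<in> graded_piece V d \<Longrightarrow> a - b \<in> graded_piece V d"
  "v \<in> V \<Longrightarrow> a \<in> graded_piece V d \<Longrightarrow> pmult v a \<in> graded_piece V (d + 1)"
  by (auto simp: graded_piece_def poly_ring_add poly_ring_diff homogeneous_add homogeneous_diff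
      pmult_def poly_ring_mult pvar_poly_ring homogeneous_pvar_mult)

lemma graded_piece_lookup:
  "q \<in> graded_piece V d \<longleftrightarrow>
    (\<forall>m. \<not> (supp m \<subseteq> V \<and> int (mdeg m) = d) \<longrightarrow> coeff q m = 0)"
  by (auto simp: graded_piece_def poly_ring_lookup homogeneous_lookup)

section \<open>Decomposition of the Koszul complex into multidegrees\<close>

lemma lookup_sgn_act: "coeff (sgn_act n q) m = sgn_act n (coeff q m)"
  by (simp add: sgn_act_def)

text \<open>The differential preserves the multidegree: in multidegree \<alpha> the coefficient at
  \<open>A\<close> belongs to the monomial \<alpha> divided by the product of \<open>A\<close>. Only
  variables in the support of \<alpha> contribute.\<close>

lemma lookup_koszul_d_pmult:
  fixes c :: "'v set \<Rightarrow> ('v, 'k::field) mpolynomial"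
  assumes fin: "finite V" and A: "A \<subseteq> supp \<alpha>" and \<alpha>: "supp \<alpha> \<subseteq> V"
  shows "coeff (koszul_d ord V pmult c A) (\<alpha> - sqmon A) =
    koszul_d ord (supp \<alpha>) scalar (\<lambda>B. coeff (c B) (\<alpha> - sqmon B)) A"
proof -
  have finA: "finite A" using A finite_subset by fastforce
  have summand: "coeff (sgn_act (below ord v A) (pmult v (c (insert v A)))) (\<alpha> - sqmon A) =
     (if v \<in> supp \<alpha> then sgn_act (below ord v A) (coeff (c (insert v A)) (\<alpha> - sqmon (insert v A))) else 0)"
    if "v \<notin> A" for v
  proof -
    have "v \<in> supp (\<alpha> - sqmon A) \<longleftrightarrow> v \<in> supp \<alpha>"
      using that finA by (simp add: in_keys_iff lookup_minus lookup_sqmon)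
    then show ?thesis
      using that finA by (simp add: lookup_sgn_act pmult_def lookup_pvar_mult diff_sqmon_insert)
  qed
  show ?thesis
    unfolding koszul_d_def lookup_sum
    by (rule sum.mono_neutral_cong_right) (use fin \<alpha> summand in \<open>auto simp: scalar_def\<close>)
qed

text \<open>The complex in degree \<open>j\<close> is the sum of its strands in the multidegrees
  \<alpha> of degree \<open>j\<close>. In a strand the coefficient at \<open>A\<close> is a multiple
  of one monomial, which vanishes in R/I unless its support is independent.\<close>

lemma koszul_homology_multigraded:
  fixes E :: "'v set set"
  assumes fin: "finite V" and E: "\<And>e. e \<in> E \<Longrightarrow> e \<subseteq> V"
  shows "hom_nz ord V (pmult :: 'v \<Rightarrow> ('v, 'k::field) mpolynomial \<Rightarrow> _)
      (\<lambda>A. graded_piece V (j - int (card A))) (\<lambda>A. graded_piece V (j - int (card A)) \<inter> edge_ideal V E) p \<longleftrightarrow>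
    (\<exists>\<alpha>. supp \<alpha> \<subseteq> V \<and> int (mdeg \<alpha>) = j \<and>
      hom_nz ord (supp \<alpha>) (scalar :: 'v \<Rightarrow> 'k \<Rightarrow> 'k) (\<lambda>_. UNIV)
        (zero_on {A. indep E (supp (\<alpha> - sqmon A))}) p)"
    (is "hom_nz ord V ?P ?S ?T p \<longleftrightarrow> (\<exists>\<alpha>. ?ok \<alpha> \<and> int (mdeg \<alpha>) = j \<and> ?h \<alpha>)")
proof -
  let ?K = "koszul_d ord V ?P"
  have famS: "subfam V ?P ?S"
  proof -
    have "pmult v m \<in> ?S A" if "A \<subseteq> V" "v \<in> V - A" "m \<in> ?S (insert v A)" for A v and m :: "('v, 'k) mpolynomial"
    proof -
      have "finite A" using that fin finite_subset by blast
      then show ?thesis using graded_piece_simps(4)[of v V m "j - int (card (insert v A))"] that by simp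
    qed
    then show ?thesis by (auto simp: subfam_def graded_piece_simps)
  qed
  have fA: "finite A" if "A \<subseteq> V" for A using that fin finite_subset by blast
  have T_iff: "q \<in> ?T A \<longleftrightarrow> (\<forall>\<alpha>. A \<subseteq> supp \<alpha> \<and> ?ok \<alpha> \<and> int (mdeg \<alpha>) = j \<and>
      indep E (supp (\<alpha> - sqmon A)) \<longrightarrow> coeff q (\<alpha> - sqmon A) = 0)"
    if q: "q \<in> ?S A" and A: "A \<subseteq> V" for q A
  proof
    assume "q \<in> ?T A"
    then show "\<forall>\<alpha>. A \<subseteq> supp \<alpha> \<and> ?ok \<alpha> \<and> int (mdeg \<alpha>) = j \<and>
      indep E (supp (\<alpha> - sqmon A)) \<longrightarrow> coeff q (\<alpha> - sqmon A) = 0"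
      by (simp add: edge_ideal_iff[OF fin E])
  next
    assume R: "\<forall>\<alpha>. A \<subseteq> supp \<alpha> \<and> ?ok \<alpha> \<and> int (mdeg \<alpha>) = j \<and>
      indep E (supp (\<alpha> - sqmon A)) \<longrightarrow> coeff q (\<alpha> - sqmon A) = 0"
    have "coeff q m = 0" if m: "indep E (supp m)" for m
    proof (cases "supp m \<subseteq> V \<and> int (mdeg m) = j - int (card A)")
      case True
      have "m + sqmon A - sqmon A = m" by simp
      moreover have "supp (m + sqmon A) = supp m \<union> A"
        by (simp add: keys_add_nat keys_sqmon fA[OF A])
      moreover have "int (mdeg (m + sqmon A)) = j" using True by (simp add: mdeg_add mdeg_sqmon fA[OF A])
      ultimately show ?thesis using R[rule_format, of "m + sqmon A"] m True A by auto
    next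
      case False
      then show ?thesis using q by (auto simp: graded_piece_lookup)
    qed
    then show "q \<in> ?T A" using q by (auto simp: edge_ideal_iff[OF fin E] graded_piece_def)
  qed
  show ?thesis
  proof
    assume L: "hom_nz ord V ?P ?S ?T p"
    show "\<exists>\<alpha>. ?ok \<alpha> \<and> int (mdeg \<alpha>) = j \<and> ?h \<alpha>"
    proof (rule ccontr)
      assume neg: "\<not> ?thesis"
      obtain c where c: "chain V ?S p c" "cycle ord V ?P ?T p c" "\<not> boundary ord V ?P ?S ?T p c"
        using L by (auto simp: hom_nz_def)
      \<comment> \<open>If no strand has homology, each strand of \<open>c\<close> has its own
        bounding chain.\<close>
      have "\<exists>g. ?ok \<alpha> \<and> int (mdeg \<alpha>) = j \<longrightarrow> (\<forall>A. A \<subseteq> supp \<alpha> \<longrightarrow> card A = p \<longrightarrow>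
          indep E (supp (\<alpha> - sqmon A)) \<longrightarrow>
          coeff (c A) (\<alpha> - sqmon A) = koszul_d ord (supp \<alpha>) scalar g A)" for \<alpha>
      proof (cases "?ok \<alpha> \<and> int (mdeg \<alpha>) = j")
        case True
        let ?f = "\<lambda>B. coeff (c B) (\<alpha> - sqmon B)"
        let ?Z = "zero_on {A. indep E (supp (\<alpha> - sqmon A))} :: 'v set \<Rightarrow> 'k set"
        have "cycle ord (supp \<alpha>) scalar ?Z p ?f"
          unfolding cycle_def
        proof (intro allI impI)
          fix A assume A: "A \<subseteq> supp \<alpha>" "Suc (card A) = p"
          have AV: "A \<subseteq> V" using A True by auto
          have "?K c A \<in> ?T A" using c(2) AV A by (auto simp: cycle_def)
          then have "coeff (?K c A) (\<alpha> - sqmon A) = 0"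
            if "indep E (supp (\<alpha> - sqmon A))"
            using that T_iff[of "?K c A" A] AV A True by blast
          then show "koszul_d ord (supp \<alpha>) scalar ?f A \<in> ?Z A"
            using lookup_koszul_d_pmult[OF fin A(1), of ord c] True by (auto simp: zero_on_def)
        qed
        moreover have "\<not> ?h \<alpha>" using neg True by blast
        ultimately have "boundary ord (supp \<alpha>) scalar (\<lambda>_. UNIV) ?Z p ?f"
          by (auto simp: hom_nz_def)
        then obtain g where "chain (supp \<alpha>) ?Z p (\<lambda>A. ?f A - koszul_d ord (supp \<alpha>) scalar g A)"
          by (auto simp: boundary_def)
        then show ?thesis
          by (intro exI[of _ g]) (auto simp: chain_def zero_on_def split: if_splits)
      qed auto
      then obtain g where g: "\<And>\<alpha> A. ?ok \<alpha> \<Longrightarrow> int (mdeg \<alpha>) = j \<Longrightarrow> A \<subseteq> supp \<alpha> \<Longrightarrow> card A = p \<Longrightarrow>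
          indep E (supp (\<alpha> - sqmon A)) \<Longrightarrow>
          coeff (c A) (\<alpha> - sqmon A) = koszul_d ord (supp \<alpha>) scalar (g \<alpha>) A"
        by metis
      \<comment> \<open>The strands are assembled: the coefficient of the monomial \<open>m\<close>
        at \<open>B\<close> comes from the chain in multidegree \<open>m + sqmon B\<close>. Fixing
        the degree makes the support finite.\<close>
      define dl where "dl B m = (if supp m \<subseteq> V \<and> int (mdeg m) = j - int (card B) then g (m + sqmon B) B else 0)" for B m
      define d where "d B = Abs_poly_mapping (dl B)" for B
      have d: "coeff (d B) = dl B" for B
      proof -
        have "{m. dl B m \<noteq> 0} \<subseteq> {m. supp m \<subseteq> V \<and> mdeg m \<le> nat j}"
          by (auto simp: dl_def split: if_splits)
        then have "finite {m. dl B m \<noteq> 0}" using finite_monomials[OF fin] finite_subset by blast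
        then show ?thesis by (simp add: d_def)
      qed
      have dS: "chain V ?S q d" for q by (auto simp: chain_def graded_piece_lookup d dl_def)
      have "chain V ?T p (\<lambda>A. c A - ?K d A)"
        unfolding chain_def
      proof (intro allI impI)
        fix A assume A: "A \<subseteq> V" "card A = p"
        have S: "c A - ?K d A \<in> ?S A"
          using koszul_d_chain[OF fin famS dS, of p ord] c(1) A by (auto simp: chain_def graded_piece_simps)
        have "coeff (c A - ?K d A) (\<alpha> - sqmon A) = 0"
          if \<alpha>: "A \<subseteq> supp \<alpha>" "?ok \<alpha>" "int (mdeg \<alpha>) = j" "indep E (supp (\<alpha> - sqmon A))" for \<alpha>
        proof -
          have "coeff (?K d A) (\<alpha> - sqmon A) =
              koszul_d ord (supp \<alpha>) scalar (\<lambda>B. coeff (d B) (\<alpha> - sqmon B)) A"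
            by (rule lookup_koszul_d_pmult[OF fin \<alpha>(1,2)])
          also have "\<dots> = koszul_d ord (supp \<alpha>) scalar (g \<alpha>) A"
          proof (rule koszul_d_cong)
            fix v assume v: "v \<in> supp \<alpha> - A"
            let ?B = "insert v A"
            have B: "?B \<subseteq> supp \<alpha>" "finite ?B" using v \<alpha>(1) fA[OF A(1)] by auto
            have eq: "\<alpha> - sqmon ?B + sqmon ?B = \<alpha>" by (rule diff_sqmon_add[OF B(2,1)])
            then have "mdeg (\<alpha> - sqmon ?B) + card ?B = mdeg \<alpha>"
              using mdeg_add[of "\<alpha> - sqmon ?B" "sqmon ?B"] mdeg_sqmon[OF B(2)] by simp
            then have "int (mdeg (\<alpha> - sqmon ?B)) = j - int (card ?B)" using \<alpha>(3) by linarith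
            moreover have "supp (\<alpha> - sqmon ?B) \<subseteq> V"
              using \<alpha>(2) by (auto simp: in_keys_iff lookup_minus)
            ultimately show "coeff (d ?B) (\<alpha> - sqmon ?B) = g \<alpha> ?B"
              unfolding d dl_def eq by simp
          qed
          finally show ?thesis using g[OF \<alpha>(2,3,1) A(2) \<alpha>(4)] by (simp add: lookup_minus)
        qed
        then show "c A - ?K d A \<in> ?T A" using T_iff[OF S A(1)] by blast
      qed
      then show False using c(3) dS by (auto simp: boundary_def)
    qed
  next
    assume "\<exists>\<alpha>. ?ok \<alpha> \<and> int (mdeg \<alpha>) = j \<and> ?h \<alpha>"
    then obtain \<alpha> where \<alpha>: "?ok \<alpha>" "int (mdeg \<alpha>) = j" "?h \<alpha>" by blast
    let ?Z = "zero_on {A. indep E (supp (\<alpha> - sqmon A))} :: 'v set \<Rightarrow> 'k set"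
    obtain f where f: "cycle ord (supp \<alpha>) scalar ?Z p f"
        "\<not> boundary ord (supp \<alpha>) scalar (\<lambda>_. UNIV) ?Z p f"
      using \<alpha>(3) by (auto simp: hom_nz_def)
    \<comment> \<open>A cycle of one strand becomes a chain of monomials that is zero in all other
      multidegrees.\<close>
    define c where "c A = (if A \<subseteq> supp \<alpha> then monom (\<alpha> - sqmon A) (f A) else 0)" for A
    have cS: "c A \<in> ?S A" if A: "A \<subseteq> V" for A
    proof (cases "A \<subseteq> supp \<alpha>")
      case True
      have "mdeg (\<alpha> - sqmon A) + card A = mdeg \<alpha>"
        using mdeg_add[of "\<alpha> - sqmon A" "sqmon A"] mdeg_sqmon[OF fA[OF A]] diff_sqmon_add[OF fA[OF A] True] by simp
      then have "int (mdeg (\<alpha> - sqmon A)) = j - int (card A)" using \<alpha>(2) by linarith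
      moreover have "supp (\<alpha> - sqmon A) \<subseteq> V"
        using \<alpha>(1) by (auto simp: in_keys_iff lookup_minus)
      ultimately show ?thesis using True
        by (simp add: c_def graded_piece_def poly_ring_single) (simp add: homogeneous_def)
    next
      case False
      then show ?thesis by (simp add: c_def graded_piece_simps)
    qed
    have lc: "coeff (c B) (\<beta> - sqmon B) = (if \<alpha> = \<beta> then f B else 0)"
      if "B \<subseteq> supp \<beta>" for B \<beta>
    proof -
      have fB: "finite B" using that finite_subset by fastforce
      have "\<alpha> = \<beta>" if "B \<subseteq> supp \<alpha>" "\<alpha> - sqmon B = \<beta> - sqmon B"
        using diff_sqmon_add[OF fB that(1)] diff_sqmon_add[OF fB \<open>B \<subseteq> supp \<beta>\<close>] that(2) by metis
      then show ?thesis using that by (auto simp: c_def lookup_single when_def)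
    qed
    have chainc: "chain V ?S q c" for q using cS by (auto simp: chain_def)
    have "cycle ord V ?P ?T p c"
      unfolding cycle_def
    proof (intro allI impI)
      fix A assume A: "A \<subseteq> V" "Suc (card A) = p"
      have S: "?K c A \<in> ?S A" using koszul_d_chain[OF fin famS chainc, of "card A" ord] A by (auto simp: chain_def)
      have "coeff (?K c A) (\<beta> - sqmon A) = 0"
        if \<beta>: "A \<subseteq> supp \<beta>" "?ok \<beta>" "indep E (supp (\<beta> - sqmon A))" for \<beta>
      proof -
        have "coeff (?K c A) (\<beta> - sqmon A) =
            koszul_d ord (supp \<beta>) scalar (\<lambda>B. coeff (c B) (\<beta> - sqmon B)) A"
          by (rule lookup_koszul_d_pmult[OF fin \<beta>(1,2)])
        also have "\<dots> = koszul_d ord (supp \<beta>) scalar (\<lambda>B. if \<alpha> = \<beta> then f B else 0) A"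
          by (rule koszul_d_cong) (use lc \<beta>(1) in auto)
        also have "\<dots> = 0"
        proof (cases "\<alpha> = \<beta>")
          case True
          then show ?thesis using f(1) A \<beta> by (auto simp: cycle_def zero_on_def)
        next
          case False
          then show ?thesis by (simp add: koszul_d_def scalar_def)
        qed
        finally show ?thesis .
      qed
      then show "?K c A \<in> ?T A" using T_iff[OF S A(1)] by blast
    qed
    moreover have "\<not> boundary ord V ?P ?S ?T p c"
    proof
      assume "boundary ord V ?P ?S ?T p c"
      then obtain d where d: "chain V ?S (Suc p) d" "chain V ?T p (\<lambda>A. c A - ?K d A)"
        by (auto simp: boundary_def)
      let ?g = "\<lambda>B. coeff (d B) (\<alpha> - sqmon B)"
      have "chain (supp \<alpha>) ?Z p (\<lambda>A. f A - koszul_d ord (supp \<alpha>) scalar ?g A)"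
        unfolding chain_def
      proof (intro allI impI)
        fix A assume A: "A \<subseteq> supp \<alpha>" "card A = p"
        have AV: "A \<subseteq> V" using A \<alpha> by auto
        have T: "c A - ?K d A \<in> ?T A" using d(2) AV A by (auto simp: chain_def)
        then have "coeff (c A - ?K d A) (\<alpha> - sqmon A) = 0"
          if "indep E (supp (\<alpha> - sqmon A))"
          using that T_iff[of "c A - ?K d A" A] AV A \<alpha> by blast
        then show "f A - koszul_d ord (supp \<alpha>) scalar ?g A \<in> ?Z A"
          using lc[OF A(1)] lookup_koszul_d_pmult[OF fin A(1) \<alpha>(1), of ord d]
          by (simp add: zero_on_def lookup_minus)
      qed
      then show False using f(2) by (auto simp: boundary_def)
    qed
    ultimately show "hom_nz ord V ?P ?S ?T p" using chainc by (auto simp: hom_nz_def)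
  qed
qed

text \<open>If some exponent of \<alpha> is at least 2, removing that vertex from \<open>A\<close>
  does not change the support of the remaining monomial, so the strand is a cone and acyclic. Only
  squarefree multidegrees remain.\<close>

theorem koszul_homology_edge_ideal:
  fixes E :: "'v set set"
  assumes fin: "finite V" and inj: "inj_on ord V" and E: "\<And>e. e \<in> E \<Longrightarrow> e \<subseteq> V"
  shows "hom_nz ord V (pmult :: 'v \<Rightarrow> ('v, 'k::field) mpolynomial \<Rightarrow> _)
      (\<lambda>A. graded_piece V (j - int (card A))) (\<lambda>A. graded_piece V (j - int (card A)) \<inter> edge_ideal V E) p \<longleftrightarrow>
    (\<exists>\<sigma>\<subseteq>V. int (card \<sigma>) = j \<and> betti_nz TYPE('k) ord E p \<sigma>)"
    (is "?L \<longleftrightarrow> ?R")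
proof -
  let ?h = "\<lambda>\<alpha>. hom_nz ord (supp \<alpha>) (scalar :: 'v \<Rightarrow> 'k \<Rightarrow> 'k) (\<lambda>_. UNIV)
        (zero_on {A. indep E (supp (\<alpha> - sqmon A))}) p"
  have sqfree: "\<alpha> = sqmon (supp \<alpha>)" if \<alpha>: "supp \<alpha> \<subseteq> V" "?h \<alpha>" for \<alpha>
  proof (rule ccontr)
    assume "\<alpha> \<noteq> sqmon (supp \<alpha>)"
    then obtain v where v: "coeff \<alpha> v \<noteq> (if v \<in> supp \<alpha> then 1 else 0)"
      using lookup_sqmon[OF finite_keys, of \<alpha>] by (metis poly_mapping_eqI)
    then have v2: "v \<in> supp \<alpha>" "2 \<le> coeff \<alpha> v"
      by (auto simp: in_keys_iff split: if_splits)
    have "\<not> ?h \<alpha>"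
    proof (rule cone_acyclic[of _ _ v])
      show "finite (supp \<alpha>)" by simp
      show "inj_on ord (supp \<alpha>)" using inj \<alpha>(1) inj_on_subset by blast
      show "v \<in> supp \<alpha>" by (rule v2)
      fix A assume A: "A \<subseteq> supp \<alpha>" "A \<in> {A. indep E (supp (\<alpha> - sqmon A))}"
      have fA: "finite A" using A finite_subset by fastforce
      have "supp (\<alpha> - sqmon (A - {v})) = supp (\<alpha> - sqmon A)"
        using v2 fA by (auto simp: in_keys_iff lookup_minus lookup_sqmon split: if_splits)
      then show "A - {v} \<in> {A. indep E (supp (\<alpha> - sqmon A))}" using A by simp
    qed
    then show False using \<alpha>(2) by blast
  qed
  have betti_nz: "?h (sqmon \<sigma>) \<longleftrightarrow> betti_nz TYPE('k) ord E p \<sigma>" if "\<sigma> \<subseteq> V" for \<sigma>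
  proof -
    have fs: "finite \<sigma>" using that fin finite_subset by blast
    have "supp (sqmon \<sigma> - sqmon A) = \<sigma> - A" if "A \<subseteq> \<sigma>" for A
      using that fs finite_subset[OF that fs] by (auto simp: in_keys_iff lookup_minus lookup_sqmon split: if_splits)
    then show ?thesis unfolding betti_nz_def keys_sqmon[OF fs]
      by (intro hom_nz_cong) (auto simp: zero_on_def cofaces_def)
  qed
  have "?L \<longleftrightarrow> (\<exists>\<alpha>. supp \<alpha> \<subseteq> V \<and> int (mdeg \<alpha>) = j \<and> ?h \<alpha>)"
    by (rule koszul_homology_multigraded[OF fin E])
  also have "\<dots> \<longleftrightarrow> ?R"
  proof
    assume "\<exists>\<alpha>. supp \<alpha> \<subseteq> V \<and> int (mdeg \<alpha>) = j \<and> ?h \<alpha>"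
    then obtain \<alpha> where \<alpha>: "supp \<alpha> \<subseteq> V" "int (mdeg \<alpha>) = j" "?h \<alpha>" by blast
    let ?\<sigma> = "supp \<alpha>"
    have "\<alpha> = sqmon ?\<sigma>" by (rule sqfree[OF \<alpha>(1,3)])
    then have "betti_nz TYPE('k) ord E p ?\<sigma>" "mdeg \<alpha> = card ?\<sigma>"
      using betti_nz[OF \<alpha>(1)] \<alpha>(3) mdeg_sqmon[of ?\<sigma>] by auto
    then show ?R using \<alpha> by auto
  next
    assume ?R
    then obtain \<sigma> where \<sigma>: "\<sigma> \<subseteq> V" "int (card \<sigma>) = j" "betti_nz TYPE('k) ord E p \<sigma>" by blast
    have "finite \<sigma>" using \<sigma> fin finite_subset by blast
    then show "\<exists>\<alpha>. supp \<alpha> \<subseteq> V \<and> int (mdeg \<alpha>) = j \<and> ?h \<alpha>"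
      using \<sigma> betti_nz[OF \<sigma>(1)] by (intro exI[of _ "sqmon \<sigma>"]) (simp add: keys_sqmon mdeg_sqmon)
  qed
  finally show ?thesis .
qed

section \<open>Minimal presentations and resolutions\<close>

type_synonym ('v, 'k) pvec = "nat \<Rightarrow> ('v, 'k) mpolynomial"

definition vmult :: "'v \<Rightarrow> ('v, 'k::field) pvec \<Rightarrow> ('v, 'k) pvec" where
  "vmult v a = (\<lambda>k. pvar v * a k)"

text \<open>The degree \<open>d\<close> part of the direct sum of the shifted rings R(-s k).\<close>

definition gvec :: "'v set \<Rightarrow> nat \<Rightarrow> (nat \<Rightarrow> int) \<Rightarrow> int \<Rightarrow> ('v, 'k::field) pvec set" where
  "gvec V r s d = {a. (\<forall>k<r. a k \<in> graded_piece V (d - s k)) \<and> (\<forall>k\<ge>r. a k = 0)}"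

definition gsub :: "'v set \<Rightarrow> ('v \<Rightarrow> 'm::ab_group_add \<Rightarrow> 'm) \<Rightarrow> (int \<Rightarrow> 'm set) \<Rightarrow> bool" where
  "gsub V X S \<longleftrightarrow> (\<forall>d. 0 \<in> S d \<and> (\<forall>a\<in>S d. \<forall>b\<in>S d. a + b \<in> S d \<and> a - b \<in> S d) \<and>
     (\<forall>v\<in>V. \<forall>m\<in>S d. X v m \<in> S (d + 1)))"

lemma gsub_zero: "gsub V X S \<Longrightarrow> 0 \<in> S d"
  and gsub_add: "gsub V X S \<Longrightarrow> a \<in> S d \<Longrightarrow> b \<in> S d \<Longrightarrow> a + b \<in> S d"
  and gsub_diff: "gsub V X S \<Longrightarrow> a \<in> S d \<Longrightarrow> b \<in> S d \<Longrightarrow> a - b \<in> S d"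
  and gsub_X: "gsub V X S \<Longrightarrow> v \<in> V \<Longrightarrow> a \<in> S d \<Longrightarrow> X v a \<in> S (d + 1)"
  by (simp_all add: gsub_def)

text \<open>In total degree \<open>j\<close> the exterior basis element of \<open>A\<close> accounts
  for \<open>card A\<close> and the coefficient for the rest.\<close>

abbreviation shifted :: "(int \<Rightarrow> 'm set) \<Rightarrow> int \<Rightarrow> 'v set \<Rightarrow> 'm set" where
  "shifted S j \<equiv> \<lambda>A. S (j - int (card A))"

lemma gsub_subfam:
  assumes "finite V" "gsub V X S"
  shows "subfam V X (shifted S j)"
proof -
  have "X v m \<in> shifted S j A" if "A \<subseteq> V" "v \<in> V - A" "m \<in> shifted S j (insert v A)" for A v m
  proof -
    have "finite A" using that assms(1) finite_subset by blast
    then have eq: "j - int (card (insert v A)) + 1 = j - int (card A)" using that by simp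
    have "X v m \<in> S (j - int (card (insert v A)) + 1)"
      using that by (intro gsub_X[OF assms(2)]) auto
    then show ?thesis unfolding eq .
  qed
  then show ?thesis using assms(2) unfolding subfam_def gsub_def by blast
qed

lemma subfam_0: "(\<And>v. X v 0 = 0) \<Longrightarrow> subfam V X (\<lambda>_. {0})"
  by (auto simp: subfam_def)

lemma koszul_vmult:
  "finite V \<Longrightarrow> inj_on ord V \<Longrightarrow> koszul ord V (vmult :: 'v \<Rightarrow> ('v, 'k::field) pvec \<Rightarrow> _)"
  by unfold_locales (auto simp: vmult_def fun_eq_iff algebra_simps)

lemma gsub_graded_piece: "gsub V pmult (graded_piece V)"
  by (auto simp: gsub_def graded_piece_simps)

lemma gsub_gvec:
  fixes V :: "'v set"
  shows "gsub V (vmult :: 'v \<Rightarrow> ('v, 'k::field) pvec \<Rightarrow> _) (gvec V r s)"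
  unfolding gsub_def
proof (intro allI conjI ballI)
  fix d and a b :: "('v, 'k) pvec" assume ab: "a \<in> gvec V r s d" "b \<in> gvec V r s d"
  show "a + b \<in> gvec V r s d" "a - b \<in> gvec V r s d"
    using ab by (auto simp: gvec_def graded_piece_simps)
next
  fix d v and a :: "('v, 'k) pvec" assume a: "v \<in> V" "a \<in> gvec V r s d"
  have "vmult v a k \<in> graded_piece V (d + 1 - s k)" if "k < r" for k
  proof -
    have "a k \<in> graded_piece V (d - s k)" using a that by (simp add: gvec_def)
    then have "pmult v (a k) \<in> graded_piece V (d - s k + 1)" by (rule graded_piece_simps(4)[OF a(1)])
    moreover have "d - s k + 1 = d + 1 - s k" by simp
    ultimately show ?thesis by (simp only: vmult_def pmult_def)
  qed
  then show "vmult v a \<in> gvec V r s (d + 1)" using a by (simp add: gvec_def vmult_def)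
qed (simp add: gvec_def graded_piece_simps)

lemma sum_fun_apply: "(sum f B) x = (\<Sum>i\<in>B. f i x)"
  by (induction B rule: infinite_finite_induct) auto

lemma sgn_act_fun_apply: "sgn_act n a x = sgn_act n (a x)"
  by (simp add: sgn_act_def)

lemma koszul_d_vmult: "koszul_d ord V vmult c A k = koszul_d ord V pmult (\<lambda>B. c B k) A"
  by (simp add: koszul_d_def sum_fun_apply sgn_act_fun_apply vmult_def pmult_def)

section \<open>Exactness of the Koszul complex of a free module\<close>

lemma edge_ideal_no_edges: "edge_ideal V {} = {0}"
  by (simp add: edge_ideal_def)

lemma lookup_0_mult:
  fixes a b :: "('v, 'k::field) mpolynomial"
  shows "coeff (a * b) 0 = coeff a 0 * coeff b 0"
proof -
  have "a = monom 0 (coeff a 0) + (a - monom 0 (coeff a 0))"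
    by simp
  then obtain a' where a: "a = monom 0 (coeff a 0) + a'"
    and a': "coeff a' 0 = 0"
    by (metis lookup_minus lookup_single_eq cancel_comm_monoid_add_class.diff_cancel)
  have "0 \<notin> supp (a' * b)"
  proof
    assume "0 \<in> supp (a' * b)"
    then obtain s t where st: "0 = s + t" "s \<in> supp a'" using keys_mult[of a' b] by auto
    have "mdeg s = 0" using st(1) mdeg_add[of s t] by (simp add: mdeg_def[of 0])
    then have "s = 0" by (simp add: mdeg_eq_0_iff)
    then show False using st a' by (simp add: in_keys_iff)
  qed
  then have "coeff (a' * b) 0 = 0" by (simp add: in_keys_iff)
  moreover have "coeff (monom 0 (coeff a 0) * b) 0 =
      coeff a 0 * coeff b 0"
    using lookup_single_mult_add[of 0 "coeff a 0" b 0] by simp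
  ultimately show ?thesis by (subst a) (simp only: distrib_right lookup_add add_0_right)
qed

lemma lookup_0_pvar [simp]: "coeff (pvar v) 0 = 0"
  using mdeg_eq_0_iff[of "monom v 1"] by (simp add: pvar_def lookup_single when_def)

lemma lookup_0_koszul_d_pmult: "coeff (koszul_d ord V pmult c A) 0 = 0"
  by (auto simp: koszul_d_def lookup_sum lookup_sgn_act pmult_def lookup_0_mult intro!: sum.neutral)

lemma graded_piece_no_constant:
  assumes "q \<in> graded_piece V d" "d \<noteq> 0 \<or> coeff q 0 = 0"
  shows "coeff q 0 = 0 \<and> (d = 0 \<longrightarrow> q = 0)"
proof -
  have "coeff q 0 = 0" using assms by (auto simp: graded_piece_lookup mdeg_def)
  moreover have "q = 0" if "d = 0"
  proof (rule poly_mapping_eqI)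
    fix m show "coeff q m = coeff 0 m"
    proof (cases "m = 0")
      case True then show ?thesis using calculation by simp
    next
      case False
      then have "mdeg m \<noteq> 0" by (simp add: mdeg_eq_0_iff)
      then show ?thesis using assms(1) that by (auto simp: graded_piece_lookup)
    qed
  qed
  ultimately show ?thesis by blast
qed

text \<open>The polynomial ring is R/I for the graph without edges, where every vertex is isolated.
  Only the empty multidegree survives, in homological degree 0, and the assumption on the constant
  term excludes it.\<close>

lemma polynomial_ring_exact:
  fixes c :: "'v set \<Rightarrow> ('v, 'k::field) mpolynomial"
  assumes fin: "finite V" and inj: "inj_on ord V"
    and c: "chain V (shifted (graded_piece V) j) p c" "cycle ord V pmult (\<lambda>_. {0}) p c"
    and p: "p = 0 \<Longrightarrow> coeff (c {}) 0 = 0"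
  shows "boundary ord V pmult (shifted (graded_piece V) j) (\<lambda>_. {0}) p c"
proof (cases "p = 0 \<and> j = 0")
  case True
  have "c {} \<in> graded_piece V j" using c(1) True by (simp add: chain_def)
  then have "c {} = 0" using graded_piece_no_constant[of "c {}" V j] p True by blast
  moreover have "A = {}" if "A \<subseteq> V" "card A = p" for A
    using that True fin finite_subset by fastforce
  ultimately show ?thesis unfolding boundary_def
    by (intro exI[of _ "\<lambda>_. 0"]) (auto simp: chain_def graded_piece_simps koszul_d_def pmult_def)
next
  case False
  have eq: "(\<lambda>A. graded_piece V (j - int (card A)) \<inter> edge_ideal V {}) = (\<lambda>_. {0})"
    by (auto simp: edge_ideal_no_edges graded_piece_simps)
  have "\<not> hom_nz ord V (pmult :: 'v \<Rightarrow> ('v, 'k) mpolynomial \<Rightarrow> _) (shifted (graded_piece V) j) (\<lambda>_. {0}) p"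
  proof
    assume "hom_nz ord V (pmult :: 'v \<Rightarrow> ('v, 'k) mpolynomial \<Rightarrow> _) (shifted (graded_piece V) j) (\<lambda>_. {0}) p"
    then obtain \<sigma> where \<sigma>: "\<sigma> \<subseteq> V" "int (card \<sigma>) = j" "betti_nz TYPE('k) ord {} p \<sigma>"
      using koszul_homology_edge_ideal[OF fin inj, of "{}" j p, where 'k='k] unfolding eq by auto
    have fs: "finite \<sigma>" "inj_on ord \<sigma>" using \<sigma>(1) fin inj finite_subset inj_on_subset by blast+
    then have "\<sigma> = {}" using betti_nz_isolated[OF fs, of _ "{}"] \<sigma>(3) by auto
    then show False using \<sigma> False betti_nz_empty[of "{}" "TYPE('k)" ord p] by auto
  qed
  then show ?thesis using c by (auto simp: hom_nz_def)
qed

text \<open>A free module is a sum of shifted copies of the ring, so bounding chains are found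
  coordinate by coordinate.\<close>

lemma free_exact:
  fixes c :: "'v set \<Rightarrow> ('v, 'k::field) pvec"
  assumes fin: "finite V" and inj: "inj_on ord V"
    and c: "chain V (shifted (gvec V r s) j) p c" "cycle ord V vmult (\<lambda>_. {0}) p c"
    and p: "\<And>k. p = 0 \<Longrightarrow> coeff (c {} k) 0 = 0"
  shows "boundary ord V vmult (shifted (gvec V r s) j) (\<lambda>_. {0}) p c"
proof -
  have "\<exists>d. k < r \<longrightarrow> chain V (shifted (graded_piece V) (j - s k)) (Suc p) d \<and>
      chain V (\<lambda>_. {0}) p (\<lambda>A. c A k - koszul_d ord V pmult d A)" for k
  proof (cases "k < r")
    case True
    have "chain V (shifted (graded_piece V) (j - s k)) p (\<lambda>A. c A k)"
      unfolding chain_def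
    proof (intro allI impI)
      fix A assume A: "A \<subseteq> V" "card A = p"
      then have "c A k \<in> graded_piece V (j - int (card A) - s k)"
        using c(1) True by (simp add: chain_def gvec_def)
      then show "c A k \<in> graded_piece V (j - s k - int (card A))" by (simp only: diff_right_commute)
    qed
    moreover have "cycle ord V pmult (\<lambda>_. {0}) p (\<lambda>A. c A k)"
      using c(2) by (simp add: cycle_def koszul_d_vmult[symmetric])
    ultimately have "boundary ord V pmult (shifted (graded_piece V) (j - s k)) (\<lambda>_. {0}) p (\<lambda>A. c A k)"
      by (rule polynomial_ring_exact[OF fin inj]) (simp add: p)
    then show ?thesis by (auto simp: boundary_def)
  qed auto
  then obtain d where d0: "\<forall>k. k < r \<longrightarrow> chain V (shifted (graded_piece V) (j - s k)) (Suc p) (d k) \<and>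
      chain V (\<lambda>_. {0}) p (\<lambda>A. c A k - koszul_d ord V pmult (d k) A)"
    using choice[of "\<lambda>k d. k < r \<longrightarrow> chain V (shifted (graded_piece V) (j - s k)) (Suc p) d \<and>
      chain V (\<lambda>_. {0}) p (\<lambda>A. c A k - koszul_d ord V pmult d A)"] by auto
  have d: "\<And>k. k < r \<Longrightarrow> chain V (shifted (graded_piece V) (j - s k)) (Suc p) (d k)"
      "\<And>k. k < r \<Longrightarrow> chain V (\<lambda>_. {0}) p (\<lambda>A. c A k - koszul_d ord V pmult (d k) A)"
    using d0 by simp_all
  define D where "D A k = (if k < r then d k A else 0)" for A k
  have "chain V (shifted (gvec V r s) j) (Suc p) D"
    unfolding chain_def
  proof (intro allI impI)
    fix A assume A: "A \<subseteq> V" "card A = Suc p"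
    have "d k A \<in> graded_piece V (j - int (card A) - s k)" if "k < r" for k
    proof -
      have "d k A \<in> graded_piece V (j - s k - int (card A))"
        using d(1)[OF that] A by (simp add: chain_def)
      then show ?thesis by (simp only: diff_right_commute)
    qed
    then show "D A \<in> gvec V r s (j - int (card A))" by (simp add: gvec_def D_def)
  qed
  moreover have "chain V (\<lambda>_. {0}) p (\<lambda>A. c A - koszul_d ord V vmult D A)"
    unfolding chain_def
  proof (intro allI impI)
    fix A assume A: "A \<subseteq> V" "card A = p"
    have "(c A - koszul_d ord V vmult D A) k = 0" for k
    proof (cases "k < r")
      case True
      then have "c A k - koszul_d ord V pmult (d k) A = 0" using d(2)[OF True] A by (simp add: chain_def)
      then show ?thesis using True by (simp add: koszul_d_vmult D_def)
    next
      case False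
      then show ?thesis using c(1) A by (simp add: koszul_d_vmult D_def chain_def gvec_def) (simp add: koszul_d_def pmult_def)
    qed
    then show "c A - koszul_d ord V vmult D A \<in> {0}" by (simp add: fun_eq_iff)
  qed
  ultimately show ?thesis by (auto simp: boundary_def)
qed

text \<open>A minimal presentation of the graded module \<open>S/T\<close> by a free module: its kernel \<open>Z\<close> is
  contained in the maximal ideal times the free module. Koszul homology then shifts by one from
  \<open>S/T\<close> to \<open>Z\<close>, and in homological degree 0 it sees the degrees of the generators.\<close>

locale minimal_presentation =
  fixes ord :: "'v \<Rightarrow> nat" and V :: "'v set" and X :: "'v \<Rightarrow> 'm::ab_group_add \<Rightarrow> 'm"
    and S T :: "int \<Rightarrow> 'm set" and r :: nat and s :: "nat \<Rightarrow> int"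
    and \<phi> :: "('v, 'k::field) pvec \<Rightarrow> 'm" and Z :: "int \<Rightarrow> ('v, 'k) pvec set"
  assumes kX: "koszul ord V X"
    and gS: "gsub V X S" and gT: "gsub V X T" and TS: "T d \<subseteq> S d"
    and add: "\<phi> (a + b) = \<phi> a + \<phi> b" and mult: "\<phi> (vmult v a) = X v (\<phi> a)"
    and into: "a \<in> gvec V r s d \<Longrightarrow> \<phi> a \<in> S d"
    and onto: "m \<in> S d \<Longrightarrow> \<exists>a\<in>gvec V r s d. m - \<phi> a \<in> T d"
    and Z: "Z d = {a \<in> gvec V r s d. \<phi> a \<in> T d}"
    and minimal: "a \<in> Z d \<Longrightarrow> coeff (a k) 0 = 0"
begin

lemma finV: "finite V" and inj: "inj_on ord V"
  using kX by (auto simp: koszul_def)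

sublocale koszul_hom ord V vmult X \<phi>
  using kX koszul_vmult[OF finV inj] add mult
  by (auto simp: koszul_hom_def koszul_hom_axioms_def)

lemma famF: "subfam V vmult (shifted (gvec V r s) j)"
  by (rule gsub_subfam[OF finV gsub_gvec])

lemma gsub_Z: "gsub V vmult Z"
  unfolding gsub_def
proof (intro allI conjI ballI)
  fix d show "0 \<in> Z d" by (simp add: Z gsub_zero[OF gsub_gvec] gsub_zero[OF gT])
  fix a b assume ab: "a \<in> Z d" "b \<in> Z d"
  show "a + b \<in> Z d" using ab by (simp add: Z \<phi>_add gsub_add[OF gsub_gvec] gsub_add[OF gT])
  show "a - b \<in> Z d" using ab by (simp add: Z \<phi>_diff gsub_diff[OF gsub_gvec] gsub_diff[OF gT])
next
  fix d v a assume "v \<in> V" "a \<in> Z d"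
  then show "vmult v a \<in> Z (d + 1)"
    by (simp add: Z \<phi>_X gsub_X[OF gsub_gvec] gsub_X[OF gT])
qed

lemma transfer:
  "hom_nz ord V X (shifted S j) (shifted T j) p \<longleftrightarrow> hom_nz ord V vmult (shifted (gvec V r s) j) (shifted Z j) p"
proof (rule hom_nz_iff)
  show "subfam V X (shifted S j)" "subfam V X (shifted T j)" "subfam V vmult (shifted (gvec V r s) j)"
    using gsub_subfam[OF finV gS] gsub_subfam[OF finV gT] famF by auto
qed (use TS into onto Z in auto)

text \<open>The homology of the free module vanishes in positive degrees, and in degree 0 minimality
  makes the map from that of \<open>Z\<close> zero. Hence nonvanishing passes both ways through the
  connecting map.\<close>

lemma shift_degree:
  "hom_nz ord V X (shifted S j) (shifted T j) (Suc p) \<longleftrightarrow> hom_nz ord V vmult (shifted Z j) (\<lambda>_. {0}) p"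
proof -
  have fam: "subfam V vmult (shifted (gvec V r s) j)" "subfam V vmult (shifted Z j)"
      "subfam V (vmult :: 'v \<Rightarrow> ('v, 'k) pvec \<Rightarrow> _) (\<lambda>_. {0})"
    using famF gsub_subfam[OF finV gsub_Z] by (auto intro: subfam_0)
  have le: "\<And>A. A \<subseteq> V \<Longrightarrow> (\<lambda>_. {0}) A \<subseteq> shifted Z j A" "\<And>A. A \<subseteq> V \<Longrightarrow> shifted Z j A \<subseteq> shifted (gvec V r s) j A"
    using gsub_Z by (auto simp: gsub_def Z)
  show ?thesis
    unfolding transfer
  proof
    assume "hom_nz ord V vmult (shifted (gvec V r s) j) (shifted Z j) (Suc p)"
    from src.les_connecting[OF fam le this]
    have "hom_nz ord V (vmult :: 'v \<Rightarrow> ('v, 'k) pvec \<Rightarrow> _) (shifted (gvec V r s) j) (\<lambda>_. {0}) (Suc p) \<or>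
      hom_nz ord V vmult (shifted Z j) (\<lambda>_. {0}) p" .
    moreover have "\<not> hom_nz ord V (vmult :: 'v \<Rightarrow> ('v, 'k) pvec \<Rightarrow> _) (shifted (gvec V r s) j) (\<lambda>_. {0}) (Suc p)"
    proof
      assume "hom_nz ord V (vmult :: 'v \<Rightarrow> ('v, 'k) pvec \<Rightarrow> _) (shifted (gvec V r s) j) (\<lambda>_. {0}) (Suc p)"
      then obtain c :: "'v set \<Rightarrow> ('v, 'k) pvec" where c: "chain V (shifted (gvec V r s) j) (Suc p) c"
        "cycle ord V vmult (\<lambda>_. {0}) (Suc p) c"
        "\<not> boundary ord V vmult (shifted (gvec V r s) j) (\<lambda>_. {0}) (Suc p) c"
        by (auto simp: hom_nz_def)
      from free_exact[OF finV inj c(1,2)] c(3) show False by simp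
    qed
    ultimately show "hom_nz ord V vmult (shifted Z j) (\<lambda>_. {0}) p" by blast
  next
    assume h: "hom_nz ord V vmult (shifted Z j) (\<lambda>_. {0}) p"
    show "hom_nz ord V vmult (shifted (gvec V r s) j) (shifted Z j) (Suc p)"
    proof (rule src.les_zero_map_lift[OF fam le _ h])
      fix c assume c: "chain V (shifted Z j) p c" "cycle ord V vmult (\<lambda>_. {0}) p c"
      show "boundary ord V vmult (shifted (gvec V r s) j) (\<lambda>_. {0}) p c"
      proof (rule free_exact[OF finV inj chain_mono[OF c(1) le(2)] c(2)])
        fix k assume "p = 0"
        then have "c {} \<in> Z j" using c(1) by (simp add: chain_def)
        then show "coeff (c {} k) 0 = 0" by (rule minimal)
      qed
    qed
  qed
qed

text \<open>Minimality puts \<open>Z\<close> among the combinations of variables, so homology in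
  degree 0 is the free module modulo the latter, and constant terms detect it. In degree
  \<open>j\<close> a nonzero constant term needs a basis element of that degree.\<close>

lemma generator_degree:
  "hom_nz ord V X (shifted S j) (shifted T j) 0 \<longleftrightarrow> (\<exists>l<r. s l = j)"
  unfolding transfer
proof
  assume "hom_nz ord V vmult (shifted (gvec V r s) j) (shifted Z j) 0"
  then obtain c where c: "chain V (shifted (gvec V r s) j) 0 c" "\<not> boundary ord V vmult (shifted (gvec V r s) j) (shifted Z j) 0 c"
    by (auto simp: hom_nz_def)
  show "\<exists>l<r. s l = j"
  proof (rule ccontr)
    assume neg: "\<not> ?thesis"
    have c0: "c {} \<in> gvec V r s j" using c(1) by (simp add: chain_def)
    have "boundary ord V vmult (shifted (gvec V r s) j) (\<lambda>_. {0}) 0 c"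
    proof (rule free_exact[OF finV inj c(1)])
      fix k
      show "coeff (c {} k) 0 = 0"
      proof (cases "k < r")
        case True
        then have "c {} k \<in> graded_piece V (j - s k)" "j - s k \<noteq> 0" using c0 neg by (auto simp: gvec_def)
        then show ?thesis using graded_piece_no_constant by blast
      next
        case False
        then show ?thesis using c0 by (simp add: gvec_def)
      qed
    qed (simp add: cycle_def)
    then obtain d where d: "chain V (shifted (gvec V r s) j) (Suc 0) d"
      "chain V (\<lambda>_. {0}) 0 (\<lambda>A. c A - koszul_d ord V vmult d A)" by (auto simp: boundary_def)
    have "chain V (shifted Z j) 0 (\<lambda>A. c A - koszul_d ord V vmult d A)"
      by (rule chain_mono[OF d(2)]) (simp add: gsub_zero[OF gsub_Z])
    with d(1) c(2) show False unfolding boundary_def by blast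
  qed
next
  assume "\<exists>l<r. s l = j"
  then obtain l where l: "l < r" "s l = j" by blast
  define u :: "('v, 'k) pvec" where "u k = (if k = l then 1 else 0)" for k
  have "u \<in> gvec V r s j" using l by (auto simp: gvec_def u_def graded_piece_def homogeneous_def mdeg_def)
  then have "chain V (shifted (gvec V r s) j) 0 (\<lambda>_. u)" by (simp add: chain_def)
  moreover have "\<not> boundary ord V vmult (shifted (gvec V r s) j) (shifted Z j) 0 (\<lambda>_. u)"
  proof
    assume "boundary ord V vmult (shifted (gvec V r s) j) (shifted Z j) 0 (\<lambda>_. u)"
    then obtain d where "chain V (shifted Z j) 0 (\<lambda>A. u - koszul_d ord V vmult d A)"
      by (auto simp: boundary_def)
    then have "u - koszul_d ord V vmult d {} \<in> Z j" by (simp add: chain_def)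
    then have "coeff ((u - koszul_d ord V vmult d {}) l) 0 = 0" by (rule minimal)
    then show False by (simp add: lookup_minus koszul_d_vmult lookup_0_koszul_d_pmult u_def)
  qed
  ultimately show "hom_nz ord V vmult (shifted (gvec V r s) j) (shifted Z j) 0"
    by (auto simp: hom_nz_def cycle_def)
qed

end

section \<open>Homogeneous components of polynomials and vectors\<close>

definition hcomp :: "int \<Rightarrow> ('v, 'k::field) mpolynomial \<Rightarrow> ('v, 'k) mpolynomial" where
  "hcomp d q = Abs_poly_mapping (\<lambda>m. if int (mdeg m) = d then coeff q m else 0)"

lemma lookup_hcomp: "coeff (hcomp d q) m = (if int (mdeg m) = d then coeff q m else 0)"
proof -
  have "finite {m. (if int (mdeg m) = d then coeff q m else 0) \<noteq> 0}"
    by (rule finite_subset[of _ "supp q"]) (auto simp: in_keys_iff split: if_splits)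
  then show ?thesis by (simp add: hcomp_def)
qed

lemma hcomp_sum: "hcomp d (sum f B) = (\<Sum>x\<in>B. hcomp d (f x))"
  by (rule poly_mapping_eqI) (simp add: lookup_hcomp lookup_sum)

lemma hcomp_zero [simp]: "hcomp d 0 = 0"
  by (rule poly_mapping_eqI) (simp add: lookup_hcomp)

lemma hcomp_diff: "hcomp d (a - b) = hcomp d a - hcomp d b"
  by (rule poly_mapping_eqI) (simp add: lookup_hcomp lookup_minus)

lemma hcomp_homogeneous: "homogeneous d q \<Longrightarrow> hcomp d q = q"
  by (rule poly_mapping_eqI) (simp add: lookup_hcomp homogeneous_lookup)

lemma homogeneous_hcomp: "homogeneous d (hcomp d q)"
  by (simp add: homogeneous_lookup lookup_hcomp)

lemma hcomp_graded_piece: "q \<in> poly_ring V \<Longrightarrow> hcomp d q \<in> graded_piece V d"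
  by (simp add: graded_piece_def homogeneous_hcomp poly_ring_lookup lookup_hcomp)

lemma hcomp_mult:
  assumes "homogeneous d p"
  shows "hcomp (d + e) (p * q) = p * hcomp e q"
proof (rule poly_mapping_eqI)
  fix m
  show "coeff (hcomp (d + e) (p * q)) m = coeff (p * hcomp e q) m"
  proof (cases "int (mdeg m) = d + e")
    case True
    have "m \<notin> supp (p * (q - hcomp e q))"
    proof
      assume "m \<in> supp (p * (q - hcomp e q))"
      then obtain s t where st: "m = s + t" "s \<in> supp p" "t \<in> supp (q - hcomp e q)"
        using keys_mult[of p "q - hcomp e q"] by auto
      have "int (mdeg s) = d" using assms st by (simp add: homogeneous_def)
      then have "int (mdeg t) = e" using True st(1) by (simp add: mdeg_add)
      then show False using st(3) by (simp add: in_keys_iff lookup_minus lookup_hcomp)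
    qed
    then have "coeff (p * q - p * hcomp e q) m = 0"
      by (simp add: in_keys_iff right_diff_distrib)
    then show ?thesis using True by (simp add: lookup_hcomp lookup_minus)
  next
    case False
    then have "coeff (p * hcomp e q) m = 0"
      using homogeneous_mult[OF assms homogeneous_hcomp, of e q] by (simp add: homogeneous_lookup)
    then show ?thesis using False by (simp add: lookup_hcomp)
  qed
qed

lemma graded_piece_mult:
  "a \<in> graded_piece V d \<Longrightarrow> b \<in> graded_piece V e \<Longrightarrow> a * b \<in> graded_piece V (d + e)"
  by (simp add: graded_piece_def poly_ring_mult homogeneous_mult)

lemma graded_piece_sum: "(\<And>x. x \<in> B \<Longrightarrow> f x \<in> graded_piece V d) \<Longrightarrow> sum f B \<in> graded_piece V d"
  by (simp add: graded_piece_def poly_ring_sum homogeneous_sum)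

definition vcomp :: "nat \<Rightarrow> (nat \<Rightarrow> int) \<Rightarrow> int \<Rightarrow> ('v, 'k::field) pvec \<Rightarrow> ('v, 'k) pvec" where
  "vcomp r s d a = (\<lambda>l. if l < r then hcomp (d - s l) (a l) else 0)"

lemma vcomp_in: "a \<in> free_module V r \<Longrightarrow> vcomp r s d a \<in> gvec V r s d"
  by (simp add: vcomp_def gvec_def free_module_def hcomp_graded_piece)

lemma vcomp_gvec: "a \<in> gvec V r s d \<Longrightarrow> vcomp r s d a = a"
  by (rule ext) (auto simp: vcomp_def gvec_def graded_piece_def hcomp_homogeneous)

lemma gvec_free_module: "gvec V r s d \<subseteq> free_module V r"
  by (auto simp: gvec_def free_module_def graded_piece_def)

lemma free_module_sum: "(\<And>x. x \<in> B \<Longrightarrow> f x \<in> free_module V r) \<Longrightarrow> sum f B \<in> free_module V r"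
  by (simp add: free_module_def sum_fun_apply poly_ring_sum)

lemma vcomp_decomposition:
  assumes "a \<in> free_module V r"
  obtains D where "finite D" "a = (\<Sum>d\<in>D. vcomp r s d a)"
proof -
  define D where "D = (\<Union>l<r. (\<lambda>m. int (mdeg m) + s l) ` supp (a l))"
  have fin: "finite D" by (simp add: D_def)
  have "a l = (\<Sum>d\<in>D. vcomp r s d a) l" for l
  proof (cases "l < r")
    case True
    have "coeff (\<Sum>d\<in>D. hcomp (d - s l) (a l)) m = coeff (a l) m" for m
    proof -
      have "coeff (\<Sum>d\<in>D. hcomp (d - s l) (a l)) m =
          (\<Sum>d\<in>D. if d = int (mdeg m) + s l then coeff (a l) m else 0)"
        unfolding lookup_sum by (rule sum.cong) (auto simp: lookup_hcomp)
      also have "\<dots> = (if int (mdeg m) + s l \<in> D then coeff (a l) m else 0)"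
        using fin by simp
      also have "\<dots> = coeff (a l) m"
      proof -
        have "int (mdeg m) + s l \<in> D" if "m \<in> supp (a l)"
          using True that unfolding D_def by blast
        then show ?thesis by (auto simp: in_keys_iff)
      qed
      finally show ?thesis .
    qed
    then show ?thesis using True by (simp add: sum_fun_apply vcomp_def poly_mapping_eqI)
  next
    case False
    then show ?thesis using assms by (simp add: sum_fun_apply vcomp_def free_module_def)
  qed
  then show ?thesis using that fin by blast
qed

section \<open>Graded matrices\<close>

definition mat_map :: "nat \<Rightarrow> nat \<Rightarrow> (nat \<Rightarrow> nat \<Rightarrow> ('v, 'k::field) mpolynomial) \<Rightarrow> ('v, 'k) pvec \<Rightarrow> ('v, 'k) pvec" where
  "mat_map r r' M a = (\<lambda>k. if k < r then \<Sum>l<r'. M k l * a l else 0)"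

definition graded_mat where
  "graded_mat V r s r' s' M \<longleftrightarrow> (\<forall>k<r. \<forall>l<r'. M k l \<in> graded_piece V (s' l - s k))"

lemma bd_map_mat_map: "bd_map F i = mat_map (rank F i) (rank F (Suc i)) (bd F i)"
  by (simp add: fun_eq_iff bd_map_def mat_map_def)

lemma mat_map_add: "mat_map r r' M (a + b) = mat_map r r' M a + mat_map r r' M b"
  by (simp add: fun_eq_iff mat_map_def distrib_left sum.distrib)

lemma mat_map_zero: "mat_map r r' M 0 = 0"
  by (simp add: fun_eq_iff mat_map_def)

lemma mat_map_sum: "mat_map r r' M (sum f B) = (\<Sum>x\<in>B. mat_map r r' M (f x))"
  by (auto simp: fun_eq_iff mat_map_def sum_fun_apply sum_distrib_left intro: sum.swap)

lemma mat_map_scale: "mat_map r r' M (\<lambda>l. q * a l) = (\<lambda>k. q * mat_map r r' M a k)"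
  by (simp add: fun_eq_iff mat_map_def sum_distrib_left mult.left_commute)

lemma mat_map_vmult: "mat_map r r' M (vmult v a) = vmult v (mat_map r r' M a)"
  unfolding vmult_def by (rule mat_map_scale)

lemma mat_map_gvec:
  assumes "graded_mat V r s r' s' M" "a \<in> gvec V r' s' d"
  shows "mat_map r r' M a \<in> gvec V r s d"
proof -
  have "M k l * a l \<in> graded_piece V (d - s k)" if "k < r" "l < r'" for k l
  proof -
    have "M k l * a l \<in> graded_piece V ((s' l - s k) + (d - s' l))"
      using assms that by (intro graded_piece_mult) (auto simp: graded_mat_def gvec_def)
    moreover have "(s' l - s k) + (d - s' l) = d - s k" by simp
    ultimately show ?thesis by (simp only:)
  qed
  then show ?thesis by (auto simp: gvec_def mat_map_def intro: graded_piece_sum)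
qed

lemma mat_map_free_module:
  assumes "graded_mat V r s r' s' M" "a \<in> free_module V r'"
  shows "mat_map r r' M a \<in> free_module V r"
  using assms by (auto simp: free_module_def mat_map_def graded_mat_def graded_piece_def
      intro!: poly_ring_sum poly_ring_mult)

lemma mat_map_vcomp:
  assumes "graded_mat V r s r' s' M"
  shows "mat_map r r' M (vcomp r' s' d a) = vcomp r s d (mat_map r r' M a)"
proof
  fix k
  show "mat_map r r' M (vcomp r' s' d a) k = vcomp r s d (mat_map r r' M a) k"
  proof (cases "k < r")
    case True
    have "hcomp (d - s k) (M k l * a l) = M k l * hcomp (d - s' l) (a l)" if "l < r'" for l
    proof -
      have "homogeneous (s' l - s k) (M k l)"
        using assms True that by (simp add: graded_mat_def graded_piece_def)
      from hcomp_mult[OF this, of "d - s' l" "a l"] show ?thesis by simp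
    qed
    then show ?thesis using True by (simp add: mat_map_def vcomp_def hcomp_sum)
  qed (simp add: mat_map_def vcomp_def)
qed

lemma mat_presentation:
  fixes M :: "nat \<Rightarrow> nat \<Rightarrow> ('v, 'k::field) mpolynomial"
  assumes fin: "finite V" and inj: "inj_on ord V" and M: "graded_mat V r s r' s' M"
    and S: "gsub V vmult S" "\<And>d. S d = mat_map r r' M ` gvec V r' s' d"
    and Z: "\<And>d. Z d = {a \<in> gvec V r' s' d. mat_map r r' M a = 0}"
    and min: "\<And>a d k. a \<in> Z d \<Longrightarrow> coeff (a k) 0 = 0"
  shows "minimal_presentation ord V vmult S (\<lambda>_. {0}) r' s' (mat_map r r' M) Z"
proof (rule minimal_presentation.intro)
  show "koszul ord V (vmult :: 'v \<Rightarrow> ('v, 'k) pvec \<Rightarrow> _)" by (rule koszul_vmult[OF fin inj])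
  show "gsub V vmult S" by (rule S)
  show "gsub V (vmult :: 'v \<Rightarrow> ('v, 'k) pvec \<Rightarrow> _) (\<lambda>_. {0})" by (auto simp: gsub_def vmult_def fun_eq_iff)
  show "{0} \<subseteq> S d" for d using gsub_zero[OF S(1)] by simp
  show "mat_map r r' M a \<in> S d" if "a \<in> gvec V r' s' d" for a d using that S(2) by blast
  show "\<exists>a\<in>gvec V r' s' d. m - mat_map r r' M a \<in> {0}" if "m \<in> S d" for m d using that S(2) by auto
  show "Z d = {a \<in> gvec V r' s' d. mat_map r r' M a \<in> {0}}" for d by (simp add: Z)
  show "coeff (a k) 0 = 0" if "a \<in> Z d" for a d k using min that .
qed (auto simp: mat_map_add mat_map_vmult)

section \<open>Generator degrees of an arbitrary minimal resolution\<close>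

locale edge_ideal_setup =
  fixes ord :: "'v \<Rightarrow> nat" and V :: "'v set" and E :: "'v set set"
    and I :: "('v, 'k::field) mpolynomial set"
  assumes finV: "finite V" and inj: "inj_on ord V"
    and E: "\<And>e. e \<in> E \<Longrightarrow> e \<subseteq> V" and ne: "{} \<notin> E" and I: "I = edge_ideal V E"
begin

abbreviation koszul_nz :: "int \<Rightarrow> nat \<Rightarrow> bool" where
  "koszul_nz j p \<equiv> hom_nz ord V (pmult :: 'v \<Rightarrow> ('v, 'k) mpolynomial \<Rightarrow> _)
     (shifted (graded_piece V) j) (shifted (\<lambda>d. graded_piece V d \<inter> I) j) p"

lemma koszul_nz_iff: "koszul_nz j p \<longleftrightarrow> (\<exists>\<sigma>\<subseteq>V. int (card \<sigma>) = j \<and> betti_nz TYPE('k) ord E p \<sigma>)"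
  unfolding I by (rule koszul_homology_edge_ideal[OF finV inj E])

lemma I_iff: "q \<in> I \<longleftrightarrow> q \<in> poly_ring V \<and> (\<forall>m. indep E (supp m) \<longrightarrow> coeff q m = 0)"
  unfolding I by (rule edge_ideal_iff[OF finV E])

lemma I_zero: "0 \<in> I"
  and I_add: "a \<in> I \<Longrightarrow> b \<in> I \<Longrightarrow> a + b \<in> I"
  and I_diff: "a \<in> I \<Longrightarrow> b \<in> I \<Longrightarrow> a - b \<in> I"
  and I_hcomp: "a \<in> I \<Longrightarrow> hcomp d a \<in> I"
  by (auto simp: I_iff poly_ring_add poly_ring_diff lookup_add lookup_minus lookup_hcomp poly_ring_lookup)

lemma I_mult:
  assumes "q \<in> poly_ring V" "a \<in> I"
  shows "q * a \<in> I"
proof -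
  obtain c where a: "a = (\<Sum>e\<in>E. c e * (\<Prod>v\<in>e. pvar v))" and c: "\<forall>e\<in>E. c e \<in> poly_ring V"
    using assms(2) by (auto simp: I edge_ideal_def)
  have "q * a = (\<Sum>e\<in>E. (q * c e) * (\<Prod>v\<in>e. pvar v))"
    unfolding a by (simp add: sum_distrib_left mult.assoc)
  then show ?thesis unfolding I edge_ideal_def using c assms(1) by (auto intro!: poly_ring_mult)
qed

lemma I_sum: "(\<And>x. x \<in> B \<Longrightarrow> f x \<in> I) \<Longrightarrow> sum f B \<in> I"
  by (induction B rule: infinite_finite_induct) (auto simp: I_zero I_add)

lemma I_no_constant: "q \<in> I \<Longrightarrow> coeff q 0 = 0"
proof -
  assume "q \<in> I"
  moreover have "indep E (supp 0)" using ne by (auto simp: indep_def)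
  ultimately show ?thesis unfolding I_iff by blast
qed

lemma gsub_I: "gsub V pmult (\<lambda>d. graded_piece V d \<inter> I)"
  unfolding gsub_def
  by (auto simp: graded_piece_simps I_zero I_add I_diff) (simp add: pmult_def I_mult pvar_poly_ring)

text \<open>The kernel of the map out of the \<open>i\<close>-th free module in degree
  \<open>d\<close>; for \<open>i = 0\<close> the target is R/I.\<close>

definition syz :: "('v, 'k) graded_free_complex \<Rightarrow> nat \<Rightarrow> int \<Rightarrow> ('v, 'k) pvec set" where
  "syz F i d = {a \<in> gvec V (rank F i) (shift F i) d.
     (case i of 0 \<Rightarrow> aug_map F a \<in> I | Suc i' \<Rightarrow> bd_map F i' a = 0)}"

context
  fixes F :: "('v, 'k) graded_free_complex"
  assumes F: "minimal_graded_free_resolution V I F"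
begin

lemma graded_mat_bd: "graded_mat V (rank F i) (shift F i) (rank F (Suc i)) (shift F (Suc i)) (bd F i)"
  using F by (simp add: minimal_graded_free_resolution_def graded_free_resolution_def graded_mat_def graded_piece_def)

lemma aug_graded: "l < rank F 0 \<Longrightarrow> aug F l \<in> graded_piece V (shift F 0 l)"
  using F by (simp add: minimal_graded_free_resolution_def graded_free_resolution_def graded_piece_def)

lemma aug_map_gvec:
  assumes "a \<in> gvec V (rank F 0) (shift F 0) d"
  shows "aug_map F a \<in> graded_piece V d"
  unfolding aug_map_def
proof (rule graded_piece_sum)
  fix l assume l: "l \<in> {..<rank F 0}"
  have "aug F l * a l \<in> graded_piece V (shift F 0 l + (d - shift F 0 l))"
    using aug_graded assms l by (intro graded_piece_mult) (auto simp: gvec_def)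
  then show "aug F l * a l \<in> graded_piece V d" by simp
qed

lemma aug_map_vcomp: "aug_map F (vcomp (rank F 0) (shift F 0) d a) = hcomp d (aug_map F a)"
proof -
  have "hcomp d (aug F l * a l) = aug F l * hcomp (d - shift F 0 l) (a l)" if "l < rank F 0" for l
    using hcomp_mult[of "shift F 0 l" "aug F l" "d - shift F 0 l" "a l"] aug_graded[OF that]
    by (simp add: graded_piece_def)
  then show ?thesis by (simp add: aug_map_def vcomp_def hcomp_sum)
qed

lemma exact:
  assumes "a \<in> free_module V (rank F i)"
  shows "(case i of 0 \<Rightarrow> aug_map F a \<in> I | Suc i' \<Rightarrow> bd_map F i' a = 0) \<longleftrightarrow>
    a \<in> bd_map F i ` free_module V (rank F (Suc i))"
  using F assms
  by (auto simp: minimal_graded_free_resolution_def graded_free_resolution_def zero_fun_def split: nat.split)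

text \<open>Exactness is given for all vectors. As the maps have degree 0, passing to the component
  of degree \<open>d\<close> turns a preimage into a homogeneous one.\<close>

lemma syz_image: "syz F i d = bd_map F i ` gvec V (rank F (Suc i)) (shift F (Suc i)) d"
proof
  show "syz F i d \<subseteq> bd_map F i ` gvec V (rank F (Suc i)) (shift F (Suc i)) d"
  proof
    fix a assume a: "a \<in> syz F i d"
    then have ag: "a \<in> gvec V (rank F i) (shift F i) d" by (simp add: syz_def)
    then have "a \<in> free_module V (rank F i)" using gvec_free_module by blast
    then obtain b where b: "b \<in> free_module V (rank F (Suc i))" "a = bd_map F i b"
      using exact a by (auto simp: syz_def)
    let ?b = "vcomp (rank F (Suc i)) (shift F (Suc i)) d b"
    have "bd_map F i ?b = vcomp (rank F i) (shift F i) d (bd_map F i b)"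
      unfolding bd_map_mat_map by (rule mat_map_vcomp[OF graded_mat_bd])
    also have "\<dots> = a" using vcomp_gvec[OF ag] b(2) by simp
    finally show "a \<in> bd_map F i ` gvec V (rank F (Suc i)) (shift F (Suc i)) d"
      using vcomp_in[OF b(1)] by blast
  qed
next
  show "bd_map F i ` gvec V (rank F (Suc i)) (shift F (Suc i)) d \<subseteq> syz F i d"
  proof
    fix a assume "a \<in> bd_map F i ` gvec V (rank F (Suc i)) (shift F (Suc i)) d"
    then obtain b where b: "b \<in> gvec V (rank F (Suc i)) (shift F (Suc i)) d" "a = bd_map F i b" by blast
    have ag: "a \<in> gvec V (rank F i) (shift F i) d"
      unfolding b(2) bd_map_mat_map by (rule mat_map_gvec[OF graded_mat_bd b(1)])
    have "a \<in> bd_map F i ` free_module V (rank F (Suc i))" using b gvec_free_module by blast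
    moreover have "a \<in> free_module V (rank F i)" using ag gvec_free_module by blast
    ultimately show "a \<in> syz F i d" unfolding syz_def using exact[of a i] ag by blast
  qed
qed

lemma syz_no_constant:
  assumes "a \<in> syz F i d"
  shows "coeff (a k) 0 = 0"
proof -
  obtain b where "a = bd_map F i b" using assms syz_image by auto
  moreover have "coeff (bd F i k l) 0 = 0" if "k < rank F i" "l < rank F (Suc i)" for l
    using F that by (simp add: minimal_graded_free_resolution_def)
  ultimately show ?thesis by (simp add: bd_map_def lookup_sum lookup_0_mult)
qed

lemma presentation_0:
  "minimal_presentation ord V pmult (graded_piece V) (\<lambda>d. graded_piece V d \<inter> I)
     (rank F 0) (shift F 0) (aug_map F) (syz F 0)"
proof (rule minimal_presentation.intro)
  show "koszul ord V (pmult :: 'v \<Rightarrow> ('v, 'k) mpolynomial \<Rightarrow> _)" by (rule koszul_pmult[OF finV inj])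
  show "gsub V (pmult :: 'v \<Rightarrow> ('v, 'k) mpolynomial \<Rightarrow> _) (graded_piece V)" by (rule gsub_graded_piece)
  show "gsub V pmult (\<lambda>d. graded_piece V d \<inter> I)" by (rule gsub_I)
  show "aug_map F (a + b) = aug_map F a + aug_map F b" for a b
    by (simp add: aug_map_def distrib_left sum.distrib)
  show "aug_map F (vmult v a) = pmult v (aug_map F a)" for v a
    by (simp add: aug_map_def vmult_def pmult_def sum_distrib_left mult.left_commute)
  show "aug_map F a \<in> graded_piece V d" if "a \<in> gvec V (rank F 0) (shift F 0) d" for a d
    using aug_map_gvec[OF that] .
  show "\<exists>a\<in>gvec V (rank F 0) (shift F 0) d. m - aug_map F a \<in> graded_piece V d \<inter> I"
    if m: "m \<in> graded_piece V d" for m d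
  proof -
    have "m \<in> poly_ring V" using m by (simp add: graded_piece_def)
    then obtain a where a: "a \<in> free_module V (rank F 0)" "m - aug_map F a \<in> I"
      using F by (auto simp: minimal_graded_free_resolution_def graded_free_resolution_def)
    let ?a = "vcomp (rank F 0) (shift F 0) d a"
    have ag: "?a \<in> gvec V (rank F 0) (shift F 0) d" by (rule vcomp_in[OF a(1)])
    have "m - aug_map F ?a = hcomp d (m - aug_map F a)"
      using m by (simp add: aug_map_vcomp hcomp_diff hcomp_homogeneous graded_piece_def)
    then have "m - aug_map F ?a \<in> I" using I_hcomp[OF a(2)] by simp
    moreover have "m - aug_map F ?a \<in> graded_piece V d"
      using m aug_map_gvec[OF ag] by (simp add: graded_piece_simps)
    ultimately show ?thesis using ag by blast
  qed
  show "syz F 0 d = {a \<in> gvec V (rank F 0) (shift F 0) d. aug_map F a \<in> graded_piece V d \<inter> I}" for d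
    using aug_map_gvec by (auto simp: syz_def)
  show "coeff (a k) 0 = 0" if "a \<in> syz F 0 d" for a d k using syz_no_constant[OF that] .
qed simp

lemma gsub_syz: "gsub V vmult (syz F i)"
proof (cases i)
  case 0
  interpret minimal_presentation ord V pmult "graded_piece V" "\<lambda>d. graded_piece V d \<inter> I"
    "rank F 0" "shift F 0" "aug_map F" "syz F 0" by (rule presentation_0)
  show ?thesis unfolding 0 by (rule gsub_Z)
next
  case (Suc i')
  have "0 \<in> syz F i d" for d by (simp add: Suc syz_def gsub_zero[OF gsub_gvec] bd_map_mat_map mat_map_zero)
  moreover have "a + b \<in> syz F i d" if "a \<in> syz F i d" "b \<in> syz F i d" for a b d
    using that by (simp add: Suc syz_def gsub_add[OF gsub_gvec] bd_map_mat_map mat_map_add)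
  moreover have "a - b \<in> syz F i d" if "a \<in> syz F i d" "b \<in> syz F i d" for a b d
  proof -
    have "mat_map r r' M (a - b) + mat_map r r' M b = mat_map r r' M a" for r r' and M :: "nat \<Rightarrow> nat \<Rightarrow> ('v, 'k) mpolynomial"
      using mat_map_add[of r r' M "a - b" b] by simp
    then show ?thesis
      using that by (simp add: Suc syz_def gsub_diff[OF gsub_gvec] bd_map_mat_map) (metis add_0_right)
  qed
  moreover have "vmult v a \<in> syz F i (d + 1)" if "v \<in> V" "a \<in> syz F i d" for v a d
    using that by (simp add: Suc syz_def gsub_X[OF gsub_gvec] bd_map_mat_map mat_map_vmult) (simp add: vmult_def fun_eq_iff)
  ultimately show ?thesis by (simp add: gsub_def)
qed

text \<open>Minimality of the resolution enters here as \<open>syz_no_constant\<close> for the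
  kernel of the covering map.\<close>

lemma presentation_Suc:
  "minimal_presentation ord V vmult (syz F i) (\<lambda>_. {0}) (rank F (Suc i)) (shift F (Suc i))
     (bd_map F i) (syz F (Suc i))"
  unfolding bd_map_mat_map
proof (rule mat_presentation[OF finV inj graded_mat_bd gsub_syz])
  show "syz F i d = mat_map (rank F i) (rank F (Suc i)) (bd F i) ` gvec V (rank F (Suc i)) (shift F (Suc i)) d" for d
    using syz_image by (simp add: bd_map_mat_map)
  show "syz F (Suc i) d = {a \<in> gvec V (rank F (Suc i)) (shift F (Suc i)) d.
      mat_map (rank F i) (rank F (Suc i)) (bd F i) a = 0}" for d
    by (simp add: syz_def bd_map_mat_map)
  show "coeff (a k) 0 = 0" if "a \<in> syz F (Suc i) d" for a d k using syz_no_constant[OF that] .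
qed

text \<open>Dimension shifting: each passage to the next syzygies lowers the homological degree by
  one.\<close>

lemma hom_nz_syz: "hom_nz ord V vmult (shifted (syz F i) j) (\<lambda>_. {0}) p \<longleftrightarrow> koszul_nz j (Suc (i + p))"
proof (induction i arbitrary: p)
  case 0
  show ?case
    unfolding add_0 by (rule minimal_presentation.shift_degree[OF presentation_0, symmetric])
next
  case (Suc i)
  have "hom_nz ord V vmult (shifted (syz F (Suc i)) j) (\<lambda>_. {0}) p \<longleftrightarrow>
      hom_nz ord V vmult (shifted (syz F i) j) (\<lambda>_. {0}) (Suc p)"
    by (rule minimal_presentation.shift_degree[OF presentation_Suc, symmetric])
  also have "\<dots> \<longleftrightarrow> koszul_nz j (Suc (Suc i + p))" by (simp only: Suc.IH add_Suc_right add_Suc)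
  finally show ?case .
qed

text \<open>The generators of the \<open>i\<close>-th module are seen by the degree 0 homology of
  what it covers, and this is the homology of R/I in degree \<open>i\<close>. As \<open>F\<close> is
  any minimal resolution, the result covers the one selected in \<open>graded_betti\<close>.\<close>

theorem generator_degrees_iff: "(\<exists>l<rank F i. shift F i l = j) \<longleftrightarrow> koszul_nz j i"
proof (cases i)
  case 0
  show ?thesis
    unfolding 0 by (rule minimal_presentation.generator_degree[OF presentation_0, symmetric])
next
  case (Suc i')
  have "(\<exists>l<rank F i. shift F i l = j) \<longleftrightarrow> hom_nz ord V vmult (shifted (syz F i') j) (\<lambda>_. {0}) 0"
    unfolding Suc by (rule minimal_presentation.generator_degree[OF presentation_Suc, symmetric])
  also have "\<dots> \<longleftrightarrow> koszul_nz j (Suc (i' + 0))" by (rule hom_nz_syz)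
  finally show ?thesis by (simp only: Suc add_0_right)
qed

end

end

section \<open>Existence of minimal resolutions\<close>

definition vscale :: "'k::field \<Rightarrow> ('v, 'k) pvec \<Rightarrow> ('v, 'k) pvec" where
  "vscale c a = (\<lambda>k. monom 0 c * a k)"

lemma vector_space_vscale: "vector_space (vscale :: 'k::field \<Rightarrow> ('v, 'k) pvec \<Rightarrow> _)"
  by unfold_locales
     (simp_all add: vscale_def fun_eq_iff distrib_left distrib_right single_add mult.assoc[symmetric] mult_single)

lemma gvec_finite_span:
  assumes "finite V"
  shows "\<exists>B. finite B \<and> (gvec V r s d :: ('v, 'k::field) pvec set) \<subseteq> module.span vscale B"
proof -
  interpret vs: vector_space "vscale :: 'k \<Rightarrow> ('v, 'k) pvec \<Rightarrow> _" by (rule vector_space_vscale)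
  define u :: "nat \<times> ('v \<Rightarrow>\<^sub>0 nat) \<Rightarrow> ('v, 'k) pvec"
    where "u = (\<lambda>(k, m) i. if i = k then monom m 1 else 0)"
  define P where "P = (SIGMA k:{..<r}. {m. supp m \<subseteq> V \<and> mdeg m \<le> nat (d - s k)})"
  have finP: "finite P" unfolding P_def using finite_monomials[OF assms] by auto
  have "a \<in> vs.span (u ` P)" if a: "a \<in> gvec V r s d" for a
  proof -
    have eq: "a = (\<Sum>k<r. \<Sum>m\<in>supp (a k). vscale (coeff (a k) m) (u (k, m)))"
    proof
      fix i
      have "(\<Sum>k<r. \<Sum>m\<in>supp (a k). vscale (coeff (a k) m) (u (k, m))) i =
          (\<Sum>k<r. if k = i then \<Sum>m\<in>supp (a k). monom m (coeff (a k) m) else 0)"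
        unfolding sum_fun_apply
        by (rule sum.cong) (auto simp: vscale_def u_def mult_single)
      also have "\<dots> = (if i < r then a i else 0)" by (simp add: sum_monomials)
      also have "\<dots> = a i" using a by (simp add: gvec_def)
      finally show "a i = (\<Sum>k<r. \<Sum>m\<in>supp (a k). vscale (coeff (a k) m) (u (k, m))) i" by simp
    qed
    have P: "(k, m) \<in> P" if "k < r" "m \<in> supp (a k)" for k m
    proof -
      have "a k \<in> graded_piece V (d - s k)" using a that by (simp add: gvec_def)
      then have "supp m \<subseteq> V" "int (mdeg m) = d - s k"
        using that(2) by (auto simp: graded_piece_def poly_ring_def homogeneous_def)
      then show ?thesis using that by (simp add: P_def)
    qed
    have "(\<Sum>k<r. \<Sum>m\<in>supp (a k). vscale (coeff (a k) m) (u (k, m))) \<in> vs.span (u ` P)"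
      using P by (intro vs.span_sum vs.span_scale vs.span_base) auto
    then show ?thesis unfolding eq[symmetric] .
  qed
  then show ?thesis using finP by (intro exI[of _ "u ` P"]) auto
qed

lemma gvec_subset_basis:
  assumes "finite V" "Z \<subseteq> (gvec V r s d :: ('v, 'k::field) pvec set)"
  shows "\<exists>B. finite B \<and> B \<subseteq> Z \<and> (\<forall>z\<in>Z. \<exists>c. z = (\<Sum>b\<in>B. vscale (c b) b))"
proof -
  interpret vs: vector_space "vscale :: 'k \<Rightarrow> ('v, 'k) pvec \<Rightarrow> _" by (rule vector_space_vscale)
  obtain G where G: "finite G" "Z \<subseteq> vs.span G" using gvec_finite_span[OF assms(1), of r s d] assms(2) by blast
  obtain B where B: "B \<subseteq> Z" "vs.independent B" "Z \<subseteq> vs.span B" using vs.maximal_independent_subset by blast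
  have fB: "finite B" using vs.independent_span_bound[OF G(1) B(2)] B(1) G(2) by blast
  then have "\<exists>c. z = (\<Sum>b\<in>B. vscale (c b) b)" if "z \<in> Z" for z
    using that B(3) vs.span_finite[OF fB] by auto
  then show ?thesis using fB B(1) by blast
qed

text \<open>A generator is stored with its degree, since the vector alone does not determine it: the
  zero vector lies in every piece.\<close>

definition generated :: "'v set \<Rightarrow> (int \<times> ('v, 'k::field) pvec) set \<Rightarrow> int \<Rightarrow> ('v, 'k) pvec \<Rightarrow> bool" where
  "generated V G d z \<longleftrightarrow> (\<exists>c. (\<forall>g\<in>G. c g \<in> graded_piece V (d - fst g)) \<and> z = (\<lambda>k. \<Sum>g\<in>G. c g * snd g k))"

lemma generated_sum:
  assumes "\<And>x. x \<in> B \<Longrightarrow> generated V G d (f x)"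
  shows "generated V G d (sum f B)"
proof -
  have "\<forall>x\<in>B. \<exists>c. (\<forall>g\<in>G. c g \<in> graded_piece V (d - fst g)) \<and> f x = (\<lambda>k. \<Sum>g\<in>G. c g * snd g k)"
    using assms unfolding generated_def by blast
  from bchoice[OF this] obtain c
    where c: "\<forall>x\<in>B. (\<forall>g\<in>G. c x g \<in> graded_piece V (d - fst g)) \<and> f x = (\<lambda>k. \<Sum>g\<in>G. c x g * snd g k)" ..
  have "sum f B = (\<lambda>k. \<Sum>g\<in>G. (\<Sum>x\<in>B. c x g) * snd g k)"
  proof
    fix k
    have "sum f B k = (\<Sum>x\<in>B. \<Sum>g\<in>G. c x g * snd g k)"
      unfolding sum_fun_apply using c by (intro sum.cong) auto
    also have "\<dots> = (\<Sum>g\<in>G. \<Sum>x\<in>B. c x g * snd g k)" by (rule sum.swap)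
    finally show "sum f B k = (\<Sum>g\<in>G. (\<Sum>x\<in>B. c x g) * snd g k)" by (simp add: sum_distrib_right)
  qed
  moreover have "\<forall>g\<in>G. (\<Sum>x\<in>B. c x g) \<in> graded_piece V (d - fst g)"
    using c by (auto intro: graded_piece_sum)
  ultimately show ?thesis unfolding generated_def by (intro exI[of _ "\<lambda>g. \<Sum>x\<in>B. c x g"]) blast
qed

lemma generated_mult:
  assumes "generated V G d z" "q \<in> graded_piece V e"
  shows "generated V G (d + e) (\<lambda>k. q * z k)"
proof -
  obtain c where c: "\<forall>g\<in>G. c g \<in> graded_piece V (d - fst g)" "z = (\<lambda>k. \<Sum>g\<in>G. c g * snd g k)"
    using assms(1) unfolding generated_def by blast
  have "q * c g \<in> graded_piece V (d + e - fst g)" if "g \<in> G" for g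
  proof -
    have "q * c g \<in> graded_piece V (e + (d - fst g))" using c(1) that assms(2) by (intro graded_piece_mult) auto
    moreover have "e + (d - fst g) = d + e - fst g" by simp
    ultimately show ?thesis by (simp only:)
  qed
  then show ?thesis unfolding generated_def c(2)
    by (intro exI[of _ "\<lambda>g. q * c g"]) (auto simp: sum_distrib_left mult.assoc)
qed

lemma sum_fun_scaled: "(\<Sum>g\<in>G. (\<lambda>k. c g * snd g k)) = (\<lambda>k. \<Sum>g\<in>G. c g * snd g k)"
  by (rule ext) (simp add: sum_fun_apply)

lemma generated_base:
  assumes "finite G" "g \<in> G" "q \<in> graded_piece V (d - fst g)"
  shows "generated V G d (\<lambda>k. q * snd g k)"
  unfolding generated_def
proof (intro exI[of _ "\<lambda>h. if h = g then q else 0"] conjI ballI ext)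
  fix h show "(if h = g then q else 0) \<in> graded_piece V (d - fst h)" using assms(3) by (simp add: graded_piece_simps)
next
  fix k
  have "(\<Sum>h\<in>G. (if h = g then q else 0) * snd h k) = (\<Sum>h\<in>G. if h = g then q * snd g k else 0)"
    by (rule sum.cong) auto
  then show "q * snd g k = (\<Sum>h\<in>G. (if h = g then q else 0) * snd h k)" using assms(1,2) by simp
qed

lemma generated_remove:
  assumes "finite G" "g \<in> G" "generated V (G - {g}) (fst g) (snd g)" "generated V G d z"
  shows "generated V (G - {g}) d z"
proof -
  obtain c where c: "\<forall>g\<in>G. c g \<in> graded_piece V (d - fst g)" "z = (\<lambda>k. \<Sum>g\<in>G. c g * snd g k)"
    using assms(4) unfolding generated_def by blast
  have z: "z = (\<Sum>h\<in>G. (\<lambda>k. c h * snd h k))" unfolding c(2) sum_fun_scaled ..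
  show ?thesis
    unfolding z
  proof (rule generated_sum)
    fix h assume h: "h \<in> G"
    show "generated V (G - {g}) d (\<lambda>k. c h * snd h k)"
    proof (cases "h = g")
      case True
      have "generated V (G - {g}) (fst g + (d - fst g)) (\<lambda>k. c g * snd g k)"
        using assms(2,3) c(1) by (intro generated_mult) auto
      then show ?thesis using True by simp
    next
      case False
      then show ?thesis using assms(1) h c(1) by (intro generated_base) auto
    qed
  qed
qed

definition graded_submodule :: "'v set \<Rightarrow> nat \<Rightarrow> (nat \<Rightarrow> int) \<Rightarrow> (int \<Rightarrow> ('v, 'k::field) pvec set) \<Rightarrow> bool" where
  "graded_submodule V r s Z \<longleftrightarrow> gsub V vmult Z \<and> (\<forall>d. Z d \<subseteq> gvec V r s d) \<and>
     (\<forall>d e. \<forall>a\<in>Z d. \<forall>q\<in>graded_piece V e. (\<lambda>k. q * a k) \<in> Z (d + e))"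

text \<open>No appeal to Hilbert's basis theorem is needed: in degrees above \<open>n\<close> the submodule \<open>Z\<close> is
  contained in the maximal ideal times \<open>Z\<close>, so its pieces of degree at most \<open>n\<close> generate.\<close>

lemma finite_generation:
  fixes Z :: "int \<Rightarrow> ('v, 'k::field) pvec set"
  assumes fin: "finite V" and Z: "graded_submodule V r s Z"
    and top: "\<And>j. j > n \<Longrightarrow> \<not> hom_nz ord V vmult (shifted Z j) (\<lambda>_. {0}) 0"
  shows "\<exists>G. finite G \<and> (\<forall>g\<in>G. snd g \<in> Z (fst g)) \<and> (\<forall>d. \<forall>z\<in>Z d. generated V G d z)"
proof -
  have sub: "\<And>d. Z d \<subseteq> gvec V r s d" using Z by (simp add: graded_submodule_def)
  \<comment> \<open>A lower bound for all \<open>s k\<close>: every piece below \<open>d0\<close> is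
    zero, so only finitely many degrees up to \<open>n\<close> remain.\<close>
  define d0 where "d0 = - (\<Sum>k<r. \<bar>s k\<bar>)"
  have d0: "d0 \<le> s k" if "k < r" for k
  proof -
    have "\<bar>s k\<bar> \<le> (\<Sum>k<r. \<bar>s k\<bar>)" using that by (intro member_le_sum) auto
    then show ?thesis by (simp add: d0_def)
  qed
  have low: "z = 0" if "z \<in> Z d" "d < d0" for z d
  proof
    fix k
    have zg: "z \<in> gvec V r s d" using that sub by blast
    show "z k = 0 k"
    proof (cases "k < r")
      case True
      have "z k \<in> graded_piece V (d - s k)" using zg True by (simp add: gvec_def)
      moreover have "d - s k < 0" using d0[OF True] that(2) by simp
      ultimately show ?thesis by (intro poly_mapping_eqI) (auto simp: graded_piece_lookup)
    next
      case False
      then show ?thesis using zg by (simp add: gvec_def)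
    qed
  qed
  have "\<forall>d. \<exists>B. finite B \<and> B \<subseteq> Z d \<and> (\<forall>z\<in>Z d. \<exists>c. z = (\<Sum>b\<in>B. vscale (c b) b))"
    using gvec_subset_basis[OF fin sub] by blast
  from choice[OF this] obtain B where B': "\<forall>d. finite (B d) \<and> B d \<subseteq> Z d \<and> (\<forall>z\<in>Z d. \<exists>c. z = (\<Sum>b\<in>B d. vscale (c b) b))" ..
  then have B: "\<And>d. finite (B d)" "\<And>d. B d \<subseteq> Z d"
      "\<And>d z. z \<in> Z d \<Longrightarrow> \<exists>c. z = (\<Sum>b\<in>B d. vscale (c b) b)"
    by blast+
  define G where "G = (SIGMA d:{d0..n}. B d)"
  have finG: "finite G" using B(1) by (simp add: G_def)
  have small: "generated V G d z" if z: "z \<in> Z d" and d: "d \<le> n" for d z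
  proof (cases "d < d0")
    case True
    then have "z = 0" using low z by blast
    then show ?thesis unfolding generated_def
      by (intro exI[of _ "\<lambda>_. 0"]) (auto simp: graded_piece_simps fun_eq_iff)
  next
    case False
    obtain c where c: "z = (\<Sum>b\<in>B d. vscale (c b) b)" using B(3)[OF z] by blast
    show ?thesis unfolding c
    proof (rule generated_sum)
      fix b assume b: "b \<in> B d"
      have "(d, b) \<in> G" using b False d by (simp add: G_def)
      moreover have "monom 0 (c b) \<in> graded_piece V (d - fst (d, b))"
        by (simp add: graded_piece_def poly_ring_single homogeneous_def mdeg_def)
      ultimately show "generated V G d (vscale (c b) b)"
        using generated_base[OF finG, of "(d, b)" "monom 0 (c b)" V d] by (simp add: vscale_def)
    qed
  qed
  have "generated V G (n + int t) z" if "z \<in> Z (n + int t)" for t z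
    using that
  proof (induction t arbitrary: z)
    case 0
    then show ?case using small[of z n] by simp
  next
    case (Suc t)
    let ?j = "n + int (Suc t)"
    have "chain V (shifted Z ?j) 0 (\<lambda>_. z)"
      unfolding chain_def using Suc.prems by simp
    moreover have "cycle ord V vmult (\<lambda>_. {0}) 0 (\<lambda>_. z)" by (simp add: cycle_def)
    ultimately have "boundary ord V vmult (shifted Z ?j) (\<lambda>_. {0}) 0 (\<lambda>_. z)"
      using top[of ?j] unfolding hom_nz_def by fastforce
    then obtain D where D: "chain V (shifted Z ?j) (Suc 0) D"
        "chain V (\<lambda>_. {0}) 0 (\<lambda>A. z - koszul_d ord V vmult D A)"
      unfolding boundary_def by blast
    \<comment> \<open>Vanishing homology in degree 0 writes \<open>z\<close> as a combination of the
      variables with coefficients in \<open>Z\<close> one degree lower.\<close>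
    have "z - koszul_d ord V vmult D {} = 0" using D(2) unfolding chain_def by auto
    then have z: "z = koszul_d ord V vmult D {}" by (simp only: right_minus_eq)
    have koszul_d: "koszul_d ord V vmult D {} = (\<Sum>v\<in>V. vmult v (D {v}))"
      by (simp add: koszul_d_def below_def)
    show ?case unfolding z koszul_d
    proof (rule generated_sum)
      fix v assume v: "v \<in> V"
      have "D {v} \<in> Z (n + int t)" using D(1) v by (auto simp: chain_def)
      then have "generated V G (n + int t) (D {v})" by (rule Suc.IH)
      from generated_mult[OF this, of "pvar v" 1] v
      have "generated V G (n + int t + 1) (\<lambda>k. pvar v * D {v} k)"
        by (simp add: graded_piece_def pvar_poly_ring homogeneous_pvar)
      moreover have "n + int t + 1 = ?j" by simp
      ultimately show "generated V G ?j (vmult v (D {v}))" unfolding vmult_def by (simp only:)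
    qed
  qed
  then have "generated V G d z" if "z \<in> Z d" for d z
    using small[OF that] that zle_iff_zadd[of n d] by (cases "d \<le> n") auto
  moreover have "snd g \<in> Z (fst g)" if "g \<in> G" for g
    using that B(2)[of "fst g"] by (auto simp: G_def)
  ultimately show ?thesis using finG by blast
qed

text \<open>In a generating set of least cardinality no relation has a nonzero constant coefficient,
  since it would express one generator by the others. This is the graded form of Nakayama's
  lemma.\<close>

lemma minimal_generators:
  fixes Z :: "int \<Rightarrow> ('v, 'k::field) pvec set"
  assumes fin: "finite V" and Z: "graded_submodule V r s Z"
    and top: "\<And>j. j > n \<Longrightarrow> \<not> hom_nz ord V vmult (shifted Z j) (\<lambda>_. {0}) 0"
  shows "\<exists>r' s' M. graded_mat V r s r' s' M \<and> (\<forall>d. Z d = mat_map r r' M ` gvec V r' s' d) \<and>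
    (\<forall>k l. k < r \<longrightarrow> l < r' \<longrightarrow> (\<lambda>k. M k l) \<in> Z (s' l)) \<and>
    (\<forall>d. \<forall>a\<in>gvec V r' s' d. mat_map r r' M a = 0 \<longrightarrow> (\<forall>k. coeff (a k) 0 = 0))"
proof -
  have sub: "\<And>d. Z d \<subseteq> gvec V r s d"
    and mul: "\<And>d e a q. a \<in> Z d \<Longrightarrow> q \<in> graded_piece V e \<Longrightarrow> (\<lambda>k. q * a k) \<in> Z (d + e)"
    and gs: "gsub V vmult Z" using Z by (auto simp: graded_submodule_def)
  have Zsum: "sum f B \<in> Z d" if "\<And>x. x \<in> B \<Longrightarrow> f x \<in> Z d" for d f and B :: "'x set"
    using that by (induction B rule: infinite_finite_induct) (auto intro: gsub_zero[OF gs] gsub_add[OF gs])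
  define gen where "gen G \<longleftrightarrow> finite G \<and> (\<forall>g\<in>G. snd g \<in> Z (fst g)) \<and> (\<forall>d. \<forall>z\<in>Z d. generated V G d z)" for G
  have "\<exists>G. gen G" unfolding gen_def by (rule finite_generation[OF fin Z top])
  then obtain G where G: "gen G" "\<And>G'. gen G' \<Longrightarrow> card G \<le> card G'"
    using arg_min_nat_lemma[of gen _ card] by blast
  have finG: "finite G" and GZ: "\<And>g. g \<in> G \<Longrightarrow> snd g \<in> Z (fst g)"
    and gen: "\<And>d z. z \<in> Z d \<Longrightarrow> generated V G d z"
    using G(1) by (auto simp: gen_def)
  obtain h where h: "bij_betw h {..<card G} G" using ex_bij_betw_nat_finite[OF finG] by (auto simp: atLeast0LessThan)
  define r' where "r' = card G"
  define s' where "s' l = fst (h l)" for l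
  define M where "M k l = snd (h l) k" for k l
  have hG: "h l \<in> G" if "l < r'" for l using h that by (auto simp: bij_betw_def r'_def)
  have col: "(\<lambda>k. M k l) \<in> Z (s' l)" if "l < r'" for l using GZ[OF hG[OF that]] by (simp add: M_def s'_def)
  have gm: "graded_mat V r s r' s' M"
    unfolding graded_mat_def
  proof (intro allI impI)
    fix k l assume kl: "k < r" "l < r'"
    have "(\<lambda>k. M k l) \<in> gvec V r s (s' l)" using col[OF kl(2)] sub by blast
    then show "M k l \<in> graded_piece V (s' l - s k)" using kl by (simp add: gvec_def)
  qed
  have M0: "M k l = 0" if "\<not> k < r" "l < r'" for k l
  proof -
    have "(\<lambda>k. M k l) \<in> gvec V r s (s' l)" using col[OF that(2)] sub by blast
    then show ?thesis using that by (simp add: gvec_def)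
  qed
  have mm: "mat_map r r' M a = (\<Sum>l<r'. (\<lambda>k. a l * M k l))" for a
    by (rule ext) (auto simp: mat_map_def sum_fun_apply M0 mult.commute)
  have image: "Z d = mat_map r r' M ` gvec V r' s' d" for d
  proof
    show "mat_map r r' M ` gvec V r' s' d \<subseteq> Z d"
    proof clarify
      fix a :: "('v, 'k) pvec" assume a: "a \<in> gvec V r' s' d"
      show "mat_map r r' M a \<in> Z d"
        unfolding mm
      proof (rule Zsum)
        fix l assume l: "l \<in> {..<r'}"
        have "a l \<in> graded_piece V (d - s' l)" using a l by (simp add: gvec_def)
        with col[of l] l have "(\<lambda>k. a l * M k l) \<in> Z (s' l + (d - s' l))" by (intro mul) auto
        then show "(\<lambda>k. a l * M k l) \<in> Z d" by simp
      qed
    qed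
    show "Z d \<subseteq> mat_map r r' M ` gvec V r' s' d"
    proof
      fix z assume "z \<in> Z d"
      then obtain c where c: "\<forall>g\<in>G. c g \<in> graded_piece V (d - fst g)" "z = (\<lambda>k. \<Sum>g\<in>G. c g * snd g k)"
        using gen unfolding generated_def by blast
      define a where "a l = (if l < r' then c (h l) else 0)" for l
      have "a \<in> gvec V r' s' d" using c(1) hG by (simp add: a_def gvec_def s'_def)
      moreover have "z = mat_map r r' M a"
      proof
        fix k
        have "z k = (\<Sum>l<r'. c (h l) * snd (h l) k)"
          unfolding c(2) r'_def by (rule sum.reindex_bij_betw[OF h, symmetric])
        also have "\<dots> = mat_map r r' M a k"
          unfolding mm sum_fun_apply by (rule sum.cong) (auto simp: a_def M_def)
        finally show "z k = mat_map r r' M a k" .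
      qed
      ultimately show "z \<in> mat_map r r' M ` gvec V r' s' d" by blast
    qed
  qed
  have min: "coeff (a l) 0 = 0" if a: "a \<in> gvec V r' s' d" "mat_map r r' M a = 0" for a d l
  proof (rule ccontr)
    assume nz: "coeff (a l) 0 \<noteq> 0"
    then have l: "l < r'" using a(1) by (auto simp: gvec_def not_less[symmetric])
    have al: "a l \<in> graded_piece V (d - s' l)" using a(1) l by (simp add: gvec_def)
    then have "int (mdeg (0 :: 'v \<Rightarrow>\<^sub>0 nat)) = d - s' l" using nz unfolding graded_piece_lookup by blast
    then have d: "d = s' l" by (simp add: mdeg_def)
    \<comment> \<open>The coefficient \<open>a l\<close> has degree 0, so it is the invertible
      scalar \<gamma>, and the relation can be solved for the generator \<open>h l\<close>.\<close>
    define \<gamma> where "\<gamma> = coeff (a l) 0"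
    have "a l - monom 0 \<gamma> \<in> graded_piece V 0"
      using al d by (intro graded_piece_simps) (auto simp: graded_piece_def poly_ring_single homogeneous_def mdeg_def)
    then have al': "a l = monom 0 \<gamma>"
      using graded_piece_no_constant[of "a l - monom 0 \<gamma>" V 0] by (simp add: lookup_minus \<gamma>_def)
    have \<gamma>: "\<gamma> \<noteq> 0" using nz by (simp add: \<gamma>_def)
    let ?g = "h l" and ?i = "monom 0 (- inverse \<gamma>) :: ('v, 'k) mpolynomial"
    have inj: "h l' \<noteq> ?g" if "l' < r'" "l' \<noteq> l" for l'
      using h that l by (auto simp: bij_betw_def inj_on_def r'_def)
    have "snd ?g = (\<Sum>l'\<in>{..<r'} - {l}. (\<lambda>k. (?i * a l') * snd (h l') k))"
    proof
      fix k
      have "0 = mat_map r r' M a k" using a(2) by simp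
      also have "\<dots> = (\<Sum>l'<r'. a l' * M k l')" unfolding mm by (simp add: sum_fun_apply)
      also have "\<dots> = a l * M k l + (\<Sum>l'\<in>{..<r'} - {l}. a l' * M k l')"
        using l by (intro sum.remove) auto
      finally have "a l * M k l = - (\<Sum>l'\<in>{..<r'} - {l}. a l' * M k l')" by (simp add: eq_neg_iff_add_eq_0)
      then have "?i * (a l * M k l) = ?i * - (\<Sum>l'\<in>{..<r'} - {l}. a l' * M k l')" by simp
      moreover have "?i * (a l * M k l) = - M k l"
        using \<gamma> by (simp add: al' mult.assoc[symmetric] mult_single single_uminus)
      ultimately have "M k l = ?i * (\<Sum>l'\<in>{..<r'} - {l}. a l' * M k l')" by simp
      then show "snd ?g k = (\<Sum>l'\<in>{..<r'} - {l}. (\<lambda>k. (?i * a l') * snd (h l') k)) k"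
        by (simp add: sum_fun_apply M_def sum_distrib_left mult.assoc)
    qed
    moreover have "generated V (G - {?g}) (fst ?g) (\<Sum>l'\<in>{..<r'} - {l}. (\<lambda>k. (?i * a l') * snd (h l') k))"
    proof (rule generated_sum)
      fix l' assume l': "l' \<in> {..<r'} - {l}"
      have i0: "?i \<in> graded_piece V 0" by (simp add: graded_piece_def poly_ring_single homogeneous_def mdeg_def)
      have "a l' \<in> graded_piece V (fst ?g - fst (h l'))"
        using a(1) l' d by (simp add: gvec_def s'_def)
      from graded_piece_mult[OF i0 this]
      show "generated V (G - {?g}) (fst ?g) (\<lambda>k. (?i * a l') * snd (h l') k)"
        using finG hG[of l'] inj[of l'] l' by (intro generated_base) auto
    qed
    ultimately have "generated V (G - {?g}) (fst ?g) (snd ?g)" by (simp only:)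
    then have "gen (G - {?g})"
      unfolding gen_def using finG GZ gen generated_remove[OF finG hG[OF l]] by blast
    then have "card G \<le> card (G - {?g})" by (rule G(2))
    moreover have "card (G - {?g}) < card G" using finG hG[OF l] by (rule card_Diff1_less)
    ultimately show False by simp
  qed
  show ?thesis using gm image col min by blast
qed

lemma free_module_eq_0_iff:
  assumes "a \<in> free_module V r"
  shows "a = 0 \<longleftrightarrow> (\<forall>d. vcomp r s d a = 0)"
proof
  assume "a = 0"
  then show "\<forall>d. vcomp r s d a = 0" by (auto simp: vcomp_def)
next
  assume "\<forall>d. vcomp r s d a = 0"
  moreover obtain D where "a = (\<Sum>d\<in>D. vcomp r s d a)" using vcomp_decomposition[OF assms] .
  ultimately show "a = 0" by (metis sum.neutral)
qed

text \<open>Generators are found degree by degree, while exactness in a resolution speaks of all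
  vectors; homogeneous preimages of the components add up.\<close>

lemma mat_map_image_components:
  assumes M: "graded_mat V r s r' s' M" and a: "a \<in> free_module V r"
  shows "a \<in> mat_map r r' M ` free_module V r' \<longleftrightarrow> (\<forall>d. vcomp r s d a \<in> mat_map r r' M ` gvec V r' s' d)"
proof
  assume "a \<in> mat_map r r' M ` free_module V r'"
  then obtain b where b: "b \<in> free_module V r'" "a = mat_map r r' M b" by blast
  have "vcomp r s d a = mat_map r r' M (vcomp r' s' d b)" for d
    unfolding b(2) by (rule mat_map_vcomp[OF M, symmetric])
  then show "\<forall>d. vcomp r s d a \<in> mat_map r r' M ` gvec V r' s' d" using vcomp_in[OF b(1)] by blast
next
  assume R: "\<forall>d. vcomp r s d a \<in> mat_map r r' M ` gvec V r' s' d"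
  then have "\<forall>d. \<exists>b. b \<in> gvec V r' s' d \<and> vcomp r s d a = mat_map r r' M b" by blast
  from choice[OF this] obtain b where b: "\<forall>d. b d \<in> gvec V r' s' d \<and> vcomp r s d a = mat_map r r' M (b d)" ..
  obtain D where D: "a = (\<Sum>d\<in>D. vcomp r s d a)" using vcomp_decomposition[OF a] .
  also have "\<dots> = mat_map r r' M (\<Sum>d\<in>D. b d)"
    unfolding mat_map_sum using b by (intro sum.cong) auto
  finally have "a = mat_map r r' M (\<Sum>d\<in>D. b d)" .
  moreover have "(\<Sum>d\<in>D. b d) \<in> free_module V r'"
    using b gvec_free_module by (intro free_module_sum) blast
  ultimately show "a \<in> mat_map r r' M ` free_module V r'" by blast
qed

section \<open>Iterating syzygies\<close>

context edge_ideal_setup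
begin

text \<open>The invariant of the construction. Vanishing above \<open>card V\<close> starts from the
  squarefree multidegrees of R/I, is passed on by \<open>shift_degree\<close>, and is the bound that
  \<open>finite_generation\<close> asks for.\<close>

definition syzygy_module :: "nat \<times> (nat \<Rightarrow> int) \<times> (int \<Rightarrow> ('v, 'k) pvec set) \<Rightarrow> bool" where
  "syzygy_module x \<longleftrightarrow> (case x of (r, s, Z) \<Rightarrow> graded_submodule V r s Z \<and>
     (\<forall>d. \<forall>a\<in>Z d. \<forall>k. coeff (a k) 0 = 0) \<and>
     (\<forall>j p. j > int (card V) \<longrightarrow> \<not> hom_nz ord V vmult (shifted Z j) (\<lambda>_. {0}) p))"

definition covers :: "nat \<times> (nat \<Rightarrow> int) \<times> (int \<Rightarrow> ('v, 'k) pvec set) \<Rightarrow>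
    nat \<times> (nat \<Rightarrow> int) \<times> (int \<Rightarrow> ('v, 'k) pvec set) \<Rightarrow> (nat \<Rightarrow> nat \<Rightarrow> ('v, 'k) mpolynomial) \<Rightarrow> bool" where
  "covers x y M \<longleftrightarrow> (case (x, y) of ((r, s, Z), (r', s', Z')) \<Rightarrow> graded_mat V r s r' s' M \<and>
     (\<forall>d. Z d = mat_map r r' M ` gvec V r' s' d) \<and>
     (\<forall>d. Z' d = {a \<in> gvec V r' s' d. mat_map r r' M a = 0}) \<and>
     (\<forall>k<r. \<forall>l<r'. coeff (M k l) 0 = 0))"

lemma syzygy_module_step:
  assumes "syzygy_module x"
  shows "\<exists>y. syzygy_module y \<and> (\<exists>M. covers x y M)"
proof -
  obtain r s Z where x: "x = (r, s, Z)" by (metis prod_cases3)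
  have Z: "graded_submodule V r s Z" "\<And>d a k. a \<in> Z d \<Longrightarrow> coeff (a k) 0 = 0"
    "\<And>j p. j > int (card V) \<Longrightarrow> \<not> hom_nz ord V vmult (shifted Z j) (\<lambda>_. {0}) p"
    using assms by (auto simp: syzygy_module_def x)
  obtain r' s' M where M: "graded_mat V r s r' s' M" "\<forall>d. Z d = mat_map r r' M ` gvec V r' s' d"
    "\<forall>k l. k < r \<longrightarrow> l < r' \<longrightarrow> (\<lambda>k. M k l) \<in> Z (s' l)"
    "\<forall>d. \<forall>a\<in>gvec V r' s' d. mat_map r r' M a = 0 \<longrightarrow> (\<forall>k. coeff (a k) 0 = 0)"
    using minimal_generators[OF finV Z(1,3)] by blast
  define Z' where "Z' d = {a \<in> gvec V r' s' d. mat_map r r' M a = 0}" for d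
  have gs: "gsub V vmult Z" using Z(1) by (simp add: graded_submodule_def)
  interpret P: minimal_presentation ord V vmult Z "\<lambda>_. {0}" r' s' "mat_map r r' M" Z'
    by (rule mat_presentation[OF finV inj M(1) gs]) (use M in \<open>auto simp: Z'_def\<close>)
  have "graded_submodule V r' s' Z'"
    unfolding graded_submodule_def
  proof (intro conjI allI ballI)
    show "gsub V vmult Z'" by (rule P.gsub_Z)
    show "Z' d \<subseteq> gvec V r' s' d" for d by (auto simp: Z'_def)
    fix d e and a :: "('v, 'k) pvec" and q :: "('v, 'k) mpolynomial"
    assume a: "a \<in> Z' d" and q: "q \<in> graded_piece V e"
    have "q * a k \<in> graded_piece V (d + e - s' k)" if "k < r'" for k
    proof -
      have "q * a k \<in> graded_piece V (e + (d - s' k))"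
        using a q that by (intro graded_piece_mult) (auto simp: Z'_def gvec_def)
      moreover have "e + (d - s' k) = d + e - s' k" by simp
      ultimately show ?thesis by (simp only:)
    qed
    moreover have "mat_map r r' M (\<lambda>k. q * a k) = 0"
      unfolding mat_map_scale using a by (simp add: Z'_def zero_fun_def)
    ultimately show "(\<lambda>k. q * a k) \<in> Z' (d + e)" using a by (simp add: Z'_def gvec_def)
  qed
  moreover have "\<not> hom_nz ord V vmult (shifted Z' j) (\<lambda>_. {0}) p" if "j > int (card V)" for j p
    unfolding P.shift_degree[symmetric] by (rule Z(3)[OF that])
  ultimately have "syzygy_module (r', s', Z')" using P.minimal by (simp add: syzygy_module_def)
  \<comment> \<open>The columns of \<open>M\<close> lie in \<open>Z\<close>, whose vectors have no
    constant terms; this is minimality of the new differential.\<close>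
  moreover have "coeff (M k l) 0 = 0" if "k < r" "l < r'" for k l
    using Z(2)[of "\<lambda>k. M k l" "s' l" k] M(3) that by blast
  then have "covers x (r', s', Z') M" using M by (simp add: covers_def x Z'_def)
  ultimately show ?thesis by blast
qed

text \<open>The ideal, regarded as a submodule of the free module of rank 1; the recursion starts
  here.\<close>

definition syz0 :: "int \<Rightarrow> ('v, 'k) pvec set" where
  "syz0 d = {a \<in> gvec V 1 (\<lambda>_. 0) d. a 0 \<in> I}"

lemma syzygy_module_0: "syzygy_module (1, (\<lambda>_. 0), syz0)"
proof -
  interpret P: minimal_presentation ord V pmult "graded_piece V" "\<lambda>d. graded_piece V d \<inter> I" 1 "\<lambda>_. 0"
    "\<lambda>a. a 0" syz0
  proof (rule minimal_presentation.intro)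
    show "koszul ord V (pmult :: 'v \<Rightarrow> ('v, 'k) mpolynomial \<Rightarrow> _)" by (rule koszul_pmult[OF finV inj])
    show "gsub V (pmult :: 'v \<Rightarrow> ('v, 'k) mpolynomial \<Rightarrow> _) (graded_piece V)" by (rule gsub_graded_piece)
    show "gsub V pmult (\<lambda>d. graded_piece V d \<inter> I)" by (rule gsub_I)
    show "\<exists>a\<in>gvec V 1 (\<lambda>_. 0) d. m - a 0 \<in> graded_piece V d \<inter> I" if "m \<in> graded_piece V d" for m d
      using that by (intro bexI[of _ "\<lambda>k. if k = 0 then m else 0"]) (auto simp: gvec_def graded_piece_simps I_zero)
    show "syz0 d = {a \<in> gvec V 1 (\<lambda>_. 0) d. a 0 \<in> graded_piece V d \<inter> I}" for d
      by (auto simp: syz0_def gvec_def)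
    show "coeff (a k) 0 = 0" if "a \<in> syz0 d" for a d k
      using that I_no_constant[of "a 0"] by (cases "k = 0") (auto simp: syz0_def gvec_def)
  qed (auto simp: vmult_def pmult_def gvec_def)
  have "graded_submodule V 1 (\<lambda>_. 0) syz0"
    unfolding graded_submodule_def
  proof (intro conjI allI ballI)
    show "gsub V vmult syz0" by (rule P.gsub_Z)
    show "syz0 d \<subseteq> gvec V 1 (\<lambda>_. 0) d" for d by (auto simp: syz0_def)
    fix d e and a :: "('v, 'k) pvec" and q :: "('v, 'k) mpolynomial"
    assume a: "a \<in> syz0 d" and q: "q \<in> graded_piece V e"
    have "q * a 0 \<in> graded_piece V (e + d)" using a q by (intro graded_piece_mult) (auto simp: syz0_def gvec_def)
    moreover have "q * a 0 \<in> I" using a q by (intro I_mult) (auto simp: syz0_def graded_piece_def)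
    ultimately show "(\<lambda>k. q * a k) \<in> syz0 (d + e)" using a by (simp add: syz0_def gvec_def add.commute)
  qed
  moreover have "\<not> hom_nz ord V vmult (shifted syz0 j) (\<lambda>_. {0}) p" if "j > int (card V)" for j p
    unfolding P.shift_degree[symmetric] koszul_nz_iff
  proof
    assume "\<exists>\<sigma>\<subseteq>V. int (card \<sigma>) = j \<and> betti_nz TYPE('k) ord E (Suc p) \<sigma>"
    then obtain \<sigma> where "\<sigma> \<subseteq> V" "int (card \<sigma>) = j" by blast
    then show False using that card_mono[OF finV, of \<sigma>] by simp
  qed
  ultimately show ?thesis using P.minimal by (simp add: syzygy_module_def)
qed

theorem minimal_resolution_exists: "\<exists>F. minimal_graded_free_resolution V I F"
proof -
  let ?x0 = "(1 :: nat, (\<lambda>_. 0) :: nat \<Rightarrow> int, syz0)"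
  \<comment> \<open>Dependent choice strings the syzygy modules together; each covering matrix
    becomes a differential.\<close>
  have "\<exists>f. \<forall>n. (syzygy_module (f n) \<and> (n = 0 \<longrightarrow> f n = ?x0)) \<and> (\<exists>M. covers (f n) (f (Suc n)) M)"
  proof (rule dependent_nat_choice[where P = "\<lambda>n x. syzygy_module x \<and> (n = 0 \<longrightarrow> x = ?x0)"
        and Q = "\<lambda>n x y. \<exists>M. covers x y M"])
    show "\<exists>x. syzygy_module x \<and> (0 = (0::nat) \<longrightarrow> x = ?x0)" using syzygy_module_0 by blast
    fix x :: "nat \<times> (nat \<Rightarrow> int) \<times> (int \<Rightarrow> ('v, 'k) pvec set)" and n :: nat
    assume "syzygy_module x \<and> (n = 0 \<longrightarrow> x = ?x0)"
    then show "\<exists>y. (syzygy_module y \<and> (Suc n = 0 \<longrightarrow> y = ?x0)) \<and> (\<exists>M. covers x y M)"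
      using syzygy_module_step[of x] by simp
  qed
  then obtain f where fM: "\<forall>n. (syzygy_module (f n) \<and> (n = 0 \<longrightarrow> f n = ?x0)) \<and> (\<exists>M. covers (f n) (f (Suc n)) M)" ..
  then have f0: "f 0 = ?x0" and ex: "\<forall>n. \<exists>M. covers (f n) (f (Suc n)) M" by blast+
  from choice[OF ex] obtain M where M: "\<forall>n. covers (f n) (f (Suc n)) (M n)" ..
  define r where "r n = fst (f n)" for n
  define s where "s n = fst (snd (f n))" for n
  define Z where "Z n = snd (snd (f n))" for n
  have f: "f n = (r n, s n, Z n)" for n by (simp add: r_def s_def Z_def)
  have cov: "graded_mat V (r n) (s n) (r (Suc n)) (s (Suc n)) (M n)"
    "\<And>d. Z n d = mat_map (r n) (r (Suc n)) (M n) ` gvec V (r (Suc n)) (s (Suc n)) d"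
    "\<And>d. Z (Suc n) d = {a \<in> gvec V (r (Suc n)) (s (Suc n)) d. mat_map (r n) (r (Suc n)) (M n) a = 0}"
    "\<And>k l. k < r n \<Longrightarrow> l < r (Suc n) \<Longrightarrow> coeff (M n k l) 0 = 0" for n
    using M[rule_format, of n] unfolding f covers_def by simp_all
  have z0: "r 0 = 1" "s 0 = (\<lambda>_. 0)" "Z 0 = syz0" using f0 f[of 0] by simp_all
  define F where "F = \<lparr>rank = r, shift = s, bd = M, aug = (\<lambda>_. 1)\<rparr>"
  have F: "rank F = r" "shift F = s" "bd F = M" "aug F = (\<lambda>_. 1)" by (simp_all add: F_def)
  have bd: "bd_map F n = mat_map (r n) (r (Suc n)) (M n)" for n by (simp add: bd_map_mat_map F)
  have aug: "aug_map F a = a 0" for a by (simp add: aug_map_def F z0)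
  have "graded_free_resolution V I F"
    unfolding graded_free_resolution_def
  proof (intro conjI allI impI ballI)
    fix l assume "l < rank F 0"
    then show "aug F l \<in> poly_ring V" "homogeneous (shift F 0 l) (aug F l)"
      by (simp_all add: F z0 homogeneous_def mdeg_def)
  next
    fix i k l assume "k < rank F i" "l < rank F (Suc i)"
    then show "bd F i k l \<in> poly_ring V" "homogeneous (shift F (Suc i) l - shift F i k) (bd F i k l)"
      using cov(1)[of i] by (simp_all add: F graded_mat_def graded_piece_def)
  next
    fix p :: "('v, 'k) mpolynomial" assume "p \<in> poly_ring V"
    then show "\<exists>a\<in>free_module V (rank F 0). p - aug_map F a \<in> I"
      by (intro bexI[of _ "\<lambda>k. if k = 0 then p else 0"]) (auto simp: aug I_zero free_module_def F z0)
  next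
    fix a :: "('v, 'k) pvec" assume a: "a \<in> free_module V (rank F 0)"
    then have a': "a \<in> free_module V (r 0)" by (simp add: F)
    have "a \<in> bd_map F 0 ` free_module V (rank F 1) \<longleftrightarrow> (\<forall>d. vcomp (r 0) (s 0) d a \<in> Z 0 d)"
      unfolding bd F One_nat_def mat_map_image_components[OF cov(1) a'] cov(2) ..
    also have "\<dots> \<longleftrightarrow> (\<forall>d. hcomp d (a 0) \<in> I)"
      using vcomp_in[OF a'] by (simp add: z0 syz0_def vcomp_def)
    also have "\<dots> \<longleftrightarrow> a 0 \<in> I"
    proof
      assume R: "\<forall>d. hcomp d (a 0) \<in> I"
      obtain D where D: "a = (\<Sum>d\<in>D. vcomp (r 0) (s 0) d a)" using vcomp_decomposition[OF a'] .
      have "a 0 = (\<Sum>d\<in>D. vcomp (r 0) (s 0) d a) 0" using D by (rule fun_cong)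
      also have "\<dots> = (\<Sum>d\<in>D. hcomp d (a 0))" by (simp add: sum_fun_apply vcomp_def z0)
      also have "\<dots> \<in> I" using R by (intro I_sum) auto
      finally show "a 0 \<in> I" .
    qed (auto simp: I_hcomp)
    finally show "aug_map F a \<in> I \<longleftrightarrow> a \<in> bd_map F 0 ` free_module V (rank F 1)" by (simp add: aug)
  next
    fix i and a :: "('v, 'k) pvec" assume "a \<in> free_module V (rank F (Suc i))"
    then have a: "a \<in> free_module V (r (Suc i))" by (simp add: F)
    let ?m = "mat_map (r i) (r (Suc i)) (M i)"
    have "a \<in> bd_map F (Suc i) ` free_module V (rank F (Suc (Suc i))) \<longleftrightarrow>
        (\<forall>d. vcomp (r (Suc i)) (s (Suc i)) d a \<in> Z (Suc i) d)"
      unfolding bd F mat_map_image_components[OF cov(1) a] cov(2)[of "Suc i"] ..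
    also have "\<dots> \<longleftrightarrow> (\<forall>d. ?m (vcomp (r (Suc i)) (s (Suc i)) d a) = 0)"
      unfolding cov(3) using vcomp_in[OF a] by blast
    also have "\<dots> \<longleftrightarrow> ?m a = 0"
      unfolding mat_map_vcomp[OF cov(1)] free_module_eq_0_iff[OF mat_map_free_module[OF cov(1) a], of "s i"] ..
    finally show "bd_map F i a = (\<lambda>_. 0) \<longleftrightarrow>
        a \<in> bd_map F (Suc i) ` free_module V (rank F (Suc (Suc i)))" by (simp add: bd zero_fun_def)
  qed
  moreover have "coeff (bd F i k l) 0 = 0" if "k < rank F i" "l < rank F (Suc i)" for i k l
    using cov(4) that by (simp add: F)
  ultimately show ?thesis by (auto simp: minimal_graded_free_resolution_def)
qed

theorem graded_betti_nonzero_iff: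
  "graded_betti V I i j \<noteq> 0 \<longleftrightarrow> (\<exists>\<sigma>\<subseteq>V. int (card \<sigma>) = j \<and> betti_nz TYPE('k) ord E i \<sigma>)"
proof -
  define F where "F = (SOME F. minimal_graded_free_resolution V I F)"
  have F: "minimal_graded_free_resolution V I F"
    unfolding F_def using minimal_resolution_exists by (rule someI_ex)
  have "graded_betti V I i j \<noteq> 0 \<longleftrightarrow> (\<exists>l<rank F i. shift F i l = j)"
    by (auto simp: graded_betti_def F_def[symmetric] Let_def)
  then show ?thesis unfolding generator_degrees_iff[OF F] koszul_nz_iff .
qed

end

theorem theorem2p18:
  fixes V :: "'v set" and E :: "'v set set" and a b :: nat
    and I :: "('v, 'k::field) mpolynomial set"
  assumes "graph_class V E"
    and "I = edge_ideal V E"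
    and "enat (a + b) \<le> proj_dim V I"
  shows "max_shift V I (a + b) \<le> max_shift V I a + max_shift V I b"
proof -
  have sg: "finite V" "\<And>e. e \<in> E \<Longrightarrow> e \<subseteq> V \<and> card e = 2"
    using graph_class_simple_graph[OF assms(1)] by (auto simp: simple_graph_def)
  \<comment> \<open>Any numbering of the vertices will do; it fixes the signs in the Koszul
    complex.\<close>
  obtain ord :: "'v \<Rightarrow> nat" where inj: "inj_on ord V"
    using finite_imp_inj_to_nat_seg[OF sg(1)] by blast
  interpret edge_ideal_setup ord V E I
    using sg(1) sg(2)[of "{}"] sg(2) inj assms(2) by unfold_locales auto
  interpret vertex_order "TYPE('k)" ord V
    using sg inj by unfold_locales auto
  show ?thesis
    unfolding max_shift_def[of V I "a + b"]
  proof (rule SUP_least)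
    fix j assume "j \<in> {j. graded_betti V I (a + b) j \<noteq> 0}"
    then obtain \<sigma> where \<sigma>: "\<sigma> \<subseteq> V" "int (card \<sigma>) = j" "betti_nz TYPE('k) ord E (a + b) \<sigma>"
      unfolding mem_Collect_eq graded_betti_nonzero_iff by blast
    have "subadd_at E \<sigma>" using subadd_graph_class[OF assms(1)] \<sigma>(1) by (simp add: subadd_def)
    from subadd_atD[OF this \<sigma>(3)] obtain \<sigma>1 \<sigma>2 where s: "\<sigma>1 \<subseteq> \<sigma>" "\<sigma>2 \<subseteq> \<sigma>"
      "betti_nz TYPE('k) ord E a \<sigma>1" "betti_nz TYPE('k) ord E b \<sigma>2" "card \<sigma> \<le> card \<sigma>1 + card \<sigma>2" .
    have up: "ereal (real_of_int (int (card \<tau>))) \<le> max_shift V I i"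
      if "\<tau> \<subseteq> \<sigma>" "betti_nz TYPE('k) ord E i \<tau>" for \<tau> i
    proof -
      have "\<tau> \<subseteq> V" using that(1) \<sigma>(1) by blast
      then have "graded_betti V I i (int (card \<tau>)) \<noteq> 0" unfolding graded_betti_nonzero_iff using that(2) by blast
      then show ?thesis unfolding max_shift_def by (intro SUP_upper) simp
    qed
    have "ereal (real_of_int j) \<le> ereal (real_of_int (int (card \<sigma>1))) + ereal (real_of_int (int (card \<sigma>2)))"
      using s(5) \<sigma>(2) by simp
    also have "\<dots> \<le> max_shift V I a + max_shift V I b"
      by (rule add_mono[OF up[OF s(1,3)] up[OF s(2,4)]])
    finally show "ereal (real_of_int j) \<le> max_shift V I a + max_shift V I b" .
  qed
qed

end
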